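(* Let $N\ge1$ and let $H\in C^2(\mathbf{R}^N\times\mathbf{R}^N;\mathbf{R})$ satisfy: there exist $\kappa>0$ and $h\in C(\mathbf{R};\mathbf{R}_+)$ with $h(r)/r\to0$ as $r\to+\infty$ such that $|\nabla_\xi H(x,\xi)|\le\kappa(1+|\xi|)$, $|\nabla_x H(x,\xi)|\le h(|x|)+\kappa|\xi|$, $|\nabla^2H(x,\xi)|\le\kappa$ for all $(x,\xi)$. Let $\Phi_t=(X_t,\Xi_t)$ be its Hamiltonian flow. Let $U^{in}$ be a continuous vector field on $\mathbf{R}^N$ with $|U^{in}(y)|/|y|\to0$ as $|y|\to\infty$ and such that for every bounded open $\Omega\subset\mathbf{R}^N$ and all $k,l$, $\partial_lU^{in}_k|_\Omega\in L^{N,1}(\Omega)$. Let $\rho^{in}$ be a probability density on $\mathbf{R}^N$, $\mu^{in}$ the monokinetic measure with momentum profile $U^{in}$ and density $\rho^{in}$, $\mu(t):=\Phi_t\#\mu^{in}$, $\rho(t):=\Pi\#\mu(t)$, and $\Lambda_t:=\Phi_t(\{(x,U^{in}(x)):x\in\mathbf{R}^N\})$. (a) For each $t\in\mathbf{R}$, $\mathrm{supp}(\mu(t))\subset\Lambda_t$. (b) Let $t\in\mathbf{R}$ and let $\rho(t)=\rho_a(t)+\rho_s(t)$ be the Lebesgue decomposition of $\rho(t)$ with respect to $\mathcal{L}^N$, with $\rho_a(t)\ll\mathcal{L}^N$ and $\rho_s(t)\perp\mathcal{L}^N$. Then $\rho_s(t)$ is carried by $C_t$, and $$\rho_a(t)=F_t\#(\rho^{in}\mathbf{1}_{P_t}\mathcal{L}^N),\qquad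 \rho_s(t)=F_t\#(\rho^{in}\mathbf{1}_{Z_t}\mathcal{L}^N).$$
   Context: $\Phi_t(x,\xi)=(X_t(x,\xi),\Xi_t(x,\xi))$ solves $\dot X=\nabla_\xi H(X,\Xi)$, $\dot\Xi=-\nabla_xH(X,\Xi)$, $\Phi_0=\mathrm{Id}$. $L^{N,1}(\Omega)$ is the Lorentz space of measurable $f$ with $\int_0^\infty(\mathcal{L}^N(\{|f|\ge\lambda\}))^{1/N}d\lambda<\infty$; then $U^{in}$ is differentiable outside the Lebesgue-null set $E$ of its non-differentiability points. $F_t(y):=X_t(y,U^{in}(y))$; for $y\notin E$, $J_t(y):=|\det DF_t(y)|$; $P_t:=\{y\in\mathbf{R}^N\setminus E: J_t(y)>0\}$, $Z_t:=\{y\in\mathbf{R}^N\setminus E: J_t(y)=0\}$; $C_t:=\{x: F_t^{-1}(\{x\})\cap(Z_t\cup E)\ne\emptyset\}$. The monokinetic measure $\mu^{in}$ is defined by $\iint\phi\,d\mu^{in}=\int\phi(x,U^{in}(x))\rho^{in}(x)dx$ for $\phi\in C_c(\mathbf{R}^N\times\mathbf{R}^N)$. $\Pi(x,\xi):=x$ and $\#$ denotes push-forward. *)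

theory Defs
  imports "HOL-Analysis.Analysis"
begin

type_synonym 'n vec = "real ^ 'n"

definition test_fun_on :: "('n::finite) vec set \<Rightarrow> ('n vec \<Rightarrow> real) \<Rightarrow> bool" where
  "test_fun_on \<Omega> \<phi> \<longleftrightarrow>
     (\<exists>D\<phi>. (\<forall>x. (\<phi> has_derivative blinfun_apply (D\<phi> x)) (at x)) \<and> continuous_on UNIV D\<phi>) \<and>
     compact (closure {x. \<phi> x \<noteq> 0}) \<and> closure {x. \<phi> x \<noteq> 0} \<subseteq> \<Omega>"

definition weak_partial_on ::
  "('n::finite) vec set \<Rightarrow> ('n vec \<Rightarrow> real) \<Rightarrow> 'n vec \<Rightarrow> ('n vec \<Rightarrow> real) \<Rightarrow> bool" where
  "weak_partial_on \<Omega> f e g \<longleftrightarrow>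
     (\<forall>K. compact K \<and> K \<subseteq> \<Omega> \<longrightarrow> set_integrable lebesgue K g) \<and>
     (\<forall>\<phi>. test_fun_on \<Omega> \<phi> \<longrightarrow>
        (\<integral>x. f x * frechet_derivative \<phi> (at x) e \<partial>lebesgue) = - (\<integral>x. g x * \<phi> x \<partial>lebesgue))"

definition lorentz_N1 :: "('n::finite) vec set \<Rightarrow> ('n vec \<Rightarrow> real) \<Rightarrow> bool" where
  "lorentz_N1 \<Omega> g \<longleftrightarrow> g \<in> borel_measurable (restrict_space lebesgue \<Omega>) \<and>
     (\<integral>\<^sup>+ s. indicator {0<..} s *
        ennreal (measure lebesgue {x\<in>\<Omega>. s \<le> \<bar>g x\<bar>} powr (1 / real CARD('n))) \<partial>lborel) < \<infinity>"

definition measure_support :: "'a::metric_space measure \<Rightarrow> 'a set" where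
  "measure_support M = {z. \<forall>e>0. emeasure M (ball z e) > 0}"

definition singular_lebesgue :: "('n::finite) vec measure \<Rightarrow> bool" where
  "singular_lebesgue M \<longleftrightarrow> (\<exists>S\<in>sets borel. emeasure lborel S = 0 \<and> emeasure M (UNIV - S) = 0)"

definition monokinetic :: "(('n::finite) vec \<Rightarrow> 'n vec) \<Rightarrow> ('n vec \<Rightarrow> real) \<Rightarrow> ('n vec \<times> 'n vec) measure" where
  "monokinetic U \<rho> = distr (density lebesgue (\<lambda>x. ennreal (\<rho> x))) borel (\<lambda>x. (x, U x))"

definition Eset :: "(('n::finite) vec \<Rightarrow> 'n vec) \<Rightarrow> 'n vec set" where
  "Eset U = {y. \<not> U differentiable (at y)}"

definition Fmap :: "(real \<Rightarrow> ('n::finite) vec \<times> 'n vec \<Rightarrow> 'n vec \<times> 'n vec) \<Rightarrow> ('n vec \<Rightarrow> 'n vec) \<Rightarrow> real \<Rightarrow> 'n vec \<Rightarrow> 'n vec" where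
  "Fmap \<Phi> U t y = fst (\<Phi> t (y, U y))"

definition Jac :: "(real \<Rightarrow> ('n::finite) vec \<times> 'n vec \<Rightarrow> 'n vec \<times> 'n vec) \<Rightarrow> ('n vec \<Rightarrow> 'n vec) \<Rightarrow> real \<Rightarrow> 'n vec \<Rightarrow> real" where
  "Jac \<Phi> U t y = \<bar>det (matrix (frechet_derivative (Fmap \<Phi> U t) (at y)))\<bar>"

definition Pset :: "(real \<Rightarrow> ('n::finite) vec \<times> 'n vec \<Rightarrow> 'n vec \<times> 'n vec) \<Rightarrow> ('n vec \<Rightarrow> 'n vec) \<Rightarrow> real \<Rightarrow> 'n vec set" where
  "Pset \<Phi> U t = {y. y \<notin> Eset U \<and> Jac \<Phi> U t y > 0}"

definition Zset :: "(real \<Rightarrow> ('n::finite) vec \<times> 'n vec \<Rightarrow> 'n vec \<times> 'n vec) \<Rightarrow> ('n vec \<Rightarrow> 'n vec) \<Rightarrow> real \<Rightarrow> 'n vec set" where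
  "Zset \<Phi> U t = {y. y \<notin> Eset U \<and> Jac \<Phi> U t y = 0}"

definition Cset :: "(real \<Rightarrow> ('n::finite) vec \<times> 'n vec \<Rightarrow> 'n vec \<times> 'n vec) \<Rightarrow> ('n vec \<Rightarrow> 'n vec) \<Rightarrow> real \<Rightarrow> 'n vec set" where
  "Cset \<Phi> U t = {x. \<exists>y \<in> Zset \<Phi> U t \<union> Eset U. Fmap \<Phi> U t y = x}"

end

theory Submission
  imports Defs
begin

text \<open>
The flow is bi-Lipschitz and differentiable by Gronwall's inequality, so the image of the (closed) graph of
the momentum profile is closed, which gives (a).

For (b), the set E is null by Stein's theorem. The difference of two values of a Sobolev function is
controlled by Riesz potentials of its gradient, with kernel of degree 1 - N; since the integral of that kernel
over a set of measure m is at most a constant times m^(1/N), the layer cake formula bounds these potentials by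
the Lorentz functional of the gradient on a ball. After subtracting an affine function this bound is o(r) on
balls of radius r around almost every point: this is clear for a continuous gradient, and such gradients
are dense, with the error controlled by a weak type estimate from Vitali's covering theorem.

On the complement of E the map F_t is differentiable. It pulls null sets back to null sets on P_t, where its
local inverses are Lipschitz, and it maps Z_t to a null set by Sard's theorem. Hence the two push-forwards are the
absolutely continuous and the singular part, and an inner approximation of Z_t by compact sets shows that the
latter is carried by a Borel subset of C_t.
\<close>

section \<open>Flows of Lipschitz vector fields\<close>

text \<open>Differentiability of the flow has to come from the equation alone. Instead of solving
  the linearised equation, the proof shows that differences of trajectories respect linear relations
  up to a relative error, and obtains the derivative as a limit of difference quotients.

  Test functions are only C^1, the momentum profile is continuous, and no mollification is used:
  point values are recovered from averages against radial bumps that are divergences away from their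
  centre, so that changing the scale or moving the centre pairs the weak gradient with an explicit
  test function.

  The obstacle in the Lorentz part is that the functional involves a root of a measure and so is not
  additive over disjoint balls if N > 1. A linear upper bound for the root, tuned to each ball, is
  what makes the covering argument sum up.

  In (b) the given pair \<open>\<rho>a\<close>, \<open>\<rho>s\<close> is arbitrary. The two
  push-forwards are shown to be a decomposition as well, and uniqueness transfers the formulas and
  the carrier.\<close>

lemma gronwall_zero_start:
  fixes v :: "real \<Rightarrow> 'a::real_inner"
  assumes der: "\<And>s. \<lbrakk>0 \<le> s; s \<le> t\<rbrakk> \<Longrightarrow> (v has_vector_derivative v' s) (at s)"
    and bd: "\<And>s. \<lbrakk>0 \<le> s; s \<le> t\<rbrakk> \<Longrightarrow> norm (v' s) \<le> K * norm (v s) + \<delta>"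
    and "0 \<le> t" "0 \<le> K" "0 \<le> \<delta>"
  shows "norm (v t) \<le> exp ((K + 1) * t) * (norm (v 0) + \<delta>)"
proof -
  \<comment> \<open>The squared norm avoids differentiating the norm at zeros of \<open>v\<close>.
    Adding \<open>\<delta>\<^sup>2\<close> lets 2|v|\<delta> \<le> |v|^2 + \<delta>^2 absorb the
    forcing, which costs the extra 1 in the rate 2K + 1. The two uses are \<delta> = 0 (Lipschitz
    bounds of the flow) and \<open>v 0 = 0\<close> (its linearisation).\<close>
  define q where "q s = ((norm (v s))\<^sup>2 + \<delta>\<^sup>2) * exp (- (2 * K + 1) * s)" for s
  define q' where "q' s = (2 * (v s \<bullet> v' s) - (2 * K + 1) * ((norm (v s))\<^sup>2 + \<delta>\<^sup>2)) * exp (- (2 * K + 1) * s)" for s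
  have qd: "DERIV q s :> q' s" if "0 \<le> s" "s \<le> t" for s
  proof -
    have v: "(v has_derivative (\<lambda>h. h *\<^sub>R v' s)) (at s)"
      using der[OF that] by (simp add: has_vector_derivative_def)
    have "((\<lambda>s. (v s \<bullet> v s + \<delta>\<^sup>2) * exp (- (2 * K + 1) * s)) has_derivative (\<lambda>h. h * q' s)) (at s)"
      unfolding q'_def
      by (auto intro!: derivative_eq_intros v simp: fun_eq_iff algebra_simps inner_commute power2_norm_eq_inner)
    then show ?thesis
      unfolding q_def by (simp add: has_field_derivative_def power2_norm_eq_inner mult.commute[of _ "q' s"])
  qed
  have "q' s \<le> 0" if s: "0 \<le> s" "s \<le> t" for s
  proof -
    have "v s \<bullet> v' s \<le> norm (v s) * (K * norm (v s) + \<delta>)"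
      by (meson bd s mult_left_mono norm_cauchy_schwarz norm_ge_zero order_trans)
    moreover have "2 * (norm (v s) * \<delta>) \<le> (norm (v s))\<^sup>2 + \<delta>\<^sup>2"
      using sum_squares_bound[of "norm (v s)" \<delta>] by (simp add: mult.assoc)
    moreover have "0 \<le> K * \<delta>\<^sup>2" using \<open>0 \<le> K\<close> by simp
    ultimately have "2 * (v s \<bullet> v' s) - (2 * K + 1) * ((norm (v s))\<^sup>2 + \<delta>\<^sup>2) \<le> 0"
      by (simp add: algebra_simps power2_eq_square)
    then show ?thesis unfolding q'_def by (simp add: mult_nonpos_nonneg)
  qed
  then have "q t \<le> q 0"
    using DERIV_nonpos_imp_nonincreasing[of 0 t q] \<open>0 \<le> t\<close> qd by fastforce
  then have "(norm (v t))\<^sup>2 + \<delta>\<^sup>2 \<le> ((norm (v 0))\<^sup>2 + \<delta>\<^sup>2) * exp ((2 * K + 1) * t)"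
  proof -
    assume "q t \<le> q 0"
    then have "q t * exp ((2 * K + 1) * t) \<le> q 0 * exp ((2 * K + 1) * t)" by simp
    also have "q t * exp ((2 * K + 1) * t) =
        ((norm (v t))\<^sup>2 + \<delta>\<^sup>2) * (exp (- (2 * K + 1) * t) * exp ((2 * K + 1) * t))"
      by (simp add: q_def)
    also have "exp (- (2 * K + 1) * t) * exp ((2 * K + 1) * t) = 1"
      by (simp add: algebra_simps flip: exp_add)
    finally show ?thesis by (simp add: q_def)
  qed
  \<comment> \<open>Enlarging 2K + 1 to 2(K + 1) makes the bound a perfect square, so the root can
    be taken.\<close>
  also have "\<dots> \<le> (norm (v 0) + \<delta>)\<^sup>2 * exp (2 * ((K + 1) * t))"
    using assms by (intro mult_mono) (auto simp: power2_eq_square algebra_simps)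
  also have "\<dots> = (exp ((K + 1) * t) * (norm (v 0) + \<delta>))\<^sup>2"
    by (simp add: power_mult_distrib exp_double)
  finally have "(norm (v t))\<^sup>2 \<le> (exp ((K + 1) * t) * (norm (v 0) + \<delta>))\<^sup>2"
    by (smt (verit) zero_le_power2)
  then show ?thesis
    using assms by (simp add: power2_le_iff_abs_le)
qed

text \<open>Approximate linearity, tested on linear relations among three vectors. Coefficients 1,
  1, -1 give additivity, r, -1, 0 homogeneity, and a vector paired with its own fractions gives
  convergence of difference quotients. The error is relative to the lengths, hence unchanged when
  the vectors shrink and the coefficients grow by the same factor.\<close>

definition linear_defect_le :: "('a::real_normed_vector \<Rightarrow> 'b::real_normed_vector) \<Rightarrow> real \<Rightarrow> real \<Rightarrow> bool" where
  "linear_defect_le W e d \<longleftrightarrow> (\<forall>h1 h2 h3 c1 c2 c3.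
      norm h1 \<le> d \<and> norm h2 \<le> d \<and> norm h3 \<le> d \<and> c1 *\<^sub>R h1 + c2 *\<^sub>R h2 + c3 *\<^sub>R h3 = 0 \<longrightarrow>
      norm (c1 *\<^sub>R W h1 + c2 *\<^sub>R W h2 + c3 *\<^sub>R W h3)
        \<le> e * (\<bar>c1\<bar> * norm h1 + \<bar>c2\<bar> * norm h2 + \<bar>c3\<bar> * norm h3))"

lemma linear_defect_leD:
  assumes "linear_defect_le W e d" "norm h1 \<le> d" "norm h2 \<le> d" "norm h3 \<le> d" "c1 *\<^sub>R h1 + c2 *\<^sub>R h2 + c3 *\<^sub>R h3 = 0"
  shows "norm (c1 *\<^sub>R W h1 + c2 *\<^sub>R W h2 + c3 *\<^sub>R W h3)
    \<le> e * (\<bar>c1\<bar> * norm h1 + \<bar>c2\<bar> * norm h2 + \<bar>c3\<bar> * norm h3)"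
  using assms unfolding linear_defect_le_def by blast

text \<open>No candidate for the derivative is known in advance. The quotients \<open>D v n\<close>
  are Cauchy because fractions of v are linearly related; linear relations pass to the limits with
  an error below every positive bound; and comparing \<open>W y\<close> with the quotients of the
  same y gives the remainder estimate.\<close>

lemma has_derivative_of_linear_defect:
  fixes W :: "'a::euclidean_space \<Rightarrow> 'b::euclidean_space"
  assumes W: "\<And>e. e > 0 \<Longrightarrow> \<exists>d>0. linear_defect_le W e d"
  shows "\<exists>L. (W has_derivative L) (at 0)"
proof -
  define D where "D v n = real (Suc n) *\<^sub>R W (v /\<^sub>R real (Suc n))" for v n
  have scale: "real (Suc n) * norm (v /\<^sub>R real (Suc n)) = norm v" for n and v :: 'a
    by simp
  have small: "\<exists>M. \<forall>n\<ge>M. norm (v /\<^sub>R real (Suc n)) \<le> d" if "d > 0" for v :: 'a and d :: real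
  proof -
    have "(\<lambda>n. norm (v /\<^sub>R real (Suc n))) \<longlonglongrightarrow> 0"
      using tendsto_mult_left_zero[OF LIMSEQ_inverse_real_of_nat, of "norm v"] by simp
    then show ?thesis using that
      using order_tendstoD(2)[OF _ \<open>d > 0\<close>] eventually_sequentially less_imp_le by (smt (verit, best))
  qed
  have W0: "W 0 = 0"
  proof -
    obtain d where "d > 0" and "linear_defect_le W 1 d"
      using W[of 1] by auto
    from linear_defect_leD[OF this(2), of 0 0 0 1 0 0] \<open>d > 0\<close> show ?thesis by simp
  qed
  have "Cauchy (D v)" for v
  proof (rule metric_CauchyI)
    fix e :: real assume "e > 0"
    \<comment> \<open>The 1 in the denominator keeps \<open>e'\<close> positive and the final
      inequality strict also for v = 0.\<close>
    define e' where "e' = e / (2 * norm v + 1)"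
    have e': "e' > 0" "e' * (2 * norm v) < e"
    proof -
      have "0 < 2 * norm v + 1" by (simp add: add_nonneg_pos)
      then show "e' > 0" "e' * (2 * norm v) < e"
        using \<open>e > 0\<close> by (auto simp: e'_def field_simps)
    qed
    obtain d where "d > 0" and d: "linear_defect_le W e' d"
      using W[OF e'(1)] by auto
    obtain M where M: "\<forall>n\<ge>M. norm (v /\<^sub>R real (Suc n)) \<le> d" using small[OF \<open>d > 0\<close>] by auto
    have "dist (D v m) (D v n) < e" if "m \<ge> M" "n \<ge> M" for m n
    proof -
      have "norm (real (Suc m) *\<^sub>R W (v /\<^sub>R real (Suc m)) + (- real (Suc n)) *\<^sub>R W (v /\<^sub>R real (Suc n)) + 0 *\<^sub>R W 0)
        \<le> e' * (\<bar>real (Suc m)\<bar> * norm (v /\<^sub>R real (Suc m)) + \<bar>- real (Suc n)\<bar> * norm (v /\<^sub>R real (Suc n)) + \<bar>0\<bar> * norm (0::'a))"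
        using that M \<open>d > 0\<close> by (intro linear_defect_leD[OF d]) (auto simp del: of_nat_Suc)
      also have "\<dots> = e' * (2 * norm v)"
          unfolding abs_minus_cancel abs_of_nat scale by simp
      finally show ?thesis using e'(2) by (simp add: D_def dist_norm del: of_nat_Suc)
    qed
    then show "\<exists>M. \<forall>m\<ge>M. \<forall>n\<ge>M. dist (D v m) (D v n) < e" by blast
  qed
  then have "\<exists>L. D v \<longlonglongrightarrow> L" for v by (simp add: Cauchy_convergent convergentD)
  then obtain L where L: "\<And>v. D v \<longlonglongrightarrow> L v" by metis
  have lin3: "norm (a *\<^sub>R L u + b *\<^sub>R L v + c *\<^sub>R L w) = 0" if "a *\<^sub>R u + b *\<^sub>R v + c *\<^sub>R w = 0" for a b c u v w
  proof -
    define X where "X = (\<bar>a\<bar> * norm u + \<bar>b\<bar> * norm v + \<bar>c\<bar> * norm w)"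
    have X0: "0 \<le> X" by (simp add: X_def)
    have "norm (a *\<^sub>R L u + b *\<^sub>R L v + c *\<^sub>R L w) \<le> e' * X" if e': "e' > 0" for e'
    proof -
      obtain d where "d > 0" and d: "linear_defect_le W e' d"
        using W[OF e'] by auto
      obtain M1 M2 M3 where M: "\<forall>n\<ge>M1. norm (u /\<^sub>R real (Suc n)) \<le> d" "\<forall>n\<ge>M2. norm (v /\<^sub>R real (Suc n)) \<le> d"
        "\<forall>n\<ge>M3. norm (w /\<^sub>R real (Suc n)) \<le> d"
        using small[OF \<open>d > 0\<close>] by meson
      have "norm (a *\<^sub>R D u n + b *\<^sub>R D v n + c *\<^sub>R D w n) \<le> e' * X" if "n \<ge> M1 + M2 + M3" for n
      proof -
        let ?r = "real (Suc n)"
        have z: "(a * ?r) *\<^sub>R (u /\<^sub>R ?r) + (b * ?r) *\<^sub>R (v /\<^sub>R ?r) + (c * ?r) *\<^sub>R (w /\<^sub>R ?r) = 0"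
        proof -
          have "(a * ?r) *\<^sub>R (u /\<^sub>R ?r) = a *\<^sub>R u" for a and u :: 'a
            by (simp add: field_simps del: of_nat_Suc)
          then show ?thesis using \<open>a *\<^sub>R u + b *\<^sub>R v + c *\<^sub>R w = 0\<close> by metis
        qed
        have "norm ((a * ?r) *\<^sub>R W (u /\<^sub>R ?r) + (b * ?r) *\<^sub>R W (v /\<^sub>R ?r) + (c * ?r) *\<^sub>R W (w /\<^sub>R ?r))
          \<le> e' * (\<bar>a * ?r\<bar> * norm (u /\<^sub>R ?r) + \<bar>b * ?r\<bar> * norm (v /\<^sub>R ?r) + \<bar>c * ?r\<bar> * norm (w /\<^sub>R ?r))"
          using that M z by (intro linear_defect_leD[OF d]) auto
        also have "\<dots> = e' * X" unfolding abs_mult abs_of_nat mult.assoc scale X_def ..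
        finally show ?thesis by (simp add: D_def del: of_nat_Suc)
      qed
      moreover have "(\<lambda>n. norm (a *\<^sub>R D u n + b *\<^sub>R D v n + c *\<^sub>R D w n)) \<longlonglongrightarrow> norm (a *\<^sub>R L u + b *\<^sub>R L v + c *\<^sub>R L w)"
        by (intro tendsto_intros L)
      ultimately show ?thesis by (meson LIMSEQ_le_const2)
    qed
    moreover have "((\<lambda>e. e * X) \<longlongrightarrow> 0 * X) (at_right 0)"
      by (intro tendsto_intros)
    ultimately have "norm (a *\<^sub>R L u + b *\<^sub>R L v + c *\<^sub>R L w) \<le> 0 * X"
      by (intro tendsto_lowerbound[where F = "at_right 0"])
        (auto intro: eventually_mono[OF eventually_at_right_less[of 0]])
    then show ?thesis by simp
  qed
  have "linear L"
  proof (rule linearI)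
    show "L (x + y) = L x + L y" for x y
      using lin3[of 1 x 1 y "-1" "x + y"] by simp
    show "L (r *\<^sub>R x) = r *\<^sub>R L x" for r x
      using lin3[of r x "-1" "r *\<^sub>R x" 0 0] by simp
  qed
  moreover have "\<exists>d>0. \<forall>y. norm (y - 0) < d \<longrightarrow> norm (W y - W 0 - L (y - 0)) \<le> e * norm (y - 0)" if "e > 0" for e
  proof -
    \<comment> \<open>The relation between y and y / (n + 1) has two terms of total weight 2|y|,
      hence the half. The estimate is uniform in n and so survives the limit.\<close>
    have "e / 2 > 0" using that by simp
    from W[OF this] obtain d where "d > 0" and d: "linear_defect_le W (e/2) d"
      by auto
    have "norm (W y - L y) \<le> e * norm y" if "norm y < d" for y
    proof -
      have "norm (W y - D y n) \<le> e * norm y" for n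
      proof -
        let ?r = "real (Suc n)"
        have "norm (y /\<^sub>R ?r) \<le> norm y"
          by (simp add: field_simps mult_left_le)
        then have "norm (1 *\<^sub>R W y + (- ?r) *\<^sub>R W (y /\<^sub>R ?r) + 0 *\<^sub>R W 0)
          \<le> e/2 * (\<bar>1\<bar> * norm y + \<bar>- ?r\<bar> * norm (y /\<^sub>R ?r) + \<bar>0\<bar> * norm (0::'a))"
          using that \<open>d > 0\<close> by (intro linear_defect_leD[OF d]) (auto simp del: of_nat_Suc)
        also have "\<dots> = e * norm y"
          unfolding abs_minus_cancel abs_of_nat scale by simp
        finally show ?thesis by (simp add: D_def del: of_nat_Suc)
      qed
      moreover have "(\<lambda>n. norm (W y - D y n)) \<longlonglongrightarrow> norm (W y - L y)"
        by (intro tendsto_intros L)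
      ultimately show ?thesis by (meson LIMSEQ_le_const2)
    qed
    then show ?thesis using W0 \<open>d > 0\<close> by auto
  qed
  ultimately show ?thesis
    unfolding has_derivative_at_alt by (auto simp: linear_linear)
qed

text \<open>Regularity in the initial point is not assumed but derived from Gronwall's inequality.
  Solutions exist for all real times, so the class is stable under time reversal.\<close>

locale lipschitz_flow =
  fixes V :: "'a::euclidean_space \<Rightarrow> 'a" and DV :: "'a \<Rightarrow> 'a \<Rightarrow>\<^sub>L 'a" and \<kappa> :: real
    and \<Phi> :: "real \<Rightarrow> 'a \<Rightarrow> 'a"
  assumes V_deriv: "\<And>z. (V has_derivative blinfun_apply (DV z)) (at z)"
    and DV_cont: "continuous_on UNIV DV"
    and DV_bound: "\<And>z. norm (DV z) \<le> \<kappa>"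
    and flow_0: "\<And>z. \<Phi> 0 z = z"
    and flow_deriv: "\<And>z t. ((\<lambda>s. \<Phi> s z) has_vector_derivative V (\<Phi> t z)) (at t)"
begin

lemma kappa_nonneg: "0 \<le> \<kappa>"
  using DV_bound norm_ge_zero order_trans by blast

lemma V_lipschitz: "norm (V z - V w) \<le> \<kappa> * norm (z - w)"
  using differentiable_bound[of UNIV V "\<lambda>z. blinfun_apply (DV z)" \<kappa> z w] V_deriv DV_bound
  by (simp add: norm_blinfun.rep_eq[symmetric])

text \<open>Reduces negative times to nonnegative ones throughout the locale.\<close>

lemma reversed: "lipschitz_flow (\<lambda>z. - V z) (\<lambda>z. - DV z) \<kappa> (\<lambda>t. \<Phi> (- t))"
proof
  show "((\<lambda>z. - V z) has_derivative blinfun_apply (- DV z)) (at z)" for z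
    using has_derivative_minus[OF V_deriv[of z]] by (simp add: uminus_blinfun.rep_eq fun_Compl_def)
  show "continuous_on UNIV (\<lambda>z. - DV z)"
    by (intro continuous_intros DV_cont)
  show "((\<lambda>s. \<Phi> (- s) z) has_vector_derivative - V (\<Phi> (- t) z)) (at t)" for z t
  proof -
    have "(uminus has_vector_derivative (-1::real)) (at t)"
      by (auto intro!: derivative_eq_intros)
    from vector_diff_chain_at[OF this flow_deriv] show ?thesis by (simp add: o_def)
  qed
  show "norm (- DV z) \<le> \<kappa>" for z using DV_bound by simp
  show "\<Phi> (- 0) z = z" for z using flow_0 by simp
qed

lemma flow_diff_bound_pos:
  assumes "0 \<le> t"
  shows "norm (\<Phi> t z - \<Phi> t w) \<le> exp ((\<kappa> + 1) * t) * norm (z - w)"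
  using gronwall_zero_start[of t "\<lambda>s. \<Phi> s z - \<Phi> s w" "\<lambda>s. V (\<Phi> s z) - V (\<Phi> s w)" \<kappa> 0,
      OF has_vector_derivative_diff[OF flow_deriv flow_deriv]]
    assms kappa_nonneg V_lipschitz
  by (simp add: flow_0)

text \<open>Gronwall along the trajectories run backwards from time t: the difference at time t is
  now the initial value and z - w the final one.\<close>

lemma flow_diff_lower_pos:
  assumes "0 \<le> t"
  shows "norm (z - w) \<le> exp ((\<kappa> + 1) * t) * norm (\<Phi> t z - \<Phi> t w)"
proof -
  have d: "((\<lambda>s. \<Phi> (t - s) y) has_vector_derivative - V (\<Phi> (t - s) y)) (at s)" for s y
  proof -
    have "((\<lambda>s. t - s) has_vector_derivative (-1::real)) (at s)"
      by (auto intro!: derivative_eq_intros)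
    from vector_diff_chain_at[OF this flow_deriv] show ?thesis by (simp add: o_def)
  qed
  show ?thesis
    using gronwall_zero_start[of t "\<lambda>s. \<Phi> (t - s) z - \<Phi> (t - s) w"
        "\<lambda>s. - V (\<Phi> (t - s) z) - - V (\<Phi> (t - s) w)" \<kappa> 0, OF has_vector_derivative_diff[OF d d]]
      assms kappa_nonneg V_lipschitz[of "\<Phi> _ w" "\<Phi> _ z"]
    by (simp add: flow_0 norm_minus_commute)
qed

lemma flow_diff_bound: "norm (\<Phi> t z - \<Phi> t w) \<le> exp ((\<kappa> + 1) * \<bar>t\<bar>) * norm (z - w)"
  using flow_diff_bound_pos[of t z w] lipschitz_flow.flow_diff_bound_pos[OF reversed, of "- t" z w]
  by (cases "0 \<le> t") auto

lemma flow_diff_lower: "norm (z - w) \<le> exp ((\<kappa> + 1) * \<bar>t\<bar>) * norm (\<Phi> t z - \<Phi> t w)"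
  using flow_diff_lower_pos[of t z w] lipschitz_flow.flow_diff_lower_pos[OF reversed, of "- t" z w]
  by (cases "0 \<le> t") auto

lemma flow_continuous: "continuous_on S (\<Phi> t)"
  by (rule lipschitz_on_continuous_on[of "exp ((\<kappa> + 1) * \<bar>t\<bar>)"])
    (auto simp: lipschitz_on_def dist_norm flow_diff_bound)

text \<open>The lower bound turns a Cauchy sequence of image points into a Cauchy sequence of
  preimages, whose limit lies in S; hence the image is complete.\<close>

lemma flow_closed_image:
  assumes "closed S" shows "closed (\<Phi> t ` S)"
proof -
  have "complete (\<Phi> t ` S)"
  proof (rule completeI)
    fix x assume x: "\<forall>n. x n \<in> \<Phi> t ` S" "Cauchy x"
    then have "\<forall>n. \<exists>y. y \<in> S \<and> x n = \<Phi> t y" by blast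
    then obtain y where "\<forall>n. y n \<in> S \<and> x n = \<Phi> t (y n)" by (rule choice[THEN exE])
    then have y: "\<And>n. y n \<in> S" "\<And>n. x n = \<Phi> t (y n)" by auto
    have "Cauchy y"
    proof (rule metric_CauchyI)
      fix e :: real assume "e > 0"
      define E where "E = exp ((\<kappa> + 1) * \<bar>t\<bar>)"
      have "e / E > 0" using \<open>e > 0\<close> by (simp add: E_def)
      then obtain M where M: "\<And>m n. \<lbrakk>m \<ge> M; n \<ge> M\<rbrakk> \<Longrightarrow> dist (x m) (x n) < e / E"
        using metric_CauchyD[OF x(2)] by blast
      have "dist (y m) (y n) < e" if "m \<ge> M" "n \<ge> M" for m n
      proof -
        have "dist (y m) (y n) \<le> E * dist (x m) (x n)"
          using flow_diff_lower[of "y m" "y n" t] by (simp add: y E_def dist_norm)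
        also have "\<dots> < e" using M[OF that] by (simp add: E_def field_simps)
        finally show ?thesis .
      qed
      then show "\<exists>M. \<forall>m\<ge>M. \<forall>n\<ge>M. dist (y m) (y n) < e" by blast
    qed
    then obtain l where l: "l \<in> S" "y \<longlonglongrightarrow> l"
      using assms y(1) by (blast elim: completeE[OF assms[folded complete_eq_closed]])
    then have "(\<lambda>n. \<Phi> t (y n)) \<longlonglongrightarrow> \<Phi> t l"
      using continuous_on_tendsto_compose[OF flow_continuous[of UNIV t]] by simp
    moreover have "x = (\<lambda>n. \<Phi> t (y n))" using y(2) by (rule ext)
    ultimately show "\<exists>l\<in>\<Phi> t ` S. x \<longlonglongrightarrow> l" using l(1) by blast
  qed
  then show ?thesis by (rule complete_imp_closed)
qed

text \<open>One radius d has to serve all times in [0, t]. The orbit segment is compact, so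
  \<open>DV\<close> is uniformly continuous on its unit neighbourhood, and the mean value inequality
  on a small ball around each orbit point gives the estimate.\<close>

lemma linearization_near_orbit:
  assumes "0 \<le> t" "e > 0"
  shows "\<exists>d>0. \<forall>s h. 0 \<le> s \<and> s \<le> t \<and> norm h \<le> d \<longrightarrow>
    norm (V (\<Phi> s z + h) - V (\<Phi> s z) - DV (\<Phi> s z) h) \<le> e * norm h"
proof -

  define K where "K = (\<lambda>s. \<Phi> s z) ` {0..t}"
  have "continuous_on {0..t} (\<lambda>s. \<Phi> s z)"
    using flow_deriv by (meson continuous_at_imp_continuous_on has_vector_derivative_continuous)
  then have K: "compact K" unfolding K_def by (intro compact_continuous_image) auto
  define K1 where "K1 = (\<Union>x\<in>K. \<Union>y\<in>cball 0 1. {x + y})"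
  have "compact K1" unfolding K1_def by (intro compact_sums' K compact_cball)
  then have "uniformly_continuous_on K1 DV"
    by (intro compact_uniformly_continuous continuous_on_subset[OF DV_cont]) auto
  then obtain d where "d > 0" and d: "\<And>x y. \<lbrakk>x \<in> K1; y \<in> K1; dist y x < d\<rbrakk> \<Longrightarrow> dist (DV y) (DV x) < e"
    using \<open>e > 0\<close> unfolding uniformly_continuous_on_def by metis
  have "norm (V (\<Phi> s z + h) - V (\<Phi> s z) - DV (\<Phi> s z) h) \<le> e * norm h"
    if s: "0 \<le> s" "s \<le> t" and h: "norm h \<le> min 1 (d / 2)" for s h
  proof -
    let ?x = "\<Phi> s z"
    let ?S = "cball ?x (norm h)"
    have "?x \<in> K" using s by (auto simp: K_def)
    have S: "w \<in> K1" if "w \<in> ?S" for w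
      unfolding K1_def using \<open>?x \<in> K\<close> that h
      by (intro UN_I[of ?x] UN_I[of "w - ?x"]) (auto simp: dist_norm norm_minus_commute)
    have "norm (V (?x + h) - V ?x - DV ?x (?x + h - ?x)) \<le> norm (?x + h - ?x) * e"
    proof (rule differentiable_bound_linearization[where S = ?S and f' = "\<lambda>w. blinfun_apply (DV w)" and ?x0.0 = ?x])
      show "?x + r *\<^sub>R (?x + h - ?x) \<in> ?S" if "r \<in> {0..1}" for r
        using that by (auto simp: dist_norm mult_left_le_one_le)
      show "(V has_derivative blinfun_apply (DV w)) (at w within ?S)" for w
        using V_deriv has_derivative_at_withinI by blast
      show "onorm (blinfun_apply (DV w) - blinfun_apply (DV ?x)) \<le> e" if "w \<in> ?S" for w
      proof -
        have "dist w ?x < d" using that h \<open>d > 0\<close> by (auto simp: dist_commute)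
        moreover have "?x \<in> ?S" by simp
        ultimately have "dist (DV w) (DV ?x) < e" using d S that by blast
        then show ?thesis
          by (simp add: dist_norm norm_blinfun.rep_eq minus_blinfun.rep_eq fun_diff_def)
      qed
    qed simp
    then show ?thesis by (simp add: mult.commute)
  qed
  then show ?thesis using \<open>d > 0\<close> by (intro exI[of _ "min 1 (d/2)"]) auto
qed

lemma flow_has_derivative_pos:
  assumes "0 \<le> t"
  shows "\<exists>L. (\<Phi> t has_derivative L) (at z)"
proof -
  define W where "W s h = \<Phi> s (z + h) - \<Phi> s z" for s h
  define E where "E = exp ((\<kappa> + 1) * t)"
  have "E \<ge> 1" "E > 0" using assms kappa_nonneg by (auto simp: E_def)
  have "\<exists>L. (W t has_derivative L) (at 0)"
  proof (rule has_derivative_of_linear_defect)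
    fix e :: real assume "e > 0"
    \<comment> \<open>One factor E converts |W s h| into |h|, the other is the Gronwall factor at
      the end.\<close>
    then have "e / (E * E) > 0" using \<open>E > 0\<close> by simp
    from linearization_near_orbit[OF assms this, of z] obtain d where "d > 0" and
      d: "\<And>s h. \<lbrakk>0 \<le> s; s \<le> t; norm h \<le> d\<rbrakk> \<Longrightarrow>
        norm (V (\<Phi> s z + h) - V (\<Phi> s z) - DV (\<Phi> s z) h) \<le> e / (E * E) * norm h" by blast
    have Wb: "norm (W s h) \<le> E * norm h" if "0 \<le> s" "s \<le> t" for s h
    proof -
      have "norm (W s h) \<le> exp ((\<kappa> + 1) * s) * norm h"
        using flow_diff_bound_pos[OF that(1), of "z + h" z] by (simp add: W_def)
      also have "\<dots> \<le> E * norm h"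
        unfolding E_def using that kappa_nonneg by (intro mult_right_mono) (auto intro: mult_left_mono)
      finally show ?thesis .
    qed
    have Wl: "norm (V (\<Phi> s (z + h)) - V (\<Phi> s z) - DV (\<Phi> s z) (W s h)) \<le> e / E * norm h"
      if "0 \<le> s" "s \<le> t" "norm h \<le> d / E" for s h
    proof -
      have "norm (W s h) \<le> d" using Wb[OF that(1,2), of h] that(3) \<open>E > 0\<close>
        by (simp add: field_simps)
      from d[OF that(1,2) this] have "norm (V (\<Phi> s (z + h)) - V (\<Phi> s z) - DV (\<Phi> s z) (W s h)) \<le> e / (E * E) * norm (W s h)"
        by (simp add: W_def)
      also have "\<dots> \<le> e / (E * E) * (E * norm h)"
        using Wb[OF that(1,2)] \<open>e > 0\<close> \<open>E > 0\<close> by (intro mult_left_mono) auto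
      finally show ?thesis using \<open>E > 0\<close> by simp
    qed
    show "\<exists>d>0. linear_defect_le (W t) e d"
      unfolding linear_defect_le_def
    proof (intro exI[of _ "d / E"] conjI allI impI)
      show "d / E > 0" using \<open>d > 0\<close> \<open>E > 0\<close> by simp
      fix h1 h2 h3 :: 'a and c1 c2 c3 :: real
      assume A: "norm h1 \<le> d / E \<and> norm h2 \<le> d / E \<and> norm h3 \<le> d / E \<and> c1 *\<^sub>R h1 + c2 *\<^sub>R h2 + c3 *\<^sub>R h3 = 0"
      \<comment> \<open>The combination \<open>y\<close> starts at 0 because the initial
        perturbations satisfy the linear relation, and it solves the linearised equation up to a
        forcing of size \<delta>. Gronwall therefore bounds it by a multiple of \<delta>
        alone.\<close>
      define y where "y s = c1 *\<^sub>R W s h1 + c2 *\<^sub>R W s h2 + c3 *\<^sub>R W s h3" for s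
      define R where "R s h = V (\<Phi> s (z + h)) - V (\<Phi> s z)" for s h
      define \<delta> where "\<delta> = e / E * (\<bar>c1\<bar> * norm h1 + \<bar>c2\<bar> * norm h2 + \<bar>c3\<bar> * norm h3)"
      have yt: "norm (y t) \<le> exp ((\<kappa> + 1) * t) * (norm (y 0) + \<delta>)"
      proof (rule gronwall_zero_start[where v = y and K = \<kappa> and \<delta> = \<delta>
            and v' = "\<lambda>s. c1 *\<^sub>R R s h1 + c2 *\<^sub>R R s h2 + c3 *\<^sub>R R s h3"])
        have "((\<lambda>s. c *\<^sub>R W s h) has_vector_derivative c *\<^sub>R R s h) (at s)" for c s h
          unfolding W_def R_def
          by (rule bounded_linear.has_vector_derivative[OF bounded_linear_scaleR_right has_vector_derivative_diff[OF flow_deriv flow_deriv]])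
        then show "(y has_vector_derivative c1 *\<^sub>R R s h1 + c2 *\<^sub>R R s h2 + c3 *\<^sub>R R s h3) (at s)" for s
          unfolding y_def by (intro has_vector_derivative_add)
        show "0 \<le> \<delta>" using \<open>e > 0\<close> \<open>E > 0\<close> by (simp add: \<delta>_def)
        show "norm (c1 *\<^sub>R R s h1 + c2 *\<^sub>R R s h2 + c3 *\<^sub>R R s h3) \<le> \<kappa> * norm (y s) + \<delta>" if s: "0 \<le> s" "s \<le> t" for s
        proof -
          let ?r = "\<lambda>h. R s h - DV (\<Phi> s z) (W s h)"
          have eq: "c1 *\<^sub>R R s h1 + c2 *\<^sub>R R s h2 + c3 *\<^sub>R R s h3 = DV (\<Phi> s z) (y s) + (c1 *\<^sub>R ?r h1 + c2 *\<^sub>R ?r h2 + c3 *\<^sub>R ?r h3)"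
            by (simp add: y_def blinfun.add_right blinfun.scaleR_right algebra_simps)
          have "norm (c1 *\<^sub>R R s h1 + c2 *\<^sub>R R s h2 + c3 *\<^sub>R R s h3) \<le> norm (DV (\<Phi> s z) (y s)) + (norm (c1 *\<^sub>R ?r h1) + norm (c2 *\<^sub>R ?r h2) + norm (c3 *\<^sub>R ?r h3))"
            unfolding eq by (intro norm_triangle_mono order_refl)
          moreover have "norm (DV (\<Phi> s z) (y s)) \<le> \<kappa> * norm (y s)"
            by (rule order_trans[OF norm_blinfun mult_right_mono[OF DV_bound norm_ge_zero]])
          moreover have "norm (c1 *\<^sub>R ?r h1) + norm (c2 *\<^sub>R ?r h2) + norm (c3 *\<^sub>R ?r h3) \<le>
            \<bar>c1\<bar> * (e / E * norm h1) + \<bar>c2\<bar> * (e / E * norm h2) + \<bar>c3\<bar> * (e / E * norm h3)"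
            unfolding norm_scaleR using A Wl[OF s] unfolding R_def by (intro add_mono mult_left_mono) auto
          moreover have "\<bar>c1\<bar> * (e / E * norm h1) + \<bar>c2\<bar> * (e / E * norm h2) + \<bar>c3\<bar> * (e / E * norm h3) = \<delta>"
            by (simp add: \<delta>_def algebra_simps)
          ultimately show ?thesis by linarith
        qed
      qed (fact assms kappa_nonneg)+
      have "y 0 = 0" using A by (simp add: y_def W_def flow_0)
      with yt have "norm (y t) \<le> E * \<delta>" by (simp add: E_def)
      then show "norm (c1 *\<^sub>R W t h1 + c2 *\<^sub>R W t h2 + c3 *\<^sub>R W t h3)
        \<le> e * (\<bar>c1\<bar> * norm h1 + \<bar>c2\<bar> * norm h2 + \<bar>c3\<bar> * norm h3)"
        using \<open>E > 0\<close> by (simp add: \<delta>_def y_def)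
    qed
  qed
  then obtain L where L: "(W t has_derivative L) (at 0)" by blast
  have "((\<lambda>w. W t (w - z) + \<Phi> t z) has_derivative L) (at z)"
  proof -
    have "((\<lambda>w. w - z) has_derivative (\<lambda>h. h)) (at z)"
      by (auto intro!: derivative_eq_intros)
    from has_derivative_compose[OF this, of "W t" L] L
    have "((\<lambda>w. W t (w - z)) has_derivative L) (at z)" by simp
    from has_derivative_add_const[OF this] show ?thesis .
  qed
  then show ?thesis by (auto simp: W_def)
qed

lemma flow_differentiable: "\<Phi> t differentiable (at z)"
  using flow_has_derivative_pos[of t z] lipschitz_flow.flow_has_derivative_pos[OF reversed, of "- t" z]
  unfolding differentiable_def by (cases "0 \<le> t") auto

end

section \<open>Test functions and weak derivatives\<close>

text \<open>Link to the gauge integral over a box, where differentiation under the integral sign is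
  carried out.\<close>

lemma integral_compact_support:
  fixes f :: "'a::euclidean_space \<Rightarrow> real"
  assumes f: "continuous_on UNIV f" and supp: "\<And>x. x \<notin> cbox a b \<Longrightarrow> f x = 0"
  shows "integrable lborel f" and "integral\<^sup>L lborel f = integral (cbox a b) f"
proof -
  have eq: "(\<lambda>x. indicator (cbox a b) x *\<^sub>R f x) = f"
    using supp by (auto simp: indicator_def fun_eq_iff)
  show int: "integrable lborel f"
    using borel_integrable_compact[of "cbox a b" f] continuous_on_subset[OF f]
    unfolding eq by auto
  have "integral\<^sup>L lborel f = integral UNIV f"
    by (rule integral_lborel[OF int, symmetric])
  also have "integral UNIV f = integral UNIV (\<lambda>x. if x \<in> cbox a b then f x else 0)"
    using supp by (intro arg_cong[of _ _ "integral UNIV"]) (auto simp: fun_eq_iff)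
  also have "\<dots> = integral (cbox a b) f"
    by (rule Henstock_Kurzweil_Integration.integral_restrict_UNIV)
  finally show "integral\<^sup>L lborel f = integral (cbox a b) f" .
qed

lemma test_fun_onI:
  fixes \<phi> :: "'n::finite vec \<Rightarrow> real"
  assumes "\<And>x. (\<phi> has_derivative blinfun_apply (D x)) (at x)" "continuous_on UNIV D"
    and "\<And>x. x \<notin> K \<Longrightarrow> \<phi> x = 0" "compact K" "K \<subseteq> \<Omega>"
  shows "test_fun_on \<Omega> \<phi>"
proof -
  have "closure {x. \<phi> x \<noteq> 0} \<subseteq> K"
    using assms(3,4) by (intro closure_minimal) (auto simp: compact_imp_closed)
  moreover from this have "compact (closure {x. \<phi> x \<noteq> 0})"
    using compact_Int_closed[OF \<open>compact K\<close> closed_closure[of "{x. \<phi> x \<noteq> 0}"]] by (simp add: inf.absorb2)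
  ultimately show ?thesis
    using assms unfolding test_fun_on_def by blast
qed

text \<open>Exposes the witnesses hidden in \<open>test_fun_on\<close>, with one compact set outside
  which both the function and its derivative vanish.\<close>

definition C1_supported :: "('n::finite) vec set \<Rightarrow> ('n vec \<Rightarrow> real) \<Rightarrow> ('n vec \<Rightarrow> 'n vec \<Rightarrow>\<^sub>L real) \<Rightarrow> 'n vec set \<Rightarrow> bool" where
  "C1_supported \<Omega> \<phi> D K \<longleftrightarrow> (\<forall>x. (\<phi> has_derivative blinfun_apply (D x)) (at x)) \<and> continuous_on UNIV D \<and>
     (\<forall>x. x \<notin> K \<longrightarrow> \<phi> x = 0) \<and> (\<forall>x. x \<notin> K \<longrightarrow> D x = 0) \<and> compact K \<and> K \<subseteq> \<Omega>"

lemma C1_supportedD: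
  assumes "C1_supported \<Omega> \<phi> D K"
  shows "(\<phi> has_derivative blinfun_apply (D x)) (at x)" "continuous_on UNIV D"
    "x \<notin> K \<Longrightarrow> \<phi> x = 0" "x \<notin> K \<Longrightarrow> D x = 0" "compact K" "K \<subseteq> \<Omega>"
    "frechet_derivative \<phi> (at x) = blinfun_apply (D x)" "continuous_on UNIV \<phi>"
proof -
  have d: "(\<phi> has_derivative blinfun_apply (D x)) (at x)" for x
    using assms by (simp add: C1_supported_def)
  show "(\<phi> has_derivative blinfun_apply (D x)) (at x)" by (rule d)
  show "frechet_derivative \<phi> (at x) = blinfun_apply (D x)"
    using frechet_derivative_at[OF d] by simp
  show "continuous_on UNIV \<phi>"
    by (rule has_derivative_continuous_on) (rule has_derivative_at_withinI[OF d])
qed (use assms in \<open>auto simp: C1_supported_def\<close>)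

lemma test_fun_on_C1_supported:
  assumes "test_fun_on \<Omega> \<phi>"
  shows "\<exists>D K. C1_supported \<Omega> \<phi> D K"
proof -
  from assms obtain D where D: "\<And>x. (\<phi> has_derivative blinfun_apply (D x)) (at x)" "continuous_on UNIV D"
    and K: "compact (closure {x. \<phi> x \<noteq> 0})" "closure {x. \<phi> x \<noteq> 0} \<subseteq> \<Omega>"
    unfolding test_fun_on_def by blast
  define L where "L = closure {x. \<phi> x \<noteq> 0}"
  have K: "compact L" "L \<subseteq> \<Omega>" using K by (simp_all add: L_def)
  have open_L: "open (- L)" using K(1) by (simp add: compact_imp_closed open_Compl)
  have 0: "\<phi> x = 0" if "x \<notin> L" for x using that closure_subset[of "{x. \<phi> x \<noteq> 0}"] unfolding L_def by auto
  have D0: "D x = 0" if "x \<notin> L" for x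
  proof -
    have "((\<lambda>_. 0) has_derivative blinfun_apply (D x)) (at x)"
    proof (rule has_derivative_transform_within_open[OF D(1)])
      show "open (- L)" by (rule open_L)
      show "x \<in> - L" using that by simp
      show "\<phi> y = 0" if "y \<in> - L" for y using 0 that by simp
    qed
    then have "blinfun_apply (D x) = (\<lambda>_. 0)"
      using has_derivative_const[of 0 "at x"] has_derivative_unique by blast
    then show ?thesis by (simp add: blinfun_eqI)
  qed
  show ?thesis
    unfolding C1_supported_def using D K 0 D0 by blast
qed

lemma test_fun_on_mult:
  fixes \<phi> :: "'n::finite vec \<Rightarrow> real"
  assumes "test_fun_on \<Omega> \<phi>" and f: "\<And>x. (f has_derivative blinfun_apply (Df x)) (at x)"
    and Df: "continuous_on UNIV Df"
  shows "test_fun_on \<Omega> (\<lambda>x. f x * \<phi> x)"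
proof -
  obtain D K where "C1_supported \<Omega> \<phi> D K"
    using test_fun_on_C1_supported[OF assms(1)] by blast
  note D = C1_supportedD[OF this]
  have fc: "continuous_on UNIV f"
    by (rule has_derivative_continuous_on) (rule has_derivative_at_withinI[OF f])
  show ?thesis
  proof (rule test_fun_onI[where K = K and D = "\<lambda>x. f x *\<^sub>R D x + \<phi> x *\<^sub>R Df x"])
    show "((\<lambda>x. f x * \<phi> x) has_derivative blinfun_apply (f x *\<^sub>R D x + \<phi> x *\<^sub>R Df x)) (at x)" for x
      using has_derivative_mult[OF f D(1)]
      by (rule has_derivative_eq_rhs) (auto simp: fun_eq_iff blinfun.add_left blinfun.scaleR_left)
    show "continuous_on UNIV (\<lambda>x. f x *\<^sub>R D x + \<phi> x *\<^sub>R Df x)"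
      by (intro continuous_intros fc D Df)
    show "f x * \<phi> x = 0" if "x \<notin> K" for x using D(3)[OF that] by simp
  qed (fact D)+
qed

lemma test_fun_translate:
  fixes \<psi> :: "'n::finite vec \<Rightarrow> real"
  assumes "test_fun_on UNIV \<psi>"
  shows "frechet_derivative (\<lambda>z. \<psi> (z - v)) (at z) = frechet_derivative \<psi> (at (z - v))"
proof -
  obtain D K where "C1_supported UNIV \<psi> D K"
    using test_fun_on_C1_supported[OF assms] by blast
  note D = C1_supportedD[OF this]
  have d: "((\<lambda>z. \<psi> (z - v)) has_derivative blinfun_apply (D (z - v))) (at z)" for z
  proof -
    have "((\<lambda>z. z - v) has_derivative (\<lambda>h. h)) (at z)" by (auto intro!: derivative_eq_intros)
    from has_derivative_compose[OF this D(1)] show ?thesis .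
  qed
  show "frechet_derivative (\<lambda>z. \<psi> (z - v)) (at z) = frechet_derivative \<psi> (at (z - v))"
    unfolding D(7) by (rule frechet_derivative_at[OF d, symmetric])
qed

text \<open>All differentiation falls on \<psi>, so continuity of \<open>w\<close> suffices. This is
  how averages at different centres will be compared.\<close>

lemma translated_pairing_deriv:
  fixes \<psi> w :: "'n::finite vec \<Rightarrow> real"
  assumes "test_fun_on UNIV \<psi>" and w: "continuous_on UNIV w"
  shows "((\<lambda>\<tau>. \<integral>z. w z * \<psi> (z - (v + \<tau> *\<^sub>R e)) \<partial>lborel) has_real_derivative
          - (\<integral>z. w z * frechet_derivative \<psi> (at (z - (v + \<tau>0 *\<^sub>R e))) e \<partial>lborel)) (at \<tau>0)"
proof -
  obtain D K where "C1_supported UNIV \<psi> D K"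
    using test_fun_on_C1_supported[OF assms(1)] by blast
  note D = C1_supportedD[OF this]
  define T where "T = {\<tau>0 - 1..\<tau>0 + 1}"
  \<comment> \<open>All supports met while \<tau> varies by at most 1 lie in this compact set, so a
    single box can serve as domain of integration for every \<tau> in \<open>T\<close>.\<close>
  define S where "S = (\<lambda>(x, \<tau>). x + (v + \<tau> *\<^sub>R e)) ` (K \<times> T)"
  have "compact S" unfolding S_def T_def case_prod_beta
    by (intro compact_continuous_image continuous_intros compact_Times D compact_Icc)
  then obtain a b where ab: "S \<subseteq> cbox a b"
    using bounded_subset_cbox_symmetric[OF compact_imp_bounded] by metis
  have out: "z - (v + \<tau> *\<^sub>R e) \<notin> K" if "z \<notin> cbox a b" "\<tau> \<in> T" for z \<tau>
  proof
    assume "z - (v + \<tau> *\<^sub>R e) \<in> K"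
    then have "z \<in> S" unfolding S_def using that(2)
      by (intro image_eqI[of _ _ "(z - (v + \<tau> *\<^sub>R e), \<tau>)"]) auto
    then show False using ab that by blast
  qed
  define f where "f \<tau> z = w z * \<psi> (z - (v + \<tau> *\<^sub>R e))" for \<tau> z
  define f' where "f' \<tau> z = w z * - D (z - (v + \<tau> *\<^sub>R e)) e" for \<tau> z
  have f_cont: "continuous_on UNIV (f \<tau>)" for \<tau>
    unfolding f_def by (intro continuous_intros w continuous_on_compose2[OF D(8)]) auto
  have f'_cont: "continuous_on UNIV (f' \<tau>)" for \<tau>
    unfolding f'_def by (intro continuous_intros w continuous_on_compose2[OF D(2)]) auto
  have lz: "((\<lambda>\<tau>. integral (cbox a b) (f \<tau>)) has_field_derivative integral (cbox a b) (f' \<tau>0)) (at \<tau>0 within T)"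
  proof (rule leibniz_rule_field_derivative)
    show "((\<lambda>\<tau>. f \<tau> z) has_real_derivative f' \<tau> z) (at \<tau> within T)" for \<tau> z
    proof -
      have "((\<lambda>\<tau>. z - (v + \<tau> *\<^sub>R e)) has_derivative (\<lambda>h. - (h *\<^sub>R e))) (at \<tau>)"
        by (auto intro!: derivative_eq_intros)
      from has_derivative_compose[OF this D(1)]
      have "((\<lambda>\<tau>. \<psi> (z - (v + \<tau> *\<^sub>R e))) has_derivative (*) (- D (z - (v + \<tau> *\<^sub>R e)) e)) (at \<tau>)"
        by (rule has_derivative_eq_rhs) (auto simp: fun_eq_iff blinfun.minus_right blinfun.scaleR_right)
      then have "((\<lambda>\<tau>. \<psi> (z - (v + \<tau> *\<^sub>R e))) has_real_derivative (- D (z - (v + \<tau> *\<^sub>R e)) e)) (at \<tau>)"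
        unfolding has_field_derivative_def .
      from DERIV_cmult[OF this, of "w z"] show ?thesis
        unfolding f_def f'_def by (rule has_field_derivative_at_within)
    qed
    show "f \<tau> integrable_on cbox a b" for \<tau>
      by (intro integrable_continuous continuous_on_subset[OF f_cont]) auto
    show "continuous_on (T \<times> cbox a b) (\<lambda>(\<tau>, z). f' \<tau> z)"
      unfolding f'_def case_prod_beta
      by (intro continuous_intros continuous_on_compose2[OF w] continuous_on_compose2[OF D(2)]) auto
  qed (auto simp: T_def)
  have eq: "(\<integral>z. f \<tau> z \<partial>lborel) = integral (cbox a b) (f \<tau>)" if "\<tau> \<in> T" for \<tau>
    by (rule integral_compact_support(2)[OF f_cont]) (simp add: f_def D(3) out that)
  have eq': "(\<integral>z. f' \<tau>0 z \<partial>lborel) = integral (cbox a b) (f' \<tau>0)"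
    by (rule integral_compact_support(2)[OF f'_cont]) (simp add: f'_def D(4) out T_def)
  have "((\<lambda>\<tau>. \<integral>z. f \<tau> z \<partial>lborel) has_field_derivative (\<integral>z. f' \<tau>0 z \<partial>lborel)) (at \<tau>0 within T)"
    unfolding eq' by (rule has_field_derivative_transform_within[OF lz, of 1]) (auto simp: eq T_def)
  then have "((\<lambda>\<tau>. \<integral>z. f \<tau> z \<partial>lborel) has_field_derivative (\<integral>z. f' \<tau>0 z \<partial>lborel)) (at \<tau>0)"
    using at_within_interior[of \<tau>0 T] by (simp add: T_def)
  then show ?thesis
    by (simp add: f_def f'_def D(7))
qed

lemma test_fun_measurable:
  fixes \<phi> :: "'n::finite vec \<Rightarrow> real"
  assumes "test_fun_on \<Omega> \<phi>"
  shows "continuous_on UNIV \<phi>" "continuous_on UNIV (\<lambda>x. frechet_derivative \<phi> (at x) e)"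
    "continuous_on UNIV w \<Longrightarrow> integrable lborel (\<lambda>x. w x * \<phi> x)"
    "continuous_on UNIV w \<Longrightarrow> integrable lborel (\<lambda>x. w x * frechet_derivative \<phi> (at x) e)"
proof -
  obtain D K where "C1_supported \<Omega> \<phi> D K"
    using test_fun_on_C1_supported[OF assms(1)] by blast
  note D = C1_supportedD[OF this]
  obtain a b where ab: "K \<subseteq> cbox a b"
    using bounded_subset_cbox_symmetric[OF compact_imp_bounded[OF D(5)]] by metis
  have 0: "\<phi> x = 0 \<and> D x = 0" if "x \<notin> cbox a b" for x using that ab D(3,4) by blast
  show 1: "continuous_on UNIV \<phi>" by fact
  show 2: "continuous_on UNIV (\<lambda>x. frechet_derivative \<phi> (at x) e)"
    unfolding D(7) by (intro continuous_intros D(2))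
  show "integrable lborel (\<lambda>x. w x * \<phi> x)" if "continuous_on UNIV w"
    by (intro integral_compact_support(1)[of _ a b] continuous_intros that 1) (simp add: 0)
  show "integrable lborel (\<lambda>x. w x * frechet_derivative \<phi> (at x) e)" if "continuous_on UNIV w"
    by (intro integral_compact_support(1)[of _ a b] continuous_intros that 2) (simp add: 0 D(7))
qed

text \<open>Translation invariance in place of the fundamental theorem of calculus: the integral of
  the translated function does not depend on the translation, and its derivative along e is minus
  the integral in question.\<close>

lemma integral_frechet_test_fun:
  fixes \<phi> :: "'n::finite vec \<Rightarrow> real"
  assumes "test_fun_on \<Omega> \<phi>"
  shows "(\<integral>x. frechet_derivative \<phi> (at x) e \<partial>lborel) = 0"
proof -
  have tf: "test_fun_on UNIV \<phi>" using assms by (auto simp: test_fun_on_def)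
  have shift: "(\<integral>z. \<phi> (z - (0 + \<tau> *\<^sub>R e)) \<partial>lborel) = (\<integral>z. \<phi> z \<partial>lborel)" for \<tau>
  proof -
    have "(\<integral>z. \<phi> z \<partial>lborel) = (\<integral>z. \<phi> z \<partial>distr lborel borel ((+) (- (\<tau> *\<^sub>R e))))"
      by (simp add: lborel_distr_plus)
    also have "\<dots> = (\<integral>z. \<phi> (- (\<tau> *\<^sub>R e) + z) \<partial>lborel)"
      using test_fun_measurable(1)[OF tf] by (intro integral_distr) (auto intro: borel_measurable_continuous_onI)
    finally show ?thesis by simp
  qed
  have "((\<lambda>\<tau>. \<integral>z. 1 * \<phi> (z - (0 + \<tau> *\<^sub>R e)) \<partial>lborel) has_real_derivative
     - (\<integral>z. 1 * frechet_derivative \<phi> (at (z - (0 + 0 *\<^sub>R e))) e \<partial>lborel)) (at 0)"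
    by (rule translated_pairing_deriv[OF tf continuous_on_const])
  then have "((\<lambda>\<tau>::real. \<integral>z. \<phi> z \<partial>lborel) has_real_derivative
     - (\<integral>z. frechet_derivative \<phi> (at z) e \<partial>lborel)) (at 0)"
    unfolding mult_1 shift by simp
  from DERIV_unique[OF this DERIV_const] show ?thesis by simp
qed

lemma integral_lebesgue_continuous:
  fixes f :: "'a::euclidean_space \<Rightarrow> real"
  assumes "continuous_on UNIV f"
  shows "integral\<^sup>L lebesgue f = integral\<^sup>L lborel f"
  by (rule integral_completion) (simp add: assms borel_measurable_continuous_onI)

text \<open>The product with a test function is again a test function, so its derivative integrates
  to 0, and the product rule gives integration by parts. Needed to subtract a first-order Taylor
  polynomial and, with a = 0, to normalise the bumps.\<close>

lemma weak_partial_affine: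
  fixes a :: "'n::finite vec"
  shows "weak_partial_on \<Omega> (\<lambda>z. a \<bullet> z + d) b (\<lambda>_. a \<bullet> b)"
  unfolding weak_partial_on_def
proof (intro conjI allI impI)
  show "set_integrable lebesgue K (\<lambda>_. a \<bullet> b)" if "compact K \<and> K \<subseteq> \<Omega>" for K
    using that lmeasurable_compact[of K] unfolding set_integrable_def
    by (intro integrable_scaleR_left integrable_real_indicator) (auto simp: fmeasurable_def)
  fix \<phi> assume \<phi>: "test_fun_on \<Omega> \<phi>"
  let ?f = "\<lambda>z. a \<bullet> z + d"
  have fc: "continuous_on UNIV ?f" by (intro continuous_intros)
  have f: "(?f has_derivative blinfun_apply (blinfun_inner_right a)) (at x)" for x
    by (auto intro!: derivative_eq_intros simp: blinfun_inner_right.rep_eq)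
  have t: "test_fun_on \<Omega> (\<lambda>x. ?f x * \<phi> x)"
    by (rule test_fun_on_mult[OF \<phi> f]) (rule continuous_on_const)
  obtain D K where "C1_supported \<Omega> \<phi> D K"
    using test_fun_on_C1_supported[OF \<phi>] by blast
  note D = C1_supportedD[OF this]
  have "frechet_derivative (\<lambda>x. ?f x * \<phi> x) (at x) b = ?f x * frechet_derivative \<phi> (at x) b + (a \<bullet> b) * \<phi> x" for x
    using frechet_derivative_at[OF has_derivative_mult[OF f D(1)], symmetric]
    by (simp add: D(7) blinfun_inner_right.rep_eq)
  then have "0 = (\<integral>x. ?f x * frechet_derivative \<phi> (at x) b + (a \<bullet> b) * \<phi> x \<partial>lborel)"
    using integral_frechet_test_fun[OF t, of b] by simp
  also have "\<dots> = (\<integral>x. ?f x * frechet_derivative \<phi> (at x) b \<partial>lborel) + (\<integral>x. (a \<bullet> b) * \<phi> x \<partial>lborel)"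
    by (intro Bochner_Integration.integral_add test_fun_measurable[OF \<phi>] fc continuous_on_const)
  finally have "(\<integral>x. ?f x * frechet_derivative \<phi> (at x) b \<partial>lborel) = - (\<integral>x. (a \<bullet> b) * \<phi> x \<partial>lborel)" by simp
  moreover have "continuous_on UNIV (\<lambda>x. ?f x * frechet_derivative \<phi> (at x) b)" "continuous_on UNIV (\<lambda>x. (a \<bullet> b) * \<phi> x)"
    by (intro continuous_intros test_fun_measurable[OF \<phi>])+
  moreover have "integral\<^sup>L lebesgue \<phi> = integral\<^sup>L lborel \<phi>"
    by (intro integral_lebesgue_continuous test_fun_measurable[OF \<phi>])
  ultimately show "(\<integral>x. ?f x * frechet_derivative \<phi> (at x) b \<partial>lebesgue) = - (\<integral>x. (a \<bullet> b) * \<phi> x \<partial>lebesgue)"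
    by (simp add: integral_lebesgue_continuous)
qed

section \<open>Radial potential estimate\<close>

lemma DERIV_pos_part_power:
  "((\<lambda>x::real. max 0 x ^ Suc (Suc n)) has_real_derivative real (Suc (Suc n)) * max 0 x ^ Suc n) (at x)"
proof -
  consider "x > 0" | "x < 0" | "x = 0" by linarith
  then show ?thesis
  proof cases
    case 1
    have "((\<lambda>x::real. x ^ Suc (Suc n)) has_real_derivative real (Suc (Suc n)) * max 0 x ^ Suc n) (at x)"
      using 1 DERIV_pow[of "Suc (Suc n)" x UNIV] by simp
    then show ?thesis
      by (rule has_field_derivative_transform_within_open[of _ _ _ "{0<..}"]) (use 1 in auto)
  next
    case 2
    have "((\<lambda>x::real. 0) has_real_derivative real (Suc (Suc n)) * max 0 x ^ Suc n) (at x)"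
      using 2 by simp
    then show ?thesis
      by (rule has_field_derivative_transform_within_open[of _ _ _ "{..<0}"]) (use 2 in auto)
  next
    case 3
    have "((\<lambda>h::real. (max 0 (0 + h) ^ Suc (Suc n) - max 0 0 ^ Suc (Suc n)) / h) \<longlongrightarrow> 0) (at 0)"
    proof (rule Lim_null_comparison)
      show "\<forall>\<^sub>F h in at 0. norm ((max 0 (0 + h) ^ Suc (Suc n) - max 0 0 ^ Suc (Suc n)) / h) \<le> \<bar>h::real\<bar> ^ Suc n"
      proof (intro always_eventually allI)
        fix h :: real
        show "norm ((max 0 (0 + h) ^ Suc (Suc n) - max 0 0 ^ Suc (Suc n)) / h) \<le> \<bar>h\<bar> ^ Suc n"
        proof (cases "h \<le> 0")
          case True
          then have "max 0 (0 + h) = 0" by simp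
          moreover have "0 \<le> \<bar>h\<bar> ^ Suc n" by (rule zero_le_power) simp
          ultimately show ?thesis by simp
        qed (simp add: max_def)
      qed
      have "((\<lambda>h::real. \<bar>h\<bar> ^ Suc n) \<longlongrightarrow> \<bar>0\<bar> ^ Suc n) (at 0)"
        by (intro tendsto_intros)
      then show "((\<lambda>h::real. \<bar>h\<bar> ^ Suc n) \<longlongrightarrow> 0) (at 0)" by simp
    qed
    then show ?thesis using 3 by (simp add: DERIV_def)
  qed
qed

text \<open>Cubes of positive parts are C^2, so the cutoff is C^2 and its slope C^1, as required of
  a C^1 test function built from the slope. The factor 8 makes the inner expression vanish at s =
  1.\<close>

definition cutoff :: "real \<Rightarrow> real" where
  "cutoff s = max 0 (1 - 8 * max 0 (s - 1/2) ^ 3) ^ 3"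

text \<open>Minus the derivative of \<open>cutoff\<close>; 72 = 3 * 8 * 3 collects the factors of
  the two cubes.\<close>

definition cutoff_slope :: "real \<Rightarrow> real" where
  "cutoff_slope s = 72 * (max 0 (1 - 8 * max 0 (s - 1/2) ^ 3) ^ 2 * max 0 (s - 1/2) ^ 2)"

lemma DERIV_pos_part_inner:
  "((\<lambda>s::real. 1 - 8 * max 0 (s - 1/2) ^ 3) has_real_derivative - (24 * max 0 (s - 1/2) ^ 2)) (at s)"
proof -
  have "((\<lambda>s::real. max 0 (s - 1/2) ^ 3) has_real_derivative (3 * max 0 (s - 1/2) ^ 2) * 1) (at s)"
  proof -
    have "((\<lambda>s. s - 1/2) has_real_derivative 1) (at s)"
      by (auto intro!: derivative_eq_intros)
    from DERIV_chain'[OF this DERIV_pos_part_power[of 1]]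
    show ?thesis by (simp add: numeral_eq_Suc)
  qed
  from DERIV_diff[OF DERIV_const DERIV_cmult[OF this, of 8], of 1] show ?thesis by simp
qed

lemma DERIV_cutoff: "(cutoff has_real_derivative - cutoff_slope s) (at s)"
proof -
  have "((\<lambda>s. max 0 (1 - 8 * max 0 (s - 1/2) ^ 3) ^ Suc (Suc 1)) has_real_derivative
     (real (Suc (Suc 1)) * max 0 (1 - 8 * max 0 (s - 1/2) ^ 3) ^ Suc 1) * (- (24 * max 0 (s - 1/2) ^ 2))) (at s)"
    by (rule DERIV_chain'[OF DERIV_pos_part_inner DERIV_pos_part_power])
  then show ?thesis
    unfolding cutoff_def[abs_def] cutoff_slope_def by (simp add: numeral_eq_Suc mult_ac)
qed

lemma cutoff_slope_C1:
  "\<exists>d. (\<forall>s. (cutoff_slope has_real_derivative d s) (at s)) \<and> continuous_on UNIV d"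
proof -
  define m1 :: "real \<Rightarrow> real" where "m1 s = max 0 (1 - 8 * max 0 (s - 1/2) ^ 3)" for s
  define m2 :: "real \<Rightarrow> real" where "m2 s = max 0 (s - 1/2)" for s
  have d1: "((\<lambda>s. m1 s ^ 2) has_real_derivative (2 * m1 s) * (- (24 * m2 s ^ 2))) (at s)" for s
    using DERIV_chain'[OF DERIV_pos_part_inner DERIV_pos_part_power[of 0]]
    unfolding m1_def m2_def by (simp add: numeral_2_eq_2)
  have d2: "((\<lambda>s. m2 s ^ 2) has_real_derivative 2 * m2 s) (at s)" for s
  proof -
    have "((\<lambda>s. s - 1/2) has_real_derivative 1) (at s)"
      by (auto intro!: derivative_eq_intros)
    from DERIV_chain'[OF this DERIV_pos_part_power[of 0]]
    show ?thesis by (simp add: m2_def numeral_2_eq_2)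
  qed
  define d where "d s = 72 * (((2 * m1 s) * (- (24 * m2 s ^ 2))) * m2 s ^ 2 + (2 * m2 s) * m1 s ^ 2)" for s
  have "(cutoff_slope has_real_derivative d s) (at s)" for s
  proof -
    have eq: "cutoff_slope = (\<lambda>s. 72 * (m1 s ^ 2 * m2 s ^ 2))"
      by (simp add: fun_eq_iff cutoff_slope_def m1_def m2_def)
    show ?thesis unfolding eq d_def by (intro DERIV_cmult DERIV_mult d1 d2)
  qed
  moreover have "continuous_on UNIV d"
    unfolding d_def m1_def m2_def by (intro continuous_intros)
  ultimately show ?thesis by blast
qed

lemma cutoff_values:
  shows "s \<le> 1/2 \<Longrightarrow> cutoff s = 1" "s \<ge> 1 \<Longrightarrow> cutoff s = 0" "0 \<le> cutoff s" "cutoff s \<le> 1"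
    and "s \<le> 1/2 \<Longrightarrow> cutoff_slope s = 0" "s \<ge> 1 \<Longrightarrow> cutoff_slope s = 0" "0 \<le> cutoff_slope s" "cutoff_slope s \<le> 72"
    and "0 < cutoff_slope (3/4)"
proof -
  show "s \<le> 1/2 \<Longrightarrow> cutoff s = 1" "s \<le> 1/2 \<Longrightarrow> cutoff_slope s = 0" "0 \<le> cutoff s" "0 \<le> cutoff_slope s"
    by (auto simp: cutoff_def cutoff_slope_def)
  have big: "1 - 8 * max 0 (s - 1/2) ^ 3 \<le> 0" if "s \<ge> 1"
  proof -
    have "(1/2) ^ 3 \<le> max 0 (s - 1/2) ^ 3" using that by (intro power_mono) auto
    then show ?thesis by (simp add: power_divide)
  qed
  show 1: "s \<ge> 1 \<Longrightarrow> cutoff s = 0" "s \<ge> 1 \<Longrightarrow> cutoff_slope s = 0"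
    using big by (auto simp: cutoff_def cutoff_slope_def max_def)
  have le1: "max 0 (1 - 8 * max 0 (s - 1/2) ^ 3) \<le> 1" by simp
  show "cutoff s \<le> 1"
    unfolding cutoff_def using power_mono[OF le1, of 3] by simp
  show "cutoff_slope s \<le> 72"
  proof (cases "s \<ge> 1")
    case False
    then have "max 0 (s - 1/2) ^ 2 \<le> 1 ^ 2" by (intro power_mono) auto
    moreover have "max 0 (1 - 8 * max 0 (s - 1/2) ^ 3) ^ 2 \<le> 1 ^ 2" using le1 by (intro power_mono) auto
    ultimately have "max 0 (1 - 8 * max 0 (s - 1/2) ^ 3) ^ 2 * max 0 (s - 1/2) ^ 2 \<le> 1 * 1"
      by (intro mult_mono) auto
    then show ?thesis by (simp add: cutoff_slope_def)
  qed (use 1 in auto)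
  show "0 < cutoff_slope (3/4)"
    by (simp add: cutoff_slope_def power_divide max_def)
qed

text \<open>The power may be singular at 0, but \<open>k\<close> vanishes below \<delta>: the
  product is C^1 on s > 0 and identically 0 on s < \<delta>, and these two open sets cover the
  line.\<close>

lemma DERIV_powr_times:
  fixes k :: "real \<Rightarrow> real"
  assumes k: "\<And>s. (k has_real_derivative k' s) (at s)" and k': "continuous_on UNIV k'"
    and "0 < \<delta>" and zero: "\<And>s. s < \<delta> \<Longrightarrow> k s = 0"
  shows "((\<lambda>s. s powr a * k s) has_real_derivative a * s powr (a - 1) * k s + s powr a * k' s) (at s)"
    and "continuous_on UNIV (\<lambda>s. a * s powr (a - 1) * k s + s powr a * k' s)"
    and "s < \<delta> \<Longrightarrow> k' s = 0"
proof -
  have z': "k' s = 0" if "s < \<delta>" for s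
  proof -
    have "((\<lambda>_. 0) has_real_derivative k' s) (at s)"
      by (rule has_field_derivative_transform_within_open[OF k, of "{..<\<delta>}"]) (use that zero in auto)
    then show ?thesis using DERIV_unique DERIV_const by blast
  qed
  show "s < \<delta> \<Longrightarrow> k' s = 0" by (rule z')
  show "((\<lambda>s. s powr a * k s) has_real_derivative a * s powr (a - 1) * k s + s powr a * k' s) (at s)"
  proof (cases "s < \<delta>")
    case True
    have "((\<lambda>_. 0) has_real_derivative 0) (at s)" by simp
    then have "((\<lambda>s. s powr a * k s) has_real_derivative 0) (at s)"
      by (rule has_field_derivative_transform_within_open[of _ _ _ "{..<\<delta>}"]) (use True zero in auto)
    then show ?thesis using True zero z' by simp
  next
    case False
    then have "s > 0" using \<open>0 < \<delta>\<close> by linarith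
    then have "((\<lambda>s. s powr a) has_real_derivative a * s powr (a - 1)) (at s)"
      by (rule has_real_derivative_powr)
    from DERIV_mult[OF this k] show ?thesis by (simp add: mult_ac)
  qed
  have kc: "continuous_on UNIV k"
    using k by (meson DERIV_continuous continuous_at_imp_continuous_on)
  have "continuous_on ({0<..} \<union> {..<\<delta>}) (\<lambda>s. a * s powr (a - 1) * k s + s powr a * k' s)"
  proof (rule continuous_on_open_Un)
    show "continuous_on {0<..} (\<lambda>s. a * s powr (a - 1) * k s + s powr a * k' s)"
      by (intro continuous_intros continuous_on_subset[OF kc] continuous_on_subset[OF k']) auto
    show "continuous_on {..<\<delta>} (\<lambda>s. a * s powr (a - 1) * k s + s powr a * k' s)"
      using zero z' by (intro continuous_on_cong[THEN iffD2, OF refl _ continuous_on_const[of _ 0]]) auto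
  qed auto
  moreover have "{0<..} \<union> {..<\<delta>} = UNIV" using \<open>0 < \<delta>\<close> by auto
  ultimately show "continuous_on UNIV (\<lambda>s. a * s powr (a - 1) * k s + s powr a * k' s)" by simp
qed

text \<open>The squared distance keeps radial functions differentiable at the centre. Summed over
  the basis, the last fact gives the divergence of the field (z - y) f(|z - y|^2).\<close>

lemma radial_test_fun:
  fixes y :: "'n::finite vec"
  assumes f: "\<And>s. (f has_real_derivative f' s) (at s)" and f': "continuous_on UNIV f'"
    and supp: "\<And>s. s \<ge> R\<^sup>2 \<Longrightarrow> f s = 0" and "0 < R" "cball y R \<subseteq> \<Omega>"
  shows "test_fun_on \<Omega> (\<lambda>z. f ((norm (z - y))\<^sup>2))"
    and "((\<lambda>z. f ((norm (z - y))\<^sup>2)) has_derivative (\<lambda>h. 2 * f' ((norm (z - y))\<^sup>2) * ((z - y) \<bullet> h))) (at z)"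
    and "test_fun_on \<Omega> (\<lambda>z. ((z - y) \<bullet> b) * f ((norm (z - y))\<^sup>2))"
    and "frechet_derivative (\<lambda>z. ((z - y) \<bullet> b) * f ((norm (z - y))\<^sup>2)) (at z) b =
      f ((norm (z - y))\<^sup>2) * (b \<bullet> b) + 2 * f' ((norm (z - y))\<^sup>2) * ((z - y) \<bullet> b)\<^sup>2"
proof -
  have d: "((\<lambda>z. f ((norm (z - y))\<^sup>2)) has_derivative (\<lambda>h. 2 * f' ((norm (z - y))\<^sup>2) * ((z - y) \<bullet> h))) (at z)" for z
  proof -
    have "((\<lambda>z. (norm (z - y))\<^sup>2) has_derivative (\<lambda>h. 2 * ((z - y) \<bullet> h))) (at z)"
      unfolding power2_norm_eq_inner by (auto intro!: derivative_eq_intros simp: inner_commute)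
    from has_derivative_compose[OF this f[unfolded has_field_derivative_def]]
    show ?thesis by (simp add: mult_ac)
  qed
  then show "((\<lambda>z. f ((norm (z - y))\<^sup>2)) has_derivative (\<lambda>h. 2 * f' ((norm (z - y))\<^sup>2) * ((z - y) \<bullet> h))) (at z)" .
  show t: "test_fun_on \<Omega> (\<lambda>z. f ((norm (z - y))\<^sup>2))"
  proof (rule test_fun_onI[where K = "cball y R"])
    show "((\<lambda>z. f ((norm (z - y))\<^sup>2)) has_derivative
        blinfun_apply ((2 * f' ((norm (z - y))\<^sup>2)) *\<^sub>R blinfun_inner_right (z - y))) (at z)" for z
      using d[of z] by (rule has_derivative_eq_rhs) (simp add: fun_eq_iff blinfun.scaleR_left blinfun_inner_right.rep_eq)
    show "continuous_on UNIV (\<lambda>z. (2 * f' ((norm (z - y))\<^sup>2)) *\<^sub>R blinfun_inner_right (z - y))"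
      by (intro continuous_intros continuous_on_compose2[OF f'] bounded_linear.continuous_on[OF bounded_linear_blinfun_inner_right]) auto
    show "f ((norm (z - y))\<^sup>2) = 0" if "z \<notin> cball y R" for z
      using that \<open>0 < R\<close> by (intro supp power_mono) (auto simp: dist_norm norm_minus_commute)
  qed (use assms in auto)
  have l: "((\<lambda>z. (z - y) \<bullet> b) has_derivative blinfun_apply (blinfun_inner_right b)) (at z)" for z
    by (auto intro!: derivative_eq_intros simp: blinfun_inner_right.rep_eq inner_commute)
  show "test_fun_on \<Omega> (\<lambda>z. ((z - y) \<bullet> b) * f ((norm (z - y))\<^sup>2))"
    by (rule test_fun_on_mult[OF t l]) (rule continuous_on_const)
  show "frechet_derivative (\<lambda>z. ((z - y) \<bullet> b) * f ((norm (z - y))\<^sup>2)) (at z) b =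
      f ((norm (z - y))\<^sup>2) * (b \<bullet> b) + 2 * f' ((norm (z - y))\<^sup>2) * ((z - y) \<bullet> b)\<^sup>2"
    using frechet_derivative_at[OF has_derivative_mult[OF l d], symmetric]
    by (simp add: blinfun_inner_right.rep_eq power2_eq_square mult_ac)
qed

section \<open>Bumps that are divergences of radial fields\<close>

text \<open>For z \<noteq> 0 this is minus the divergence of z |z|^(-N) cutoff(|z|^2 / R^2): the
  field z |z|^(-N) is divergence free away from 0, so only the derivative of the cutoff survives. It
  lives on the shell R^2 / 2 \<le> |z|^2 \<le> R^2.\<close>

definition bump :: "real \<Rightarrow> 'n::finite vec \<Rightarrow> real" where
  "bump R z = (norm z)\<^sup>2 powr (1 - real CARD('n) / 2) * (2 * cutoff_slope ((norm z)\<^sup>2 / R\<^sup>2) / R\<^sup>2)"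

abbreviation riesz :: "'n::finite vec \<Rightarrow> 'n vec \<Rightarrow> real" where
  "riesz y z \<equiv> norm (z - y) powr (1 - real CARD('n))"

text \<open>Truncated Riesz potential of order one, as an extended nonnegative number so that no
  integrability has to be carried along.\<close>

definition potential :: "('n::finite vec \<Rightarrow> real) \<Rightarrow> 'n vec \<Rightarrow> real \<Rightarrow> ennreal" where
  "potential g y R = (\<integral>\<^sup>+z. ennreal (\<bar>g z\<bar> * riesz y z) * indicator (ball y R) z \<partial>lebesgue)"

lemma bump_nonneg: "0 \<le> bump R z"
  by (simp add: bump_def cutoff_values)

lemma bump_eq_0: "R > 0 \<Longrightarrow> norm z \<ge> R \<Longrightarrow> bump R z = 0"
  by (simp add: bump_def cutoff_values power_mono)

text \<open>On the support |z|^(2 - N) \<le> R |z|^(1 - N), and the slope is at most 72; the factor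
  2 in \<open>bump\<close> makes 144.\<close>

lemma bump_le:
  fixes z :: "'n::finite vec"
  assumes "R > 0"
  shows "bump R z \<le> 144 / R * norm z powr (1 - real CARD('n))"
proof (cases "z = 0 \<or> norm z \<ge> R")
  case True
  then show ?thesis using assms bump_eq_0[OF assms, of z] by (auto simp: bump_def)
next
  case False
  then have z: "0 < norm z" "norm z < R" by auto
  have "(norm z)\<^sup>2 powr (1 - real CARD('n) / 2) = norm z powr (2 * (1 - real CARD('n) / 2))"
    using z powr_powr[of "norm z" 2 "1 - real CARD('n) / 2"] by simp
  also have "\<dots> = norm z powr (1 + (1 - real CARD('n)))" by (simp add: algebra_simps)
  also have "\<dots> = norm z * norm z powr (1 - real CARD('n))"
    using z by (subst powr_add) simp
  also have "\<dots> \<le> R * norm z powr (1 - real CARD('n))"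
    using z by (intro mult_right_mono) auto
  finally have 1: "(norm z)\<^sup>2 powr (1 - real CARD('n) / 2) \<le> R * norm z powr (1 - real CARD('n))" .
  have 2: "2 * cutoff_slope ((norm z)\<^sup>2 / R\<^sup>2) / R\<^sup>2 \<le> 144 / R\<^sup>2"
    using cutoff_values(8)[of "(norm z)\<^sup>2 / R\<^sup>2"] by (intro divide_right_mono) auto
  have "bump R z \<le> (R * norm z powr (1 - real CARD('n))) * (144 / R\<^sup>2)"
    unfolding bump_def using assms by (intro mult_mono 1 2) (auto simp: cutoff_values)
  also have "\<dots> = 144 / R * norm z powr (1 - real CARD('n))"
    using assms by (simp add: power2_eq_square)
  finally show ?thesis .
qed

lemma DERIV_scaled_cutoff:
  "((\<lambda>s. cutoff (s / R\<^sup>2)) has_real_derivative - (cutoff_slope (s / R\<^sup>2) / R\<^sup>2)) (at s)"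
proof -
  have "((\<lambda>s. s / R\<^sup>2) has_real_derivative 1 / R\<^sup>2) (at s)"
    by (intro DERIV_cdivide DERIV_ident)
  from DERIV_chain'[OF this DERIV_cutoff] show ?thesis by simp
qed

lemma cutoff_slope_continuous: "continuous_on UNIV cutoff_slope"
  using cutoff_slope_C1 by (meson DERIV_continuous continuous_at_imp_continuous_on)

lemma bump_test_fun:
  fixes y :: "'n::finite vec"
  assumes "0 < R" "cball y R \<subseteq> \<Omega>"
  shows "test_fun_on \<Omega> (\<lambda>z. bump R (z - y))"
proof -
  obtain d where d: "\<And>s. (cutoff_slope has_real_derivative d s) (at s)" "continuous_on UNIV d"
    using cutoff_slope_C1 by auto
  define k where "k s = 2 * cutoff_slope (s / R\<^sup>2) / R\<^sup>2" for s
  define k' where "k' s = 2 * (d (s / R\<^sup>2) * (1 / R\<^sup>2)) / R\<^sup>2" for s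
  have k: "(k has_real_derivative k' s) (at s)" for s
  proof -
    have "((\<lambda>s. s / R\<^sup>2) has_real_derivative 1 / R\<^sup>2) (at s)"
      by (intro DERIV_cdivide DERIV_ident)
    from DERIV_chain'[OF this d(1)]
    show ?thesis unfolding k_def[abs_def] k'_def by (intro DERIV_cdivide DERIV_cmult) simp
  qed
  have k': "continuous_on UNIV k'"
    unfolding k'_def by (intro continuous_intros continuous_on_compose2[OF d(2)]) (use assms in auto)
  have z: "k s = 0" if "s < R\<^sup>2 / 2" for s
    using that assms by (simp add: k_def cutoff_values field_simps)
  have \<delta>: "0 < R\<^sup>2 / 2" using assms by simp
  have "test_fun_on \<Omega> (\<lambda>z. (norm (z - y))\<^sup>2 powr (1 - real CARD('n) / 2) * k ((norm (z - y))\<^sup>2))"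
  proof (rule radial_test_fun(1)[OF DERIV_powr_times(1,2)[OF k k' \<delta> z]])
    show "s powr (1 - real CARD('n) / 2) * k s = 0" if "s \<ge> R\<^sup>2" for s
      using that assms by (simp add: k_def cutoff_values)
  qed (use assms in auto)
  then show ?thesis by (simp add: k_def bump_def)
qed

text \<open>If f is not integrable, its Bochner integral is 0 by convention and the bound is
  trivial.\<close>

lemma ennreal_abs_integral_le:
  fixes f :: "'a \<Rightarrow> real"
  assumes "\<And>x. \<bar>f x\<bar> \<le> h x"
  shows "ennreal \<bar>integral\<^sup>L M f\<bar> \<le> (\<integral>\<^sup>+x. ennreal (h x) \<partial>M)"
proof (cases "integrable M f")
  case True
  then have "ennreal \<bar>integral\<^sup>L M f\<bar> \<le> (\<integral>\<^sup>+x. ennreal \<bar>f x\<bar> \<partial>M)"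
    using integral_norm_bound_ennreal[OF True] by simp
  also have "\<dots> \<le> (\<integral>\<^sup>+x. ennreal (h x) \<partial>M)"
    by (intro nn_integral_mono ennreal_leI assms)
  finally show ?thesis .
qed (simp add: not_integrable_integral_eq)

text \<open>With s = |z - y|^2, the radial field (z - y) s^(-N/2), cut off between the scales R' and R, has divergence
  bump R' - bump R.\<close>

lemma bump_scale_identity:
  fixes u :: "'n::finite vec \<Rightarrow> real"
  assumes u: "continuous_on UNIV u" and g: "\<And>b. b \<in> Basis \<Longrightarrow> weak_partial_on \<Omega> u b (g b)"
    and R: "0 < R'" "R' < R" "cball y R \<subseteq> \<Omega>"
  shows "\<exists>p. (\<forall>z. \<bar>p z\<bar> \<le> norm (z - y) powr (- real CARD('n)) * indicator (ball y R) z) \<and>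
    (\<integral>z. u z * (bump R' (z - y) - bump R (z - y)) \<partial>lborel)
      = - (\<Sum>b\<in>Basis. \<integral>z. g b z * (((z - y) \<bullet> b) * p z) \<partial>lebesgue)"
proof -
  let ?N = "real CARD('n)"
  define k where "k s = cutoff (s / R\<^sup>2) - cutoff (s / R'\<^sup>2)" for s
  define k' where "k' s = - (cutoff_slope (s / R\<^sup>2) / R\<^sup>2) - - (cutoff_slope (s / R'\<^sup>2) / R'\<^sup>2)" for s
  define P where "P s = s powr (- ?N / 2) * k s" for s
  define P' where "P' s = (- ?N / 2) * s powr (- ?N / 2 - 1) * k s + s powr (- ?N / 2) * k' s" for s
  have R2: "R'\<^sup>2 < R\<^sup>2" using R by (simp add: power_strict_mono)
  have k: "(k has_real_derivative k' s) (at s)" for s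
    unfolding k_def[abs_def] k'_def by (intro DERIV_diff DERIV_scaled_cutoff)
  have k'c: "continuous_on UNIV k'"
    unfolding k'_def by (intro continuous_intros continuous_on_compose2[OF cutoff_slope_continuous]) (use R in auto)
  have z: "k s = 0" if "s < R'\<^sup>2 / 2" for s
    using that R R2 by (simp add: k_def cutoff_values field_simps)
  have \<delta>: "0 < R'\<^sup>2 / 2" using R by simp
  have P: "(P has_real_derivative P' s) (at s)" for s
    unfolding P_def[abs_def] P'_def by (rule DERIV_powr_times(1)[OF k k'c \<delta> z])
  have P'c: "continuous_on UNIV P'"
    unfolding P'_def[abs_def] by (rule DERIV_powr_times(2)[OF k k'c \<delta> z])
  have k'0: "k' s = 0" if "s < R'\<^sup>2 / 2" for s
    by (rule DERIV_powr_times(3)[OF k k'c \<delta> z that])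
  have kR: "k s = 0" if "s \<ge> R\<^sup>2" for s
    using that R R2 by (simp add: k_def cutoff_values field_simps)
  have PR: "P s = 0" if "s \<ge> R\<^sup>2" for s
    using kR[OF that] by (simp add: P_def)
  have k1: "\<bar>k s\<bar> \<le> 1" for s
    unfolding k_def using cutoff_values(3,4)[of "s / R\<^sup>2"] cutoff_values(3,4)[of "s / R'\<^sup>2"] by linarith
  \<comment> \<open>The exponent -N/2 is the one for which the terms in k cancel, N s^(-N/2) k
    against 2 s (-N/2) s^(-N/2 - 1) k. At s = 0 everything vanishes, since k and k' are 0 near
    0.\<close>
  have div: "?N * P s + 2 * s * P' s = s powr (1 - ?N / 2) * (2 * k' s)" if "s \<ge> 0" for s
  proof (cases "s = 0")
    case True
    then show ?thesis using k'0[of 0] z[of 0] \<delta> by (simp add: P_def)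
  next
    case False
    then have "s > 0" using that by simp
    then have e: "s * s powr (- ?N / 2 - 1) = s powr (- ?N / 2)" "s * s powr (- ?N / 2) = s powr (1 - ?N / 2)"
      by (simp_all add: powr_mult_base)
    have "2 * s * P' s = - ?N * (s * s powr (- ?N / 2 - 1)) * k s + 2 * (s * s powr (- ?N / 2)) * k' s"
      by (simp add: P'_def algebra_simps)
    then show ?thesis unfolding e by (simp add: P_def)
  qed
  define \<phi> where "\<phi> b z = ((z - y) \<bullet> b) * P ((norm (z - y))\<^sup>2)" for b z
  have R0: "0 < R" using R by simp
  note rt = radial_test_fun[OF P P'c PR R0 R(3)]
  have t: "test_fun_on \<Omega> (\<phi> b)" for b
    unfolding \<phi>_def by (rule rt(3))
  have fd: "frechet_derivative (\<phi> b) (at z) b = P ((norm (z - y))\<^sup>2) + 2 * P' ((norm (z - y))\<^sup>2) * ((z - y) \<bullet> b)\<^sup>2"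
    if "b \<in> Basis" for b z
    using rt(4)[of b z] that unfolding \<phi>_def by simp
  have sum: "(\<Sum>b\<in>Basis. frechet_derivative (\<phi> b) (at z) b) = bump R' (z - y) - bump R (z - y)" for z
  proof -
    let ?s = "(norm (z - y))\<^sup>2"
    have "(\<Sum>b\<in>Basis. frechet_derivative (\<phi> b) (at z) b) = (\<Sum>b\<in>(Basis :: 'n vec set). P ?s) + (\<Sum>b\<in>Basis. 2 * P' ?s * ((z - y) \<bullet> b)\<^sup>2)"
      by (simp add: fd sum.distrib)
    also have "(\<Sum>b\<in>Basis. 2 * P' ?s * ((z - y) \<bullet> b)\<^sup>2) = 2 * P' ?s * ?s"
      by (simp add: norm_eq_sqrt_inner euclidean_inner[of "z - y" "z - y"] power2_eq_square sum_distrib_left sum_nonneg)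
    also have "(\<Sum>b\<in>(Basis :: 'n vec set). P ?s) + 2 * P' ?s * ?s = ?s powr (1 - ?N / 2) * (2 * k' ?s)"
      using div[of ?s] by (simp add: mult_ac)
    also have "\<dots> = bump R' (z - y) - bump R (z - y)"
      by (simp add: bump_def k'_def algebra_simps)
    finally show ?thesis .
  qed
  have "(\<integral>z. u z * (bump R' (z - y) - bump R (z - y)) \<partial>lborel) = (\<integral>z. (\<Sum>b\<in>Basis. u z * frechet_derivative (\<phi> b) (at z) b) \<partial>lborel)"
    by (simp add: sum[symmetric] sum_distrib_left)
  also have "\<dots> = (\<Sum>b\<in>Basis. \<integral>z. u z * frechet_derivative (\<phi> b) (at z) b \<partial>lborel)"
    by (intro Bochner_Integration.integral_sum test_fun_measurable[OF t] u)
  also have "\<dots> = (\<Sum>b\<in>Basis. \<integral>z. u z * frechet_derivative (\<phi> b) (at z) b \<partial>lebesgue)"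
    by (intro sum.cong refl integral_lebesgue_continuous[symmetric] continuous_intros test_fun_measurable[OF t] u)
  also have "\<dots> = (\<Sum>b\<in>Basis. - (\<integral>z. g b z * \<phi> b z \<partial>lebesgue))"
    using g t unfolding weak_partial_on_def by (intro sum.cong) auto
  also have "\<dots> = - (\<Sum>b\<in>Basis. \<integral>z. g b z * (((z - y) \<bullet> b) * P ((norm (z - y))\<^sup>2)) \<partial>lebesgue)"
    by (simp add: sum_negf \<phi>_def)
  finally have main: "(\<integral>z. u z * (bump R' (z - y) - bump R (z - y)) \<partial>lborel)
      = - (\<Sum>b\<in>Basis. \<integral>z. g b z * (((z - y) \<bullet> b) * P ((norm (z - y))\<^sup>2)) \<partial>lebesgue)" .
  have bd: "\<bar>P ((norm (z - y))\<^sup>2)\<bar> \<le> norm (z - y) powr (- ?N) * indicator (ball y R) z" for z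
  proof (cases "z \<in> ball y R")
    case False
    then have "R\<^sup>2 \<le> (norm (z - y))\<^sup>2" using R0 by (intro power_mono) (auto simp: dist_norm norm_minus_commute)
    then show ?thesis using False by (simp add: PR)
  next
    case True
    have "\<bar>P ((norm (z - y))\<^sup>2)\<bar> \<le> (norm (z - y))\<^sup>2 powr (- ?N / 2) * 1"
      unfolding P_def abs_mult using k1 by (intro mult_mono) auto
    also have "(norm (z - y))\<^sup>2 powr (- ?N / 2) = norm (z - y) powr (- ?N)"
    proof (cases "z = y")
      case False
      then show ?thesis using powr_powr[of "norm (z - y)" 2 "- ?N / 2"] by simp
    qed simp
    finally show ?thesis using True by simp
  qed
  show ?thesis
    using main bd by (intro exI[of _ "\<lambda>z. P ((norm (z - y))\<^sup>2)"]) simp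
qed

text \<open>Contracting z - y with a basis vector gains one power of the distance over the bound on
  p, which produces the Riesz kernel. The right-hand side is independent of R', so the smaller scale
  may shrink to 0.\<close>

lemma bump_scale_bound:
  fixes u :: "'n::finite vec \<Rightarrow> real"
  assumes u: "continuous_on UNIV u" and g: "\<And>b. b \<in> Basis \<Longrightarrow> weak_partial_on \<Omega> u b (g b)"
    and R: "0 < R'" "R' < R" "cball y R \<subseteq> \<Omega>"
  shows "ennreal \<bar>\<integral>z. u z * (bump R' (z - y) - bump R (z - y)) \<partial>lborel\<bar> \<le> (\<Sum>b\<in>Basis. potential (g b) y R)"
proof -
  let ?N = "real CARD('n)"
  obtain p where p: "\<And>z. \<bar>p z\<bar> \<le> norm (z - y) powr (- ?N) * indicator (ball y R) z"
    and eq: "(\<integral>z. u z * (bump R' (z - y) - bump R (z - y)) \<partial>lborel)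
      = - (\<Sum>b\<in>Basis. \<integral>z. g b z * (((z - y) \<bullet> b) * p z) \<partial>lebesgue)"
    using bump_scale_identity[OF u g R] by blast
  have "\<bar>\<integral>z. u z * (bump R' (z - y) - bump R (z - y)) \<partial>lborel\<bar>
      \<le> (\<Sum>b\<in>Basis. \<bar>\<integral>z. g b z * (((z - y) \<bullet> b) * p z) \<partial>lebesgue\<bar>)"
    unfolding eq by (simp add: sum_abs)
  then have "ennreal \<bar>\<integral>z. u z * (bump R' (z - y) - bump R (z - y)) \<partial>lborel\<bar>
      \<le> (\<Sum>b\<in>Basis. ennreal \<bar>\<integral>z. g b z * (((z - y) \<bullet> b) * p z) \<partial>lebesgue\<bar>)"
    by (simp add: sum_ennreal ennreal_leI)
  also have "\<dots> \<le> (\<Sum>b\<in>Basis. potential (g b) y R)"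
  proof (intro sum_mono)
    fix b :: "'n vec" assume b: "b \<in> Basis"
    have "\<bar>g b z * (((z - y) \<bullet> b) * p z)\<bar> \<le> \<bar>g b z\<bar> * riesz y z * indicator (ball y R) z" for z
    proof -
      have "\<bar>((z - y) \<bullet> b) * p z\<bar> \<le> norm (z - y) * (norm (z - y) powr (- ?N) * indicator (ball y R) z)"
        unfolding abs_mult using b by (intro mult_mono p Basis_le_norm) auto
      also have "norm (z - y) * (norm (z - y) powr (- ?N) * indicator (ball y R) z) = riesz y z * indicator (ball y R) z"
        by (simp add: powr_mult_base mult.assoc[symmetric])
      finally show ?thesis by (simp add: abs_mult[of "g b z"] mult.assoc mult_left_mono)
    qed
    then have "ennreal \<bar>\<integral>z. g b z * (((z - y) \<bullet> b) * p z) \<partial>lebesgue\<bar> \<le>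
        (\<integral>\<^sup>+z. ennreal (\<bar>g b z\<bar> * riesz y z * indicator (ball y R) z) \<partial>lebesgue)"
      by (rule ennreal_abs_integral_le)
    also have "\<dots> = potential (g b) y R"
      unfolding potential_def by (intro nn_integral_cong) (auto simp: indicator_def)
    finally show "ennreal \<bar>\<integral>z. g b z * (((z - y) \<bullet> b) * p z) \<partial>lebesgue\<bar> \<le> potential (g b) y R" .
  qed
  finally show ?thesis .
qed

lemma bump_test_fun_0: "0 < R \<Longrightarrow> test_fun_on UNIV (bump R)"
  using bump_test_fun[of R 0 UNIV] by simp

lemma bump_integrable:
  fixes y :: "'n::finite vec"
  assumes "0 < R" "continuous_on UNIV u"
  shows "integrable lborel (\<lambda>z. u z * bump R (z - y))" "integrable lborel (\<lambda>z. bump R (z - y))"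
  using test_fun_measurable(3)[OF bump_test_fun[OF assms(1), of y UNIV]] assms(2)
    test_fun_measurable(3)[OF bump_test_fun[OF assms(1), of y UNIV], of "\<lambda>_. 1"]
  by (auto simp: continuous_on_const)

abbreviation bump_mass :: "'n::finite itself \<Rightarrow> real" where
  "bump_mass _ \<equiv> integral\<^sup>L lborel (bump 1 :: 'n vec \<Rightarrow> real)"

text \<open>The two-scale identity applied to the constant 1, whose weak partials are 0, shows
  independence of R; translation invariance gives independence of the centre.\<close>

lemma integral_bump:
  fixes y :: "'n::finite vec"
  assumes "0 < R"
  shows "(\<integral>z. bump R (z - y) \<partial>lborel) = bump_mass TYPE('n)" (is "?I R y = _")
proof -
  have mono: "?I R' 0 = ?I R 0" if "0 < R'" "R' < R" for R' R
  proof -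
    have w: "weak_partial_on UNIV (\<lambda>z. 0 \<bullet> z + 1) b (\<lambda>z. 0 \<bullet> b)" for b :: "'n vec"
      by (rule weak_partial_affine)
    have c: "continuous_on UNIV (\<lambda>z. (0 :: 'n vec) \<bullet> z + 1)" by (intro continuous_intros)
    have "(\<integral>z. (0 \<bullet> z + 1) * (bump R' (z - 0) - bump R (z - (0::'n vec))) \<partial>lborel) = 0"
      using bump_scale_identity[OF c w that, of 0] by auto
    then have "(\<integral>z. bump R' (z - 0) - bump R (z - (0::'n vec)) \<partial>lborel) = 0" by simp
    then show ?thesis
      using that by (subst (asm) Bochner_Integration.integral_diff) (auto intro: bump_integrable(2)[OF _ continuous_on_const, of _ 0, simplified])
  qed
  have "?I R y = ?I R 0"
  proof -
    have "?I R 0 = (\<integral>z. bump R z \<partial>distr lborel borel ((+) (- y)))"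
      by (simp add: lborel_distr_plus)
    also have "\<dots> = (\<integral>z. bump R (- y + z) \<partial>lborel)"
      using test_fun_measurable(1)[OF bump_test_fun_0[OF assms]]
      by (intro integral_distr) (auto intro: borel_measurable_continuous_onI)
    finally show ?thesis by simp
  qed
  also have "?I R 0 = ?I 1 0"
    using mono[of R 1] mono[of 1 R] assms by (cases "R = 1") (auto simp: neq_iff)
  finally show ?thesis by simp
qed

text \<open>A continuous nonnegative function with integral 0 over a box vanishes there, whereas
  \<open>bump 1\<close> is positive where |z|^2 = 3/4, midway through its shell.\<close>

lemma bump_mass_pos: "0 < bump_mass TYPE('n::finite)"
proof -
  obtain b :: "'n vec" where b: "b \<in> Basis" using nonempty_Basis by blast
  let ?z = "sqrt (3/4) *\<^sub>R b"
  have n: "(norm ?z)\<^sup>2 = 3/4" using b by simp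
  have pos: "0 < bump 1 ?z"
    using cutoff_values(9) unfolding bump_def n by simp
  have bc: "continuous_on UNIV (bump 1 :: 'n vec \<Rightarrow> real)"
    by (rule test_fun_measurable(1)[OF bump_test_fun_0]) simp
  obtain a :: "'n vec" where a: "cball 0 1 \<subseteq> cbox (- a) a"
    using bounded_subset_cbox_symmetric[OF bounded_cball] by metis
  have out: "bump 1 z = 0" if "z \<notin> cbox (- a) a" for z :: "'n vec"
  proof (rule bump_eq_0)
    show "1 \<le> norm z" using that a by (metis linear mem_cball_0 subsetD)
  qed simp
  have eq: "bump_mass TYPE('n) = integral (cbox (- a) a) (bump 1)"
    by (rule integral_compact_support(2)[OF bc out])
  have "0 \<le> bump_mass TYPE('n)"
    by (intro integral_nonneg_AE) (simp add: bump_nonneg)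
  moreover have "bump_mass TYPE('n) \<noteq> 0"
  proof
    assume 0: "bump_mass TYPE('n) = 0"
    have "(bump 1 has_integral 0) (cbox (- a) a)"
      using integrable_integral[OF integrable_continuous[OF continuous_on_subset[OF bc]], of "-a" a] eq 0 by simp
    moreover have "?z \<in> cbox (- a) a"
    proof -
      have "norm ?z = sqrt (3/4)" using b by simp
      moreover have "sqrt (3/4) \<le> 1" by (rule real_le_lsqrt) auto
      ultimately have "norm ?z \<le> 1" by linarith
      then have "?z \<in> cball 0 1" by (simp only: mem_cball_0)
      then show ?thesis using a by blast
    qed
    moreover have "box (- a) a \<noteq> {}"
    proof
      assume "box (- a) a = {}"
      then have "negligible (cbox (- a) a)" by (simp add: negligible_interval)
      then have "negligible (ball (0::'n vec) 1)" using a by (meson ball_subset_cball negligible_subset)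
      then show False using open_not_negligible[of "ball (0::'n vec) 1"] by simp
    qed
    ultimately have "bump 1 ?z = 0"
      using has_integral_0_cbox_imp_0[of "- a" a "bump 1" ?z] continuous_on_subset[OF bc] by (auto simp: bump_nonneg)
    then show False using pos by simp
  qed
  ultimately show ?thesis by simp
qed

section \<open>From averages to point values\<close>

text \<open>As the scale R' tends to 0, the pairing with \<open>bump R'\<close> tends to the bump
  mass times u y by continuity, while its distance from the pairing at scale R never exceeds
  s.\<close>

lemma bump_average_bound:
  fixes u :: "'n::finite vec \<Rightarrow> real"
  assumes u: "continuous_on UNIV u" and g: "\<And>b. b \<in> Basis \<Longrightarrow> weak_partial_on \<Omega> u b (g b)"
    and R: "0 < R" "cball y R \<subseteq> \<Omega>" and s: "(\<Sum>b\<in>Basis. potential (g b) y R) \<le> ennreal s" "0 \<le> s"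
  shows "\<bar>bump_mass TYPE('n) * u y - (\<integral>z. u z * bump R (z - y) \<partial>lborel)\<bar> \<le> s"
proof -
  let ?c = "bump_mass TYPE('n)"
  have "\<bar>?c * u y - (\<integral>z. u z * bump R (z - y) \<partial>lborel)\<bar> \<le> s + e" if "e > 0" for e
  proof -
    have e: "e / ?c > 0" using that bump_mass_pos[where 'n = 'n] by (rule divide_pos_pos)
    have "isCont u y" using u by (simp add: continuous_on_eq_continuous_at)
    then obtain d where d: "d > 0" "\<And>z. dist z y < d \<Longrightarrow> dist (u z) (u y) < e / ?c"
      using e unfolding continuous_at_eps_delta by metis
    define R' where "R' = min d (R / 2)"
    have R': "0 < R'" "R' < R" "R' \<le> d" using d R by (auto simp: R'_def)
    have "ennreal \<bar>\<integral>z. u z * (bump R' (z - y) - bump R (z - y)) \<partial>lborel\<bar> \<le> ennreal s"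
      using bump_scale_bound[OF u g R'(1,2) R(2)] s(1) by (rule order_trans)
    then have 1: "\<bar>\<integral>z. u z * (bump R' (z - y) - bump R (z - y)) \<partial>lborel\<bar> \<le> s"
      using s(2) by (simp add: ennreal_le_iff)
    have 2: "(\<integral>z. u z * (bump R' (z - y) - bump R (z - y)) \<partial>lborel) =
        (\<integral>z. u z * bump R' (z - y) \<partial>lborel) - (\<integral>z. u z * bump R (z - y) \<partial>lborel)"
      unfolding right_diff_distrib by (intro Bochner_Integration.integral_diff bump_integrable R R' u)
    have "\<bar>?c * u y - (\<integral>z. u z * bump R' (z - y) \<partial>lborel)\<bar> \<le> e"
    proof -
      have "?c * u y = (\<integral>z. u y * bump R' (z - y) \<partial>lborel)"
        by (simp add: integral_bump[OF R'(1)])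
      then have "?c * u y - (\<integral>z. u z * bump R' (z - y) \<partial>lborel) = (\<integral>z. u y * bump R' (z - y) - u z * bump R' (z - y) \<partial>lborel)"
        using bump_integrable[OF R'(1) u, of y] by simp
      also have "\<bar>\<dots>\<bar> \<le> (\<integral>z. \<bar>u y * bump R' (z - y) - u z * bump R' (z - y)\<bar> \<partial>lborel)"
        by (rule integral_abs_bound)
      also have "\<dots> \<le> (\<integral>z. e / ?c * bump R' (z - y) \<partial>lborel)"
      proof (rule integral_mono)
        show "integrable lborel (\<lambda>z. \<bar>u y * bump R' (z - y) - u z * bump R' (z - y)\<bar>)"
          using bump_integrable[OF R'(1) u, of y] by simp
        show "integrable lborel (\<lambda>z. e / ?c * bump R' (z - y))"
          using bump_integrable[OF R'(1) u, of y] by simp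
        show "\<bar>u y * bump R' (z - y) - u z * bump R' (z - y)\<bar> \<le> e / ?c * bump R' (z - y)" for z
        proof (cases "norm (z - y) \<ge> R'")
          case True
          then show ?thesis using bump_eq_0[OF R'(1) True] by simp
        next
          case False
          then have "\<bar>u y - u z\<bar> \<le> e / ?c"
            using d(2)[of z] R'(3) by (auto simp: dist_norm abs_minus_commute)
          then have "\<bar>u y - u z\<bar> * bump R' (z - y) \<le> e / ?c * bump R' (z - y)"
            by (intro mult_right_mono bump_nonneg)
          moreover have "\<bar>u y * bump R' (z - y) - u z * bump R' (z - y)\<bar> = \<bar>u y - u z\<bar> * bump R' (z - y)"
            by (simp add: left_diff_distrib[symmetric] abs_mult bump_nonneg)
          ultimately show ?thesis by simp
        qed
      qed
      also have "\<dots> = e" using bump_mass_pos[where 'n = 'n] by (simp add: integral_bump[OF R'(1)])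
      finally show ?thesis .
    qed
    then show ?thesis using 1 2 by linarith
  qed
  then show ?thesis by (rule field_le_epsilon)
qed

text \<open>The weak derivative moves to u, with the bump itself as test function. The length |e|
  \<le> R cancels the 1/R of \<open>bump_le\<close>, leaving 144 times the potentials at every
  scale.\<close>

lemma bump_pairing_deriv_bound:
  fixes u :: "'n::finite vec \<Rightarrow> real"
  assumes u: "continuous_on UNIV u" and g: "\<And>b. b \<in> Basis \<Longrightarrow> weak_partial_on \<Omega> u b (g b)"
    and R: "0 < R" "cball v R \<subseteq> \<Omega>" and s: "(\<Sum>b\<in>Basis. potential (g b) v R) \<le> ennreal s" "0 \<le> s"
    and e: "norm e \<le> R" and gm: "\<And>b. b \<in> Basis \<Longrightarrow> g b \<in> borel_measurable lebesgue"
  shows "\<bar>\<integral>z. u z * frechet_derivative (\<lambda>z. bump R (z - v)) (at z) e \<partial>lborel\<bar> \<le> 144 * s"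
proof -
  let ?N = "real CARD('n)"
  define \<phi> where "\<phi> z = bump R (z - v)" for z
  have t: "test_fun_on \<Omega> \<phi>" unfolding \<phi>_def by (rule bump_test_fun[OF R])
  obtain D K where "C1_supported \<Omega> \<phi> D K" using test_fun_on_C1_supported[OF t] by blast
  note D = C1_supportedD[OF this]
  have lin: "frechet_derivative \<phi> (at z) e = (\<Sum>b\<in>Basis. (e \<bullet> b) * frechet_derivative \<phi> (at z) b)" for z
  proof -
    have "D z e = D z (\<Sum>b\<in>Basis. (e \<bullet> b) *\<^sub>R b)" by (simp add: euclidean_representation)
    also have "\<dots> = (\<Sum>b\<in>Basis. (e \<bullet> b) * D z b)"
      by (simp add: blinfun.sum_right blinfun.scaleR_right)
    finally show ?thesis by (simp add: D(7))
  qed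
  have "(\<integral>z. u z * frechet_derivative \<phi> (at z) e \<partial>lborel)
      = (\<integral>z. (\<Sum>b\<in>Basis. (e \<bullet> b) * (u z * frechet_derivative \<phi> (at z) b)) \<partial>lborel)"
    by (simp add: lin sum_distrib_left mult_ac)
  also have "\<dots> = (\<Sum>b\<in>Basis. (e \<bullet> b) * (\<integral>z. u z * frechet_derivative \<phi> (at z) b \<partial>lborel))"
    using test_fun_measurable(4)[OF t u] by simp
  also have "\<dots> = (\<Sum>b\<in>Basis. (e \<bullet> b) * - (\<integral>z. g b z * \<phi> z \<partial>lebesgue))"
  proof (intro sum.cong refl)
    fix b :: "'n vec" assume "b \<in> Basis"
    have "(\<integral>z. u z * frechet_derivative \<phi> (at z) b \<partial>lborel) = (\<integral>z. u z * frechet_derivative \<phi> (at z) b \<partial>lebesgue)"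
      by (intro integral_lebesgue_continuous[symmetric] continuous_intros test_fun_measurable[OF t] u)
    also have "\<dots> = - (\<integral>z. g b z * \<phi> z \<partial>lebesgue)"
      using g[OF \<open>b \<in> Basis\<close>] t unfolding weak_partial_on_def by blast
    finally show "(e \<bullet> b) * (\<integral>z. u z * frechet_derivative \<phi> (at z) b \<partial>lborel) = (e \<bullet> b) * - (\<integral>z. g b z * \<phi> z \<partial>lebesgue)"
      by simp
  qed
  finally have eq: "(\<integral>z. u z * frechet_derivative \<phi> (at z) e \<partial>lborel) = (\<Sum>b\<in>Basis. (e \<bullet> b) * - (\<integral>z. g b z * \<phi> z \<partial>lebesgue))" .
  have "ennreal \<bar>\<integral>z. u z * frechet_derivative \<phi> (at z) e \<partial>lborel\<bar> \<le> ennreal (\<Sum>b\<in>Basis. R * \<bar>\<integral>z. g b z * \<phi> z \<partial>lebesgue\<bar>)"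
    unfolding eq
  proof (rule ennreal_leI, rule order_trans[OF sum_abs], rule sum_mono)
    fix b :: "'n vec" assume "b \<in> Basis"
    have "\<bar>e \<bullet> b\<bar> \<le> R" using Basis_le_norm[OF \<open>b \<in> Basis\<close>, of e] e by simp
    then show "\<bar>(e \<bullet> b) * - (\<integral>z. g b z * \<phi> z \<partial>lebesgue)\<bar> \<le> R * \<bar>\<integral>z. g b z * \<phi> z \<partial>lebesgue\<bar>"
      by (simp add: abs_mult mult_right_mono)
  qed
  also have "\<dots> = (\<Sum>b\<in>Basis. ennreal (R * \<bar>\<integral>z. g b z * \<phi> z \<partial>lebesgue\<bar>))"
    using R by (simp add: sum_ennreal)
  also have "\<dots> \<le> (\<Sum>b\<in>Basis. ennreal 144 * potential (g b) v R)"
  proof (rule sum_mono)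
    fix b :: "'n vec" assume b: "b \<in> Basis"
    have "\<bar>g b z * \<phi> z\<bar> \<le> 144 / R * (\<bar>g b z\<bar> * riesz v z * indicator (ball v R) z)" for z
    proof (cases "norm (z - v) \<ge> R")
      case True
      then show ?thesis using bump_eq_0[OF R(1) True] R by (simp add: \<phi>_def)
    next
      case False
      then have "z \<in> ball v R" by (simp add: dist_norm norm_minus_commute)
      moreover have "\<bar>g b z\<bar> * \<phi> z \<le> \<bar>g b z\<bar> * (144 / R * riesz v z)"
        unfolding \<phi>_def by (intro mult_left_mono bump_le R) simp
      ultimately show ?thesis by (simp add: abs_mult \<phi>_def bump_nonneg mult_ac)
    qed
    then have "ennreal \<bar>\<integral>z. g b z * \<phi> z \<partial>lebesgue\<bar> \<le>
       (\<integral>\<^sup>+z. ennreal (144 / R * (\<bar>g b z\<bar> * riesz v z * indicator (ball v R) z)) \<partial>lebesgue)"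
      by (rule ennreal_abs_integral_le)
    then have "ennreal R * ennreal \<bar>\<integral>z. g b z * \<phi> z \<partial>lebesgue\<bar> \<le>
       ennreal R * (\<integral>\<^sup>+z. ennreal (144 / R * (\<bar>g b z\<bar> * riesz v z * indicator (ball v R) z)) \<partial>lebesgue)"
      by (rule mult_left_mono) simp
    also have "(\<integral>\<^sup>+z. ennreal (144 / R * (\<bar>g b z\<bar> * riesz v z * indicator (ball v R) z)) \<partial>lebesgue)
      = (\<integral>\<^sup>+z. ennreal (144 / R) * (ennreal (\<bar>g b z\<bar> * riesz v z) * indicator (ball v R) z) \<partial>lebesgue)"
      using R by (intro nn_integral_cong) (auto simp: indicator_def ennreal_mult[symmetric])
    also have "\<dots> = ennreal (144 / R) * potential (g b) v R"
      unfolding potential_def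
    proof (intro nn_integral_cmult borel_measurable_times_ennreal measurable_compose[OF _ measurable_ennreal] borel_measurable_times)
      show "(\<lambda>z. riesz v z) \<in> borel_measurable lebesgue"
        by (intro measurable_completion) measurable
      show "(\<lambda>z. \<bar>g b z\<bar>) \<in> borel_measurable lebesgue"
        using gm[OF b] by (rule borel_measurable_abs)
    qed (auto intro: borel_measurable_indicator)
    also have "ennreal R * (ennreal (144 / R) * potential (g b) v R) = ennreal 144 * potential (g b) v R"
      using R by (simp add: mult.assoc[symmetric] ennreal_mult[symmetric])
    finally show "ennreal (R * \<bar>\<integral>z. g b z * \<phi> z \<partial>lebesgue\<bar>) \<le> ennreal 144 * potential (g b) v R"
      using R by (simp add: ennreal_mult)
  qed
  also have "\<dots> = ennreal 144 * (\<Sum>b\<in>Basis. potential (g b) v R)" by (simp add: sum_distrib_left)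
  also have "\<dots> \<le> ennreal 144 * ennreal s" by (intro mult_left_mono s) simp
  also have "\<dots> = ennreal (144 * s)" by (rule ennreal_mult[symmetric]) (use s in auto)
  finally have "\<bar>\<integral>z. u z * frechet_derivative \<phi> (at z) e \<partial>lborel\<bar> \<le> 144 * s"
    using s by (simp add: ennreal_le_iff)
  then show ?thesis unfolding \<phi>_def[abs_def] .
qed

text \<open>Three comparisons: u y with the average at y, the averages at y and x with each other,
  the average at x with u x. The middle one uses the mean value theorem along the segment; its
  intermediate centre v is unknown, so the potentials are controlled at every centre within R of x.
  The losses 1 + 144 + 1 give 146.\<close>

lemma oscillation_bound:
  fixes u :: "'n::finite vec \<Rightarrow> real"
  assumes u: "continuous_on UNIV u" and g: "\<And>b. b \<in> Basis \<Longrightarrow> weak_partial_on \<Omega> u b (g b)"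
    and R: "0 < R" "cball x (2 * R) \<subseteq> \<Omega>" and y: "dist x y \<le> R"
    and s: "\<And>v. dist x v \<le> R \<Longrightarrow> (\<Sum>b\<in>Basis. potential (g b) v R) \<le> ennreal s" "0 \<le> s"
    and gm: "\<And>b. b \<in> Basis \<Longrightarrow> g b \<in> borel_measurable lebesgue"
  shows "bump_mass TYPE('n) * \<bar>u y - u x\<bar> \<le> 146 * s"
proof -
  let ?c = "bump_mass TYPE('n)"
  have sub: "cball v R \<subseteq> \<Omega>" if "dist x v \<le> R" for v
  proof
    fix z assume "z \<in> cball v R"
    then have "dist x z \<le> 2 * R" using that dist_triangle[of x z v] by simp
    then show "z \<in> \<Omega>" using R(2) by auto
  qed
  define f where "f \<tau> = (\<integral>z. u z * bump R (z - (x + \<tau> *\<^sub>R (y - x))) \<partial>lborel)" for \<tau>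
  have ave: "\<bar>?c * u v - (\<integral>z. u z * bump R (z - v) \<partial>lborel)\<bar> \<le> s" if "dist x v \<le> R" for v
    by (rule bump_average_bound[OF u g R(1) sub[OF that] s(1)[OF that] s(2)])
  have "(f has_real_derivative - (\<integral>z. u z * frechet_derivative (bump R) (at (z - (x + \<tau> *\<^sub>R (y - x)))) (y - x) \<partial>lborel)) (at \<tau>)" for \<tau>
    unfolding f_def[abs_def] by (rule translated_pairing_deriv[OF bump_test_fun_0[OF R(1)] u])
  from MVT2[of 0 1 f, OF _ this] obtain \<tau> where \<tau>: "0 < \<tau>" "\<tau> < 1"
    and eq: "f 1 - f 0 = - (\<integral>z. u z * frechet_derivative (bump R) (at (z - (x + \<tau> *\<^sub>R (y - x)))) (y - x) \<partial>lborel)"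
    by auto
  define v where "v = x + \<tau> *\<^sub>R (y - x)"
  have "dist x v \<le> R"
  proof -
    have "dist x v = \<tau> * dist x y" using \<tau> by (simp add: v_def dist_norm norm_minus_commute)
    also have "\<dots> \<le> 1 * R" using \<tau> y R by (intro mult_mono) auto
    finally show ?thesis by simp
  qed
  then have "\<bar>\<integral>z. u z * frechet_derivative (\<lambda>z. bump R (z - v)) (at z) (y - x) \<partial>lborel\<bar> \<le> 144 * s"
    using y by (intro bump_pairing_deriv_bound[OF u g R(1) sub s]) (auto simp: dist_norm norm_minus_commute gm)
  then have "\<bar>f 1 - f 0\<bar> \<le> 144 * s"
    unfolding eq by (simp add: test_fun_translate[OF bump_test_fun_0[OF R(1)]] v_def)
  moreover have "\<bar>?c * u y - f 1\<bar> \<le> s" "\<bar>?c * u x - f 0\<bar> \<le> s"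
    using ave[of y] ave[of x] y R by (simp_all add: f_def)
  ultimately have "\<bar>?c * u y - ?c * u x\<bar> \<le> 146 * s" by linarith
  then show ?thesis
    using bump_mass_pos[where 'n = 'n] by (simp add: right_diff_distrib[symmetric] abs_mult)
qed

section \<open>The Lorentz functional\<close>

definition superlevel :: "('n::finite vec \<Rightarrow> real) \<Rightarrow> 'n vec set \<Rightarrow> real \<Rightarrow> real" where
  "superlevel g B s = measure lborel {z\<in>B. s \<le> \<bar>g z\<bar>}"

text \<open>Up to a constant factor the L^{N,1} quasi-norm. Unlike \<open>lorentz_N1\<close> it
  refers to \<open>lborel\<close>: Borel representatives are used from here on, in order to apply
  Tonelli's theorem.\<close>

definition lorentz :: "('n::finite vec \<Rightarrow> real) \<Rightarrow> 'n vec set \<Rightarrow> ennreal" where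
  "lorentz g B = (\<integral>\<^sup>+s. indicator {0<..} s * ennreal (superlevel g B s powr (1 / real CARD('n))) \<partial>lborel)"

text \<open>Finiteness matters because \<open>measure\<close> assigns 0 to sets of infinite measure,
  which would destroy monotonicity of \<open>superlevel\<close> in the set.\<close>

abbreviation finite_borel :: "'n::finite vec set \<Rightarrow> bool" where
  "finite_borel B \<equiv> B \<in> sets borel \<and> emeasure lborel B < \<infinity>"

lemma superlevel_sets:
  fixes g :: "'n::finite vec \<Rightarrow> real"
  assumes "g \<in> borel_measurable borel" "B \<in> sets borel"
  shows "{z\<in>B. s \<le> \<bar>g z\<bar>} \<in> sets borel"
proof -
  have "{z\<in>B. s \<le> \<bar>g z\<bar>} = B \<inter> {z\<in>space borel. s \<le> \<bar>g z\<bar>}" by auto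
  also have "\<dots> \<in> sets borel"
  proof (rule sets.Int[OF assms(2)])
    note [measurable] = assms(1)
    show "{z\<in>space borel. s \<le> \<bar>g z\<bar>} \<in> sets borel" by measurable
  qed
  finally show ?thesis .
qed

lemma finite_borel_subset:
  assumes "finite_borel B" "A \<subseteq> B" "A \<in> sets borel"
  shows "finite_borel A"
  using assms emeasure_mono[of A B lborel] by (auto simp: order_le_less_trans)

lemma superlevel_fmeasurable:
  fixes g :: "'n::finite vec \<Rightarrow> real"
  assumes "g \<in> borel_measurable borel" "finite_borel B"
  shows "{z\<in>B. s \<le> \<bar>g z\<bar>} \<in> fmeasurable lborel"
proof -
  have "finite_borel {z\<in>B. s \<le> \<bar>g z\<bar>}"
    by (rule finite_borel_subset[OF assms(2)]) (use assms in \<open>auto intro: superlevel_sets\<close>)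
  then show ?thesis by (auto simp: fmeasurable_def)
qed

lemma superlevel_mono:
  assumes "g \<in> borel_measurable borel" "h \<in> borel_measurable borel" "A \<in> sets borel" "finite_borel B" "A \<subseteq> B"
    and "\<And>z. z \<in> A \<Longrightarrow> s \<le> \<bar>g z\<bar> \<Longrightarrow> t \<le> \<bar>h z\<bar>"
  shows "superlevel g A s \<le> superlevel h B t"
  unfolding superlevel_def using assms
  by (intro measure_mono_fmeasurable superlevel_fmeasurable) (auto intro: superlevel_sets)

lemma superlevel_nonneg: "0 \<le> superlevel g B s"
  by (simp add: superlevel_def)

lemma superlevel_measurable:
  assumes "g \<in> borel_measurable borel" "finite_borel B"
  shows "superlevel g B \<in> borel_measurable borel"
proof -
  have "mono (\<lambda>s. - superlevel g B s)"
    using assms by (intro monoI) (auto intro!: superlevel_mono)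
  then have "(\<lambda>s. - (- superlevel g B s)) \<in> borel_measurable borel"
    by (intro borel_measurable_uminus borel_measurable_mono)
  then show ?thesis by simp
qed

lemma superlevel_powr_measurable:
  assumes "g \<in> borel_measurable borel" "finite_borel B"
  shows "(\<lambda>s. ennreal (superlevel g B s powr p)) \<in> borel_measurable borel"
  using superlevel_measurable[OF assms] by measurable

lemma lorentz_mono:
  assumes "g \<in> borel_measurable borel" "h \<in> borel_measurable borel" "A \<in> sets borel" "finite_borel B" "A \<subseteq> B"
    and "\<And>z. z \<in> A \<Longrightarrow> \<bar>g z\<bar> \<le> \<bar>h z\<bar>"
  shows "lorentz g A \<le> lorentz h B"
  unfolding lorentz_def using assms
  by (intro nn_integral_mono mult_left_mono ennreal_leI powr_mono2 superlevel_mono)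
    (auto simp: superlevel_nonneg intro: order_trans)

text \<open>After dividing by a + b this is x \<le> x^p on [0, 1], added for the two shares.\<close>

lemma powr_add_le:
  fixes a b :: real
  assumes "0 \<le> a" "0 \<le> b" "0 \<le> p" "p \<le> 1"
  shows "(a + b) powr p \<le> a powr p + b powr p"
proof (cases "a + b = 0")
  case False
  then have ab: "a + b > 0" using assms by simp
  have le: "x / (a + b) \<le> (x / (a + b)) powr p" if "0 \<le> x" "x \<le> a + b" for x
  proof (cases "x = 0")
    case False
    then have "(x / (a + b)) powr 1 \<le> (x / (a + b)) powr p"
      using that ab assms by (intro powr_mono') auto
    then show ?thesis using that ab by simp
  qed simp
  have "1 = a / (a + b) + b / (a + b)" using ab by (simp add: add_divide_distrib[symmetric])
  also have "\<dots> \<le> (a / (a + b)) powr p + (b / (a + b)) powr p"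
    using assms by (intro add_mono le) auto
  also have "\<dots> = (a powr p + b powr p) / (a + b) powr p"
    using assms ab by (simp add: powr_divide add_divide_distrib)
  finally show ?thesis using ab by (simp add: field_simps)
qed (use assms in auto)

text \<open>If |f| \<ge> s then |g| or |h| is at least s/2; the N-th root is subadditive, and the
  substitution for s/2 gives the factor 2.\<close>

lemma lorentz_add:
  fixes g h :: "'n::finite vec \<Rightarrow> real"
  assumes g: "g \<in> borel_measurable borel" and h: "h \<in> borel_measurable borel" and B: "finite_borel B"
    and f: "f \<in> borel_measurable borel" and le: "\<And>z. z \<in> B \<Longrightarrow> \<bar>f z\<bar> \<le> \<bar>g z\<bar> + \<bar>h z\<bar>"
  shows "lorentz f B \<le> 2 * (lorentz g B + lorentz h B)"
proof -
  let ?p = "1 / real CARD('n)"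
  let ?F = "\<lambda>g s. indicator {0<..} s * ennreal (superlevel g B s powr ?p)"
  have p: "0 \<le> ?p" "?p \<le> 1" by (auto simp: divide_simps)
  have m: "?F g \<in> borel_measurable borel" "?F h \<in> borel_measurable borel"
    using superlevel_powr_measurable[OF g B] superlevel_powr_measurable[OF h B] by measurable
  have "superlevel f B s \<le> superlevel g B (s / 2) + superlevel h B (s / 2)" for s
  proof -
    have "superlevel f B s \<le> measure lborel ({z\<in>B. s / 2 \<le> \<bar>g z\<bar>} \<union> {z\<in>B. s / 2 \<le> \<bar>h z\<bar>})"
      unfolding superlevel_def
    proof (rule measure_mono_fmeasurable)
      show "{z\<in>B. s \<le> \<bar>f z\<bar>} \<subseteq> {z\<in>B. s / 2 \<le> \<bar>g z\<bar>} \<union> {z\<in>B. s / 2 \<le> \<bar>h z\<bar>}"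
        using le by fastforce
      show "{z\<in>B. s \<le> \<bar>f z\<bar>} \<in> sets lborel" using superlevel_sets[OF f] B by simp
      show "{z\<in>B. s / 2 \<le> \<bar>g z\<bar>} \<union> {z\<in>B. s / 2 \<le> \<bar>h z\<bar>} \<in> fmeasurable lborel"
        by (intro fmeasurable.Un superlevel_fmeasurable g h B)
    qed
    also have "\<dots> \<le> superlevel g B (s / 2) + superlevel h B (s / 2)"
      unfolding superlevel_def
      by (rule measure_Un_le) (simp_all only: sets_lborel superlevel_sets g h B)
    finally show ?thesis .
  qed
  then have "superlevel f B s powr ?p \<le> superlevel g B (s / 2) powr ?p + superlevel h B (s / 2) powr ?p" for s
    by (rule order_trans[OF powr_mono2 powr_add_le, rotated 2]) (auto simp: superlevel_nonneg p)
  then have "lorentz f B \<le> (\<integral>\<^sup>+s. (?F g (s / 2) + ?F h (s / 2)) \<partial>lborel)"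
    unfolding lorentz_def
    by (intro nn_integral_mono) (auto simp: indicator_def ennreal_leI simp flip: ennreal_plus)
  also have "\<dots> = 2 * (\<integral>\<^sup>+s. (?F g s + ?F h s) \<partial>lborel)"
  proof -
    have "(\<lambda>s. ?F g (s / 2) + ?F h (s / 2)) \<in> borel_measurable borel"
      by (intro borel_measurable_add measurable_compose[OF _ m(1)] measurable_compose[OF _ m(2)]) measurable
    from nn_integral_real_affine[OF this, of 2 0] show ?thesis by simp
  qed
  also have "(\<integral>\<^sup>+s. (?F g s + ?F h s) \<partial>lborel) = lorentz g B + lorentz h B"
    unfolding lorentz_def using m by (intro nn_integral_add) auto
  finally show ?thesis .
qed

text \<open>Serves both as an estimate for bounded functions and as the dominating function for
  convergence.\<close>

lemma lorentz_integrand_le: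
  fixes g :: "'n::finite vec \<Rightarrow> real"
  assumes g: "g \<in> borel_measurable borel" and B: "finite_borel B" and c: "\<And>z. z \<in> B \<Longrightarrow> \<bar>g z\<bar> \<le> c" and "0 \<le> p"
  shows "indicator {0<..} s * ennreal (superlevel g B s powr p) \<le> ennreal (measure lborel B powr p) * indicator {0<..c} s"
proof (cases "s \<le> c")
  case True
  have "superlevel g B s \<le> measure lborel B"
    unfolding superlevel_def using B g superlevel_sets[OF g]
    by (intro measure_mono_fmeasurable) (auto simp: fmeasurable_def)
  then have "superlevel g B s powr p \<le> measure lborel B powr p"
    using \<open>0 \<le> p\<close> by (intro powr_mono2) (auto simp: superlevel_nonneg)
  then show ?thesis using True by (auto simp: indicator_def ennreal_leI)
next
  case False
  then have "{z\<in>B. s \<le> \<bar>g z\<bar>} = {}" using c by force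
  then have "superlevel g B s = 0" by (simp only: superlevel_def measure_empty)
  then show ?thesis by simp
qed

lemma lorentz_bounded:
  fixes g :: "'n::finite vec \<Rightarrow> real"
  assumes g: "g \<in> borel_measurable borel" and B: "finite_borel B" and c: "0 \<le> c" "\<And>z. z \<in> B \<Longrightarrow> \<bar>g z\<bar> \<le> c"
  shows "lorentz g B \<le> ennreal (c * measure lborel B powr (1 / real CARD('n)))"
proof -
  let ?p = "1 / real CARD('n)"
  have "lorentz g B \<le> (\<integral>\<^sup>+s. ennreal (measure lborel B powr ?p) * indicator {0<..c} s \<partial>lborel)"
    unfolding lorentz_def using c by (intro nn_integral_mono lorentz_integrand_le g B) auto
  also have "\<dots> = ennreal (c * measure lborel B powr ?p)"
    using c by (subst nn_integral_cmult_indicator) (simp_all add: ennreal_mult mult.commute)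
  finally show ?thesis .
qed

text \<open>The integrand is nonincreasing in s, so on (0, l] it is at least its value at l.\<close>

lemma lorentz_chebyshev:
  fixes g :: "'n::finite vec \<Rightarrow> real"
  assumes g: "g \<in> borel_measurable borel" and B: "finite_borel B" and l: "0 < l"
  shows "ennreal (l * superlevel g B l powr (1 / real CARD('n))) \<le> lorentz g B"
proof -
  let ?p = "1 / real CARD('n)"
  have "ennreal (l * superlevel g B l powr ?p) = (\<integral>\<^sup>+s. ennreal (superlevel g B l powr ?p) * indicator {0<..l} s \<partial>lborel)"
    using l by (subst nn_integral_cmult_indicator) (simp_all add: ennreal_mult mult.commute)
  also have "\<dots> \<le> lorentz g B"
    unfolding lorentz_def
  proof (rule nn_integral_mono)
    fix s :: real
    have "superlevel g B l powr ?p \<le> superlevel g B s powr ?p" if "s \<le> l"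
      using that B by (intro powr_mono2 superlevel_mono g) (auto simp: superlevel_nonneg)
    then show "ennreal (superlevel g B l powr ?p) * indicator {0<..l} s \<le> indicator {0<..} s * ennreal (superlevel g B s powr ?p)"
      by (auto simp: indicator_def ennreal_leI)
  qed
  finally show ?thesis .
qed

section \<open>Riesz potentials against the Lorentz functional\<close>

lemma ball_root_measure:
  fixes x :: "'n::finite vec"
  assumes "0 \<le> r"
  shows "measure lborel (ball x r) powr (1 / real CARD('n)) = unit_ball_vol (real CARD('n)) powr (1 / real CARD('n)) * r"
proof -
  have "measure lborel (ball x r) = unit_ball_vol (real CARD('n)) * r ^ CARD('n)"
    using content_ball[OF assms, of x] by (simp add: measure_def)
  moreover have "(r ^ CARD('n)) powr (1 / real CARD('n)) = r"
    using assms by (cases "r = 0") (auto simp: powr_realpow[symmetric] powr_powr)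
  ultimately show ?thesis using assms by (simp add: powr_mult)
qed

text \<open>Split at the radius \<rho> with \<rho>^N equal to the measure of A. Outside, the kernel
  is at most \<rho>^(1 - N), contributing at most \<rho>. Inside, the dyadic shell between r and 2r
  contributes at most r^(1 - N) times the volume of the ball of radius 2r, that is 2^N w r with w
  the volume of the unit ball, and the radii r = \<rho> / 2^(k + 1) sum to \<rho>.\<close>

lemma kernel_bound:
  fixes y :: "'n::finite vec"
  assumes A: "finite_borel A"
  shows "(\<integral>\<^sup>+z. ennreal (riesz y z) * indicator A z \<partial>lborel)
    \<le> ennreal ((1 + 2 ^ CARD('n) * unit_ball_vol (real CARD('n))) * measure lborel A powr (1 / real CARD('n)))"
proof -
  let ?N = "CARD('n)"
  let ?w = "unit_ball_vol (real CARD('n))"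
  define \<rho> where "\<rho> = measure lborel A powr (1 / real ?N)"
  have w: "?w > 0" by simp
  have emA: "emeasure lborel A = ennreal (measure lborel A)"
    using A by (intro emeasure_eq_ennreal_measure) auto
  show ?thesis
  proof (cases "measure lborel A = 0")
    case True
    then have "A \<in> null_sets lborel" using A emA by (auto simp: null_sets_def)
    then have "AE z in lborel. z \<notin> A" by (rule AE_not_in)
    then have "AE z in lborel. ennreal (riesz y z) * indicator A z = 0"
      by eventually_elim simp
    then have "(\<integral>\<^sup>+z. ennreal (riesz y z) * indicator A z \<partial>lborel) = (\<integral>\<^sup>+z. 0 \<partial>(lborel :: 'n vec measure))"
      by (rule nn_integral_cong_AE)
    then show ?thesis by simp
  next
    case False
    then have mA: "measure lborel A > 0" by (simp add: less_le)
    then have \<rho>: "\<rho> > 0" by (simp add: \<rho>_def)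
    have \<rho>N: "\<rho> ^ ?N = measure lborel A"
      using mA by (simp add: \<rho>_def powr_realpow[symmetric] powr_powr)
    define q where "q k = (\<rho> / 2 ^ Suc k) powr (1 - real ?N)" for k :: nat
    define far where "far z = ennreal (\<rho> powr (1 - real ?N)) * indicator A z" for z
    define near where "near z = (\<Sum>k. ennreal (q k) * indicator (ball y (\<rho> / 2 ^ k)) z)" for z
    have "ennreal (riesz y z) * indicator A z \<le> far z + near z" for z
    proof (cases "norm (z - y) \<ge> \<rho>")
      case True
      then have "riesz y z \<le> \<rho> powr (1 - real ?N)"
        using \<rho> by (intro powr_mono2') (auto simp: Suc_le_eq)
      then show ?thesis
        unfolding far_def by (intro add_increasing2 mult_right_mono ennreal_leI) auto
    next
      case False
      show ?thesis
      \<comment> \<open>At z = y the kernel is 0 because \<open>0 powr a = 0\<close> for every a, so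
        the concluding \<open>simp\<close> settles this point.\<close>
      proof (cases "z = y")
        case nz: False
        define d where "d = norm (z - y)"
        have d: "0 < d" "d < \<rho>" using False nz by (auto simp: d_def)
        have "\<exists>k. \<rho> / 2 ^ Suc k \<le> d"
        proof -
          obtain k where "\<rho> / d < 2 ^ k" using real_arch_pow[of 2 "\<rho> / d"] by auto
          then show ?thesis using d by (intro exI[of _ k]) (simp add: field_simps)
        qed
        \<comment> \<open>The least such index puts d into the shell [\<rho> / 2^(k + 1), \<rho> /
          2^k); for k = 0 the upper end is the case assumption d < \<rho>.\<close>
        define k where "k = (LEAST k. \<rho> / 2 ^ Suc k \<le> d)"
        have k1: "\<rho> / 2 ^ Suc k \<le> d" unfolding k_def using \<open>\<exists>k. \<rho> / 2 ^ Suc k \<le> d\<close> by (rule LeastI_ex)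
        have k2: "d < \<rho> / 2 ^ k"
        proof (cases k)
          case (Suc j)
          then have "j < (LEAST k. \<rho> / 2 ^ Suc k \<le> d)" unfolding k_def by linarith
          then have "\<not> \<rho> / 2 ^ Suc j \<le> d" by (rule not_less_Least)
          then show ?thesis using Suc by simp
        qed (use d in simp)
        have "riesz y z \<le> q k"
          unfolding q_def d_def[symmetric] using k1 \<rho> by (intro powr_mono2') (auto simp: Suc_le_eq)
        then have "ennreal (riesz y z) * indicator A z \<le> ennreal (q k) * indicator (ball y (\<rho> / 2 ^ k)) z"
          using k2 by (auto simp: indicator_def d_def dist_norm norm_minus_commute intro: ennreal_leI)
        also have "\<dots> \<le> near z"
        proof -
          define T where "T k = ennreal (q k) * indicator (ball y (\<rho> / 2 ^ k)) z" for k
          have "sum T {k} \<le> suminf T" by (rule sum_le_suminf) auto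
          then show ?thesis by (simp add: near_def T_def[symmetric])
        qed
        finally show ?thesis by (simp add: add_increasing)
      qed simp
    qed
    then have 1: "(\<integral>\<^sup>+z. ennreal (riesz y z) * indicator A z \<partial>lborel) \<le> (\<integral>\<^sup>+z. far z + near z \<partial>lborel)"
      by (rule nn_integral_mono)
    have Am: "A \<in> sets lborel" using A by simp
    have farm: "far \<in> borel_measurable lborel"
      unfolding far_def by (intro borel_measurable_times_ennreal borel_measurable_indicator Am) simp
    have ballm: "(\<lambda>z. ennreal (q k) * indicator (ball y (\<rho> / 2 ^ k)) z) \<in> borel_measurable lborel" for k
      by (intro borel_measurable_times_ennreal borel_measurable_indicator) auto
    have nearm: "near \<in> borel_measurable lborel"
      unfolding near_def by (intro borel_measurable_suminf_order ballm)
    have 2: "(\<integral>\<^sup>+z. far z + near z \<partial>lborel) = (\<integral>\<^sup>+z. far z \<partial>lborel) + (\<integral>\<^sup>+z. near z \<partial>lborel)"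
      by (intro nn_integral_add farm nearm)
    have scale: "r powr (1 - real ?N) * r ^ ?N = r" if "r > 0" for r :: real
    proof -
      have "r powr (1 - real ?N) * r powr real ?N = r powr 1" by (simp only: powr_add[symmetric]) simp
      then show ?thesis using that by (simp add: powr_realpow)
    qed
    have 3: "(\<integral>\<^sup>+z. far z \<partial>lborel) = ennreal \<rho>"
    proof -
      have "(\<integral>\<^sup>+z. far z \<partial>lborel) = ennreal (\<rho> powr (1 - real ?N)) * emeasure lborel A"
        unfolding far_def by (rule nn_integral_cmult_indicator[OF Am])
      also have "\<dots> = ennreal (\<rho> powr (1 - real ?N) * \<rho> ^ ?N)"
        by (simp add: emA \<rho>N ennreal_mult)
      finally show ?thesis using scale[OF \<rho>] by simp
    qed
    have ball: "(\<integral>\<^sup>+z. ennreal (q k) * indicator (ball y (\<rho> / 2 ^ k)) z \<partial>lborel) = ennreal (2 ^ ?N * ?w * \<rho> * (1 / 2) ^ Suc k)" for k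
    proof -
      define r where "r = \<rho> / 2 ^ Suc k"
      have r: "r > 0" "\<rho> / 2 ^ k = 2 * r" using \<rho> by (simp_all add: r_def)
      have "(\<integral>\<^sup>+z. ennreal (q k) * indicator (ball y (\<rho> / 2 ^ k)) z \<partial>lborel) = ennreal (q k) * emeasure lborel (ball y (2 * r))"
        unfolding r(2) by (rule nn_integral_cmult_indicator) simp
      also have "\<dots> = ennreal (q k * (?w * (2 * r) ^ ?N))"
        using r(1) by (simp add: emeasure_ball ennreal_mult q_def)
      also have "q k * (?w * (2 * r) ^ ?N) = 2 ^ ?N * ?w * (r powr (1 - real ?N) * r ^ ?N)"
        by (simp add: q_def r_def[symmetric] power_mult_distrib mult_ac del: power_Suc)
      also have "\<dots> = 2 ^ ?N * ?w * \<rho> * (1 / 2) ^ Suc k"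
        unfolding scale[OF r(1)] by (simp add: r_def power_divide)
      finally show ?thesis .
    qed
    have "(\<integral>\<^sup>+z. near z \<partial>lborel) = (\<Sum>k. \<integral>\<^sup>+z. ennreal (q k) * indicator (ball y (\<rho> / 2 ^ k)) z \<partial>lborel)"
      unfolding near_def by (intro nn_integral_suminf ballm)
    also have "\<dots> = ennreal (2 ^ ?N * ?w * \<rho>)"
      unfolding ball
    proof -
      have "(\<lambda>k. (2 ^ ?N * ?w * \<rho>) * (1 / 2) ^ Suc k) sums ((2 ^ ?N * ?w * \<rho>) * 1)"
        by (intro sums_mult power_half_series)
      then show "(\<Sum>k. ennreal (2 ^ ?N * ?w * \<rho> * (1 / 2) ^ Suc k)) = ennreal (2 ^ ?N * ?w * \<rho>)"
        using \<rho> w by (intro suminf_ennreal_eq) auto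
    qed
    finally have 4: "(\<integral>\<^sup>+z. near z \<partial>lborel) = ennreal (2 ^ ?N * ?w * \<rho>)" .
    have "ennreal \<rho> + ennreal (2 ^ ?N * ?w * \<rho>) = ennreal ((1 + 2 ^ ?N * ?w) * \<rho>)"
      using \<rho> w by (simp add: distrib_right flip: ennreal_plus)
    with 1 2 3 4 show ?thesis by (simp add: \<rho>_def)
  qed
qed

lemma finite_borel_ball: "finite_borel (ball x r)"
  using emeasure_lborel_cball_finite[of x r] emeasure_mono[of "ball x r" "cball x r" lborel]
  by (auto simp: order_le_less_trans)

text \<open>By Tonelli the potential is an integral over s of kernel integrals over superlevel sets,
  each bounded by the root of the measure of the set, uniformly in the centre. Joint measurability
  is where the Borel property of g enters.\<close>

lemma potential_le_lorentz:
  fixes g :: "'n::finite vec \<Rightarrow> real"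
  assumes g[measurable]: "g \<in> borel_measurable borel"
  shows "potential g y R \<le> ennreal (1 + 2 ^ CARD('n) * unit_ball_vol (real CARD('n))) * lorentz g (ball y R)"
proof -
  let ?K = "1 + 2 ^ CARD('n) * unit_ball_vol (real CARD('n))"
  have K: "?K \<ge> 0" by simp
  define k where "k z = ennreal (riesz y z)" for z
  have km[measurable]: "k \<in> borel_measurable borel" unfolding k_def by measurable
  define f where "f z s = (if 0 < s \<and> s \<le> \<bar>g z\<bar> \<and> z \<in> ball y R then k z else 0)" for z s
  have fm: "(\<lambda>(z, s). f z s) \<in> borel_measurable (lborel \<Otimes>\<^sub>M lborel)"
    unfolding f_def mem_ball by measurable
  have "potential g y R = (\<integral>\<^sup>+z. (\<integral>\<^sup>+s. f z s \<partial>lborel) \<partial>lborel)"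
    unfolding potential_def nn_integral_completion
  proof (rule nn_integral_cong)
    fix z
    have "(\<integral>\<^sup>+s. f z s \<partial>lborel) = (\<integral>\<^sup>+s. (k z * indicator (ball y R) z) * indicator {0<..\<bar>g z\<bar>} s \<partial>lborel)"
      by (intro nn_integral_cong) (auto simp: f_def indicator_def)
    also have "\<dots> = (k z * indicator (ball y R) z) * ennreal \<bar>g z\<bar>"
      by (subst nn_integral_cmult_indicator) auto
    also have "\<dots> = ennreal (\<bar>g z\<bar> * riesz y z) * indicator (ball y R) z"
      by (simp add: k_def ennreal_mult mult_ac)
    finally show "ennreal (\<bar>g z\<bar> * riesz y z) * indicator (ball y R) z = (\<integral>\<^sup>+s. f z s \<partial>lborel)" ..
  qed
  also have "\<dots> = (\<integral>\<^sup>+s. (\<integral>\<^sup>+z. f z s \<partial>lborel) \<partial>lborel)"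
    by (rule lborel_pair.Fubini'[OF fm, symmetric])
  also have "\<dots> \<le> (\<integral>\<^sup>+s. ennreal ?K * (indicator {0<..} s * ennreal (superlevel g (ball y R) s powr (1 / real CARD('n)))) \<partial>lborel)"
  proof (rule nn_integral_mono)
    fix s :: real
    show "(\<integral>\<^sup>+z. f z s \<partial>lborel) \<le> ennreal ?K * (indicator {0<..} s * ennreal (superlevel g (ball y R) s powr (1 / real CARD('n))))"
    proof (cases "s > 0")
      case True
      have fb: "finite_borel {z\<in>ball y R. s \<le> \<bar>g z\<bar>}"
        by (rule finite_borel_subset[OF finite_borel_ball[of y R]]) (auto intro: superlevel_sets g)
      have "(\<integral>\<^sup>+z. f z s \<partial>lborel) = (\<integral>\<^sup>+z. k z * indicator {z\<in>ball y R. s \<le> \<bar>g z\<bar>} z \<partial>lborel)"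
        using True by (intro nn_integral_cong) (auto simp: f_def indicator_def)
      also have "\<dots> \<le> ennreal (?K * superlevel g (ball y R) s powr (1 / real CARD('n)))"
        unfolding k_def superlevel_def by (rule kernel_bound[OF fb])
      finally show ?thesis using True K by (simp add: ennreal_mult)
    qed (simp add: f_def)
  qed
  also have "\<dots> = ennreal ?K * lorentz g (ball y R)"
    unfolding lorentz_def
  proof (rule nn_integral_cmult)
    from superlevel_powr_measurable[OF g finite_borel_ball]
    show "(\<lambda>s. indicator {0<..} s * ennreal (superlevel g (ball y R) s powr (1 / real CARD('n)))) \<in> borel_measurable lborel"
      by measurable
  qed
  finally show ?thesis .
qed

section \<open>A weak type estimate by covering\<close>

text \<open>A linear upper bound for the concave root with a free parameter \<tau>: for x = (p /
  P)^(1/n) either x \<le> \<tau>, or x \<le> x^n / \<tau>^(n - 1). Linearity in p is what can be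
  summed over disjoint sets.\<close>

lemma root_tangent_bound:
  fixes p P \<tau> :: real
  assumes "0 \<le> p" "p \<le> P" "0 < \<tau>" "0 < n"
  shows "p powr (1 / real n) \<le> \<tau> * P powr (1 / real n) + p * P powr (1 / real n - 1) / \<tau> ^ (n - 1)"
proof (cases "p = 0")
  case True
  then show ?thesis using assms by simp
next
  case False
  then have p: "0 < p" "0 < P" using assms by auto
  define x where "x = (p / P) powr (1 / real n)"
  have x: "0 < x" using p by (simp add: x_def)
  have xn: "x ^ n = p / P" using p assms by (simp add: x_def powr_powr flip: powr_realpow)
  have xp: "p powr (1 / real n) = x * P powr (1 / real n)"
    using p by (simp add: x_def powr_divide)
  show ?thesis
  proof (cases "x \<le> \<tau>")
    case True
    then have "x * P powr (1 / real n) \<le> \<tau> * P powr (1 / real n)" by (intro mult_right_mono) auto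
    then show ?thesis unfolding xp using assms by (simp add: add_increasing2)
  next
    case False
    then have "\<tau> ^ (n - 1) \<le> x ^ (n - 1)" using assms by (intro power_mono) auto
    then have "x * \<tau> ^ (n - 1) \<le> x * x ^ (n - 1)" using x by (intro mult_left_mono) auto
    also have "x * x ^ (n - 1) = p / P" using assms(4) xn by (simp add: power_eq_if)
    finally have "x * \<tau> ^ (n - 1) \<le> p / P" .
    then have "x \<le> p / P / \<tau> ^ (n - 1)" using assms p by (intro pos_le_divide_eq[THEN iffD2]) (simp_all add: field_simps)
    then have "x * P powr (1 / real n) \<le> p / P / \<tau> ^ (n - 1) * P powr (1 / real n)" by (intro mult_right_mono) auto
    also have "\<dots> = p * P powr (1 / real n - 1) / \<tau> ^ (n - 1)"
      using p by (simp add: powr_diff)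
    finally show ?thesis unfolding xp using assms by (simp add: add_increasing)
  qed
qed

lemma lorentz_weak_type:
  fixes e :: "'n::finite vec \<Rightarrow> real"
  assumes e: "e \<in> borel_measurable borel" and \<Omega>: "open \<Omega>" "emeasure lborel \<Omega> < \<infinity>"
    and A: "lorentz e \<Omega> \<le> ennreal A" "0 < A" and l: "0 < l" and S: "S \<subseteq> \<Omega>"
    and big: "\<And>x d. x \<in> S \<Longrightarrow> 0 < d \<Longrightarrow> \<exists>r. 0 < r \<and> r < d \<and> ennreal (l * r) < lorentz e (ball x r)"
  shows "\<exists>T. S \<subseteq> T \<and> T \<in> lmeasurable \<and> measure lebesgue T \<le> unit_ball_vol (real CARD('n)) * (2 * A / l) ^ CARD('n)"
proof -
  let ?N = "CARD('n)"
  let ?w = "unit_ball_vol (real ?N)"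
  have fb\<Omega>: "finite_borel \<Omega>" using \<Omega> by simp
  define K where "K = {i. fst i \<in> S \<and> 0 < snd i \<and> ball (fst i) (snd i) \<subseteq> \<Omega> \<and> ennreal (l * snd i) < lorentz e (ball (fst i) (snd i))}"
  obtain C where C: "countable C" "C \<subseteq> K"
    and dj: "pairwise (\<lambda>i j. disjnt (ball (fst i) (snd i)) (ball (fst j) (snd j))) C"
    and neg: "negligible (S - (\<Union>i\<in>C. ball (fst i) (snd i)))"
  proof (rule Vitali_covering_theorem_balls[of S K fst snd])
    fix x and d :: real assume x: "x \<in> S" and d: "0 < d"
    then obtain d' where d': "0 < d'" "ball x d' \<subseteq> \<Omega>" using \<Omega>(1) S by (meson open_contains_ball subsetD)
    obtain r where r: "0 < r" "r < min d d'" "ennreal (l * r) < lorentz e (ball x r)"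
      using big[OF x, of "min d d'"] d d' by auto
    have "ball x r \<subseteq> ball x d'" using r by (intro subset_ball) simp
    then have "(x, r) \<in> K" using x r d' by (auto simp: K_def)
    then show "\<exists>i. i \<in> K \<and> x \<in> ball (fst i) (snd i) \<and> snd i < d" using r by (intro exI[of _ "(x, r)"]) auto
  qed blast
  have CD: "0 < snd i" "ball (fst i) (snd i) \<subseteq> \<Omega>" "ennreal (l * snd i) < lorentz e (ball (fst i) (snd i))" if "i \<in> C" for i
    using subsetD[OF C(2) that] unfolding K_def by blast+
  define P where "P s = superlevel e \<Omega> s" for s
  define p where "p i s = superlevel e (ball (fst i) (snd i)) s" for i s
  have fbball: "finite_borel (ball (fst i) (snd i))" for i :: "'n vec \<times> real" by (rule finite_borel_ball)
  have Pm[measurable]: "P \<in> borel_measurable borel" unfolding P_def[abs_def] by (rule superlevel_measurable[OF e fb\<Omega>])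
  have pm[measurable]: "p i \<in> borel_measurable borel" for i unfolding p_def[abs_def] by (rule superlevel_measurable[OF e fbball])
  have p0: "0 \<le> p i s" and P0: "0 \<le> P s" for i s by (auto simp: p_def P_def superlevel_nonneg)
  have pP: "p i s \<le> P s" if "i \<in> C" for i s
    unfolding p_def P_def using CD(2)[OF that] by (intro superlevel_mono e fb\<Omega>) auto
  let ?H = "\<lambda>s. \<integral>\<^sup>+i. indicator {0<..} s * ennreal (p i s * P s powr (1 / real ?N - 1)) \<partial>count_space C"
  define q where "q i = (\<integral>\<^sup>+s. indicator {0<..} s * ennreal (p i s * P s powr (1 / real ?N - 1)) \<partial>lborel)" for i
  \<comment> \<open>Chosen so that w A / c, the bound obtained for the union of the balls, equals w
    (2 A / l)^N.\<close>
  define c where "c = A * (l / (2 * A)) ^ ?N"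
  have c: "0 < c" using A l by (simp add: c_def)
  have q_lower: "ennreal (c * snd i ^ ?N) \<le> q i" if "i \<in> C" for i
  proof (cases "q i")
    case (real x)
    \<comment> \<open>With this \<tau> the term \<tau> A is exactly half of l r, so the other half
      must be carried by \<open>q i\<close>.\<close>
    define \<tau> where "\<tau> = l * snd i / (2 * A)"
    have \<tau>: "0 < \<tau>" using CD(1)[OF that] A l by (simp add: \<tau>_def)
    have "lorentz e (ball (fst i) (snd i)) \<le> (\<integral>\<^sup>+s. ennreal \<tau> * (indicator {0<..} s * ennreal (P s powr (1 / real ?N)))
        + ennreal (1 / \<tau> ^ (?N - 1)) * (indicator {0<..} s * ennreal (p i s * P s powr (1 / real ?N - 1))) \<partial>lborel)"
      unfolding lorentz_def p_def[symmetric]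
    proof (rule nn_integral_mono)
      fix s
      have "p i s powr (1 / real ?N) \<le> \<tau> * P s powr (1 / real ?N) + 1 / \<tau> ^ (?N - 1) * (p i s * P s powr (1 / real ?N - 1))"
        using root_tangent_bound[OF p0 pP[OF that] \<tau>, of ?N s] by simp
      then have "ennreal (p i s powr (1 / real ?N)) \<le> ennreal \<tau> * ennreal (P s powr (1 / real ?N)) + ennreal (1 / \<tau> ^ (?N - 1)) * ennreal (p i s * P s powr (1 / real ?N - 1))"
        using \<tau> p0 P0 by (simp add: ennreal_leI flip: ennreal_plus ennreal_mult)
      then show "indicator {0<..} s * ennreal (p i s powr (1 / real ?N)) \<le> ennreal \<tau> * (indicator {0<..} s * ennreal (P s powr (1 / real ?N)))
        + ennreal (1 / \<tau> ^ (?N - 1)) * (indicator {0<..} s * ennreal (p i s * P s powr (1 / real ?N - 1)))"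
        by (simp add: indicator_def)
    qed
    also have "\<dots> = ennreal \<tau> * lorentz e \<Omega> + ennreal (1 / \<tau> ^ (?N - 1)) * q i"
      unfolding lorentz_def P_def[symmetric] q_def
      by (subst nn_integral_add) (simp_all add: nn_integral_cmult)
    also have "\<dots> \<le> ennreal \<tau> * ennreal A + ennreal (1 / \<tau> ^ (?N - 1)) * ennreal x"
      using A(1) real(2) by (intro add_mono mult_left_mono) auto
    also have "\<dots> = ennreal (\<tau> * A + x / \<tau> ^ (?N - 1))"
      using \<tau> A(2) real(1) by (simp flip: ennreal_plus ennreal_mult)
    finally have "ennreal (l * snd i) < ennreal (\<tau> * A + x / \<tau> ^ (?N - 1))"
      using CD(3)[OF that] by (rule less_le_trans[rotated])
    then have "l * snd i < \<tau> * A + x / \<tau> ^ (?N - 1)"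
      by (simp add: ennreal_less_iff CD(1)[OF that] l less_imp_le)
    moreover have "\<tau> * A = l * snd i / 2" using A by (simp add: \<tau>_def)
    ultimately have "A * \<tau> < x / \<tau> ^ (?N - 1)" by (simp add: mult.commute)
    then have "A * (\<tau> * \<tau> ^ (?N - 1)) < x" using \<tau> by (simp add: field_simps)
    moreover have "\<tau> * \<tau> ^ (?N - 1) = \<tau> ^ ?N" by (simp add: power_eq_if)
    moreover have "A * \<tau> ^ ?N = c * snd i ^ ?N"
      by (simp add: \<tau>_def c_def power_mult_distrib power_divide)
    ultimately show ?thesis using real by (simp add: ennreal_leI)
  qed simp
  \<comment> \<open>For fixed s the superlevel sets in the balls are disjoint subsets of the one in
    \<Omega>, so the \<open>p i s\<close> sum to at most \<open>P s\<close>. The remaining product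
    of \<open>P s\<close> with its power 1/N - 1 is the root of \<open>P s\<close>, also for
    \<open>P s = 0\<close> by the convention for \<open>powr\<close>.\<close>
  have q_sum: "(\<integral>\<^sup>+i. q i \<partial>count_space C) \<le> ennreal A"
  proof -
    have "(\<integral>\<^sup>+i. q i \<partial>count_space C) = (\<integral>\<^sup>+s. ?H s \<partial>lborel)"
      unfolding q_def by (rule nn_integral_count_space_nn_integral[OF C(1), symmetric]) measurable
    also have "\<dots> \<le> (\<integral>\<^sup>+s. indicator {0<..} s * ennreal (P s powr (1 / real ?N)) \<partial>lborel)"
    proof (rule nn_integral_mono)
      fix s
      let ?a = "indicator {0<..} s * ennreal (P s powr (1 / real ?N - 1))"
      have "?H s = (\<integral>\<^sup>+i. ?a * ennreal (p i s) \<partial>count_space C)"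
        by (intro nn_integral_cong) (simp add: ennreal_mult p0 mult_ac)
      also have "\<dots> = ?a * (\<integral>\<^sup>+i. ennreal (p i s) \<partial>count_space C)"
        by (rule nn_integral_cmult) simp
      also have "(\<integral>\<^sup>+i. ennreal (p i s) \<partial>count_space C) = (\<integral>\<^sup>+i. emeasure lborel {z\<in>ball (fst i) (snd i). s \<le> \<bar>e z\<bar>} \<partial>count_space C)"
        unfolding p_def superlevel_def using superlevel_fmeasurable[OF e fbball]
        by (intro nn_integral_cong emeasure_eq_measure2[symmetric])
      also have "\<dots> = emeasure lborel (\<Union>i\<in>C. {z\<in>ball (fst i) (snd i). s \<le> \<bar>e z\<bar>})"
      proof (rule emeasure_UN_countable[symmetric])
        show "disjoint_family_on (\<lambda>i. {z\<in>ball (fst i) (snd i). s \<le> \<bar>e z\<bar>}) C"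
          using dj unfolding disjoint_family_on_def pairwise_def disjnt_def by blast
      qed (use C(1) superlevel_sets[OF e] in auto)
      also have "\<dots> \<le> emeasure lborel {z\<in>\<Omega>. s \<le> \<bar>e z\<bar>}"
      proof (rule emeasure_mono)
        show "(\<Union>i\<in>C. {z\<in>ball (fst i) (snd i). s \<le> \<bar>e z\<bar>}) \<subseteq> {z\<in>\<Omega>. s \<le> \<bar>e z\<bar>}" using CD(2) by blast
        show "{z\<in>\<Omega>. s \<le> \<bar>e z\<bar>} \<in> sets lborel" using superlevel_sets[OF e, of \<Omega> s] fb\<Omega> by simp
      qed
      also have "\<dots> = ennreal (P s)"
        unfolding P_def superlevel_def by (rule emeasure_eq_measure2[OF superlevel_fmeasurable[OF e fb\<Omega>]])
      finally have "?H s \<le> ?a * ennreal (P s)"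
        by (simp add: mult_left_mono)
      also have "?a * ennreal (P s) = indicator {0<..} s * ennreal (P s powr (1 / real ?N))"
      proof (cases "P s = 0")
        case False
        then have "P s powr (1 / real ?N - 1) * P s = P s powr (1 / real ?N)"
          using P0[of s] by (simp add: powr_diff)
        then show ?thesis using P0[of s] by (simp add: mult.assoc flip: ennreal_mult)
      qed simp
      finally show "?H s \<le> indicator {0<..} s * ennreal (P s powr (1 / real ?N))" .
    qed
    also have "\<dots> = lorentz e \<Omega>" by (simp add: lorentz_def P_def)
    finally show ?thesis using A(1) by (rule order_trans)
  qed
  let ?U = "\<Union>i\<in>C. ball (fst i) (snd i)"
  have "emeasure lborel ?U = (\<integral>\<^sup>+i. emeasure lborel (ball (fst i) (snd i)) \<partial>count_space C)"
  proof (rule emeasure_UN_countable)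
    show "disjoint_family_on (\<lambda>i. ball (fst i) (snd i)) C"
      using dj unfolding disjoint_family_on_def pairwise_def disjnt_def by blast
  qed (use C(1) in auto)
  also have "\<dots> \<le> (\<integral>\<^sup>+i. ennreal (?w / c) * q i \<partial>count_space C)"
  proof (rule nn_integral_mono)
    fix i assume "i \<in> space (count_space C)"
    then have i: "i \<in> C" by simp
    have "emeasure lborel (ball (fst i) (snd i)) = ennreal (?w * snd i ^ ?N)"
      using CD(1)[OF i] by (simp add: emeasure_ball)
    also have "?w * snd i ^ ?N = ?w / c * (c * snd i ^ ?N)" using c by simp
    also have "ennreal \<dots> = ennreal (?w / c) * ennreal (c * snd i ^ ?N)"
      using c CD(1)[OF i] by (intro ennreal_mult) auto
    also have "\<dots> \<le> ennreal (?w / c) * q i" by (intro mult_left_mono q_lower i) simp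
    finally show "emeasure lborel (ball (fst i) (snd i)) \<le> ennreal (?w / c) * q i" .
  qed
  also have "\<dots> = ennreal (?w / c) * (\<integral>\<^sup>+i. q i \<partial>count_space C)" by (rule nn_integral_cmult) simp
  also have "\<dots> \<le> ennreal (?w / c) * ennreal A" by (intro mult_left_mono q_sum) simp
  also have "\<dots> = ennreal (?w / c * A)" using c A by (intro ennreal_mult[symmetric]) auto
  also have "?w / c * A = ?w * (2 * A / l) ^ ?N" using A l by (simp add: c_def power_divide)
  finally have Ub: "emeasure lborel ?U \<le> ennreal (?w * (2 * A / l) ^ ?N)" .
  have Uo: "open ?U" by auto
  have Um: "?U \<in> lmeasurable" using Ub Uo by (auto simp: fmeasurable_def intro: le_less_trans)
  have Umeas: "measure lebesgue ?U \<le> ?w * (2 * A / l) ^ ?N"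
    using Ub Uo A l by (subst measure_completion) (auto simp: measure_def intro!: enn2real_leI)
  \<comment> \<open>Vitali's theorem covers \<open>S\<close> only up to a negligible set, which is
    added to the union of the balls.\<close>
  let ?T = "(S - ?U) \<union> ?U"
  have "measure lebesgue ?T \<le> measure lebesgue (S - ?U) + measure lebesgue ?U"
    by (rule measure_Un_le) (rule fmeasurableD[OF negligible_imp_measurable[OF neg]], rule fmeasurableD[OF Um])
  also have "measure lebesgue (S - ?U) = 0" using neg by (rule negligible_imp_measure0)
  finally have "measure lebesgue ?T \<le> ?w * (2 * A / l) ^ ?N" using Umeas by simp
  moreover have "?T \<in> lmeasurable" by (intro fmeasurable.Un negligible_imp_measurable[OF neg] Um)
  ultimately show ?thesis by (intro exI[of _ ?T]) auto
qed

section \<open>Density of continuous functions and Lebesgue points\<close>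

lemma superlevel_tendsto_0:
  fixes d :: "nat \<Rightarrow> 'n::finite vec \<Rightarrow> real"
  assumes d: "\<And>n. d n \<in> borel_measurable borel" and B: "finite_borel B"
    and lim: "AE z in lborel. (\<lambda>n. d n z) \<longlonglongrightarrow> 0" and "0 < s"
  shows "(\<lambda>n. superlevel (d n) B s) \<longlonglongrightarrow> 0"
proof -
  have "(\<lambda>n. \<integral>\<^sup>+z. indicator {z\<in>B. s \<le> \<bar>d n z\<bar>} z \<partial>lborel) \<longlonglongrightarrow> (\<integral>\<^sup>+z. 0 \<partial>(lborel :: 'n vec measure))"
  proof (rule nn_integral_dominated_convergence)
    show "indicator {z\<in>B. s \<le> \<bar>d n z\<bar>} \<in> borel_measurable lborel" for n
      using superlevel_sets[OF d] B by (intro borel_measurable_indicator) simp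
    show "indicator B \<in> borel_measurable lborel" using B by (intro borel_measurable_indicator) simp
    show "AE z in lborel. indicator {z\<in>B. s \<le> \<bar>d n z\<bar>} z \<le> (indicator B z :: ennreal)" for n
      by (auto simp: indicator_def)
    show "(\<integral>\<^sup>+z. indicator B z \<partial>lborel) < \<infinity>" using B by simp
    show "AE z in lborel. (\<lambda>n. indicator {z\<in>B. s \<le> \<bar>d n z\<bar>} z) \<longlonglongrightarrow> (0 :: ennreal)"
      using lim
    proof eventually_elim
      fix z assume "(\<lambda>n. d n z) \<longlonglongrightarrow> 0"
      then have "(\<lambda>n. \<bar>d n z\<bar>) \<longlonglongrightarrow> 0" by (simp add: tendsto_rabs_zero_iff)
      then have "\<forall>\<^sub>F n in sequentially. \<bar>d n z\<bar> < s" using \<open>0 < s\<close> by (rule order_tendstoD(2))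
      then have "\<forall>\<^sub>F n in sequentially. indicator {z\<in>B. s \<le> \<bar>d n z\<bar>} z = (0 :: ennreal)"
        by eventually_elim (simp add: indicator_def)
      then show "(\<lambda>n. indicator {z\<in>B. s \<le> \<bar>d n z\<bar>} z) \<longlonglongrightarrow> (0 :: ennreal)" by (rule tendsto_eventually)
    qed
  qed simp
  then have "(\<lambda>n. emeasure lborel {z\<in>B. s \<le> \<bar>d n z\<bar>}) \<longlonglongrightarrow> ennreal 0"
    using superlevel_sets[OF d] B by simp
  then have "(\<lambda>n. enn2real (emeasure lborel {z\<in>B. s \<le> \<bar>d n z\<bar>})) \<longlonglongrightarrow> 0"
    by (rule tendsto_enn2real) simp
  then show ?thesis by (simp add: superlevel_def measure_def)
qed

text \<open>Dominated convergence twice: in z, on the set B of finite measure, for each level s;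
  then in s, where the uniform bound c confines the integrand to (0, c].\<close>

lemma lorentz_bounded_convergence:
  fixes d :: "nat \<Rightarrow> 'n::finite vec \<Rightarrow> real"
  assumes d: "\<And>n. d n \<in> borel_measurable borel" and B: "finite_borel B"
    and lim: "AE z in lborel. (\<lambda>n. d n z) \<longlonglongrightarrow> 0" and c: "\<And>n z. \<bar>d n z\<bar> \<le> c"
  shows "(\<lambda>n. lorentz (d n) B) \<longlonglongrightarrow> 0"
proof -
  let ?p = "1 / real CARD('n)"
  have "(\<lambda>n. lorentz (d n) B) \<longlonglongrightarrow> (\<integral>\<^sup>+s. 0 \<partial>(lborel :: real measure))"
    unfolding lorentz_def
  proof (rule nn_integral_dominated_convergence)
    show "(\<lambda>s. indicator {0<..} s * ennreal (superlevel (d n) B s powr ?p)) \<in> borel_measurable lborel" for n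
      using superlevel_powr_measurable[OF d B] by measurable
    show "(\<lambda>s. ennreal (measure lborel B powr ?p) * indicator {0<..c} s) \<in> borel_measurable lborel" by measurable
    show "AE s in lborel. indicator {0<..} s * ennreal (superlevel (d n) B s powr ?p) \<le> ennreal (measure lborel B powr ?p) * indicator {0<..c} s" for n
      using c by (intro AE_I2 lorentz_integrand_le d B) auto
    show "(\<integral>\<^sup>+s. ennreal (measure lborel B powr ?p) * indicator {0<..c} s \<partial>lborel) < \<infinity>"
      using c[of 0 0] by (subst nn_integral_cmult_indicator) (auto simp: ennreal_mult_less_top)
    show "AE s in lborel. (\<lambda>n. indicator {0<..} s * ennreal (superlevel (d n) B s powr ?p)) \<longlonglongrightarrow> 0"
    proof (rule AE_I2)
      fix s :: real
      show "(\<lambda>n. indicator {0<..} s * ennreal (superlevel (d n) B s powr ?p)) \<longlonglongrightarrow> 0"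
      proof (cases "0 < s")
        case True
        have "(\<lambda>n. superlevel (d n) B s powr ?p) \<longlonglongrightarrow> 0"
          by (rule tendsto_zero_powrI[OF superlevel_tendsto_0[OF d B lim True] tendsto_const]) (auto simp: superlevel_nonneg)
        then have "(\<lambda>n. ennreal (superlevel (d n) B s powr ?p)) \<longlonglongrightarrow> ennreal 0" by (rule tendsto_ennrealI)
        then show ?thesis using True by simp
      qed simp
    qed
  qed simp
  then show ?thesis by simp
qed

definition clamp_abs :: "real \<Rightarrow> real \<Rightarrow> real" where
  "clamp_abs M x = max (- M) (min M x)"

text \<open>The part of g beyond M has its superlevel set at s inside that of g at M + s, so its
  functional is at most the tail beyond M of a convergent integral.\<close>

lemma lorentz_truncation:
  fixes g :: "'n::finite vec \<Rightarrow> real"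
  assumes g[measurable]: "g \<in> borel_measurable borel" and B: "finite_borel B" and fin: "lorentz g B < \<infinity>"
  shows "(\<lambda>M. lorentz (\<lambda>z. g z - clamp_abs (real M) (g z)) B) \<longlonglongrightarrow> 0"
proof -
  let ?p = "1 / real CARD('n)"
  let ?F = "\<lambda>s. ennreal (superlevel g B s powr ?p)"
  have F[measurable]: "?F \<in> borel_measurable borel" by (rule superlevel_powr_measurable[OF g B])
  have gm[measurable]: "(\<lambda>z. g z - clamp_abs (real M) (g z)) \<in> borel_measurable borel" for M
    unfolding clamp_abs_def by measurable
  have le: "lorentz (\<lambda>z. g z - clamp_abs (real M) (g z)) B \<le> (\<integral>\<^sup>+s. indicator {real M<..} s * ?F s \<partial>lborel)" for M
  proof -
    have "lorentz (\<lambda>z. g z - clamp_abs (real M) (g z)) B \<le> (\<integral>\<^sup>+s. indicator {real M<..} (real M + 1 * s) * ?F (real M + 1 * s) \<partial>lborel)"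
      unfolding lorentz_def
    proof (rule nn_integral_mono)
      fix s :: real
      have "superlevel (\<lambda>z. g z - clamp_abs (real M) (g z)) B s powr ?p \<le> superlevel g B (real M + s) powr ?p" if "0 < s"
        using that B by (intro powr_mono2 superlevel_mono gm g) (auto simp: superlevel_nonneg clamp_abs_def)
      then show "indicator {0<..} s * ennreal (superlevel (\<lambda>z. g z - clamp_abs (real M) (g z)) B s powr ?p) \<le> indicator {real M<..} (real M + 1 * s) * ?F (real M + 1 * s)"
        by (auto simp: indicator_def ennreal_leI)
    qed
    also have "\<dots> = (\<integral>\<^sup>+s. indicator {real M<..} s * ?F s \<partial>lborel)"
      using nn_integral_real_affine[of "\<lambda>s. indicator {real M<..} s * ?F s" 1 "real M"] by simp
    finally show ?thesis .
  qed
  have lim: "(\<lambda>M. \<integral>\<^sup>+s. indicator {real M<..} s * ?F s \<partial>lborel) \<longlonglongrightarrow> (\<integral>\<^sup>+s. 0 \<partial>(lborel :: real measure))"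
  proof (rule nn_integral_dominated_convergence)
    show "(\<lambda>s. indicator {real M<..} s * ?F s) \<in> borel_measurable lborel" for M by measurable
    show "(\<lambda>s. indicator {0<..} s * ?F s) \<in> borel_measurable lborel" by measurable
    show "AE s in lborel. indicator {real M<..} s * ?F s \<le> indicator {0<..} s * ?F s" for M
      by (auto simp: indicator_def)
    show "(\<integral>\<^sup>+s. indicator {0<..} s * ?F s \<partial>lborel) < \<infinity>" using fin by (simp add: lorentz_def)
    show "AE s in lborel. (\<lambda>M. indicator {real M<..} s * ?F s) \<longlonglongrightarrow> 0"
    proof (rule AE_I2)
      fix s :: real
      obtain M0 where "s \<le> real M0" using real_arch_simple by blast
      then have "\<forall>\<^sub>F M in sequentially. indicator {real M<..} s * ?F s = 0"
        by (intro eventually_sequentiallyI[of M0]) (auto simp: indicator_def)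
      then show "(\<lambda>M. indicator {real M<..} s * ?F s) \<longlonglongrightarrow> 0" by (rule tendsto_eventually)
    qed
  qed simp
  show ?thesis
    by (rule tendsto_sandwich[OF _ _ tendsto_const lim[simplified]]) (auto simp: le)
qed

text \<open>A measurable function is an almost everywhere limit of continuous ones, but convergence
  in the functional uses a uniform bound. Hence g is truncated first and the approximants are
  clamped to the same level. The quarters of \<eta> pay for the factor 2 of
  \<open>lorentz_add\<close>.\<close>

lemma lorentz_continuous_dense:
  fixes g :: "'n::finite vec \<Rightarrow> real"
  assumes g: "g \<in> borel_measurable borel" and B: "finite_borel B" and fin: "lorentz g B < \<infinity>" and "0 < \<eta>"
  shows "\<exists>v. continuous_on UNIV v \<and> lorentz (\<lambda>z. g z - v z) B \<le> ennreal \<eta>"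
proof -
  have \<eta>4: "(0::ennreal) < ennreal (\<eta> / 4)" using \<open>0 < \<eta>\<close> by simp
  obtain M where M: "lorentz (\<lambda>z. g z - clamp_abs (real M) (g z)) B < ennreal (\<eta> / 4)"
    using order_tendstoD(2)[OF lorentz_truncation[OF g B fin] \<eta>4] by (auto simp: eventually_sequentially)
  have "g \<in> borel_measurable lebesgue" using g by (simp add: measurable_completion)
  then have "g measurable_on UNIV" by (rule lebesgue_measurable_imp_measurable_on_real) simp
  then obtain N v where N: "negligible N" and v: "\<And>n. continuous_on UNIV (v n)" "\<And>x. x \<notin> N \<Longrightarrow> (\<lambda>n. v n x) \<longlonglongrightarrow> g x"
    unfolding measurable_on_def by auto
  define d where "d n z = clamp_abs (real M) (g z) - clamp_abs (real M) (v n z)" for n z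
  have vc: "continuous_on UNIV (\<lambda>z. clamp_abs (real M) (v n z))" for n
    unfolding clamp_abs_def by (intro continuous_intros v)
  have vm: "(\<lambda>z. clamp_abs (real M) (v n z)) \<in> borel_measurable borel" for n
    using vc by (rule borel_measurable_continuous_onI)
  have cm: "(\<lambda>z. clamp_abs (real M) (g z)) \<in> borel_measurable borel"
    unfolding clamp_abs_def using g by measurable
  have dm: "d n \<in> borel_measurable borel" for n
    unfolding d_def using cm vm by (rule borel_measurable_diff)
  have "(\<lambda>n. lorentz (d n) B) \<longlonglongrightarrow> 0"
  proof (rule lorentz_bounded_convergence[OF dm B])
    show "\<bar>d n z\<bar> \<le> 2 * real M" for n z by (auto simp: d_def clamp_abs_def max_def min_def)
    have "AE z in lebesgue. z \<notin> N" using N by (intro AE_not_in) (simp add: negligible_iff_null_sets)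
    then have "AE z in lborel. z \<notin> N" by (simp add: AE_completion_iff)
    then show "AE z in lborel. (\<lambda>n. d n z) \<longlonglongrightarrow> 0"
    proof eventually_elim
      fix z assume "z \<notin> N"
      have "(\<lambda>n. d n z) \<longlonglongrightarrow> clamp_abs (real M) (g z) - clamp_abs (real M) (g z)"
        unfolding d_def clamp_abs_def by (intro tendsto_intros v \<open>z \<notin> N\<close>)
      then show "(\<lambda>n. d n z) \<longlonglongrightarrow> 0" by simp
    qed
  qed
  from order_tendstoD(2)[OF this \<eta>4] obtain n where n: "lorentz (d n) B < ennreal (\<eta> / 4)"
    by (auto simp: eventually_sequentially)
  have "lorentz (\<lambda>z. g z - clamp_abs (real M) (v n z)) B \<le>
      2 * (lorentz (\<lambda>z. g z - clamp_abs (real M) (g z)) B + lorentz (d n) B)"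
    using g cm dm vm by (intro lorentz_add B borel_measurable_diff) (auto simp: d_def)
  also have "\<dots> \<le> 2 * (ennreal (\<eta> / 4) + ennreal (\<eta> / 4))"
    using M n by (intro mult_left_mono add_mono less_imp_le) auto
  also have "\<dots> = ennreal 2 * ennreal (\<eta> / 2)" using \<open>0 < \<eta>\<close> by (simp flip: ennreal_plus)
  also have "\<dots> = ennreal \<eta>" using \<open>0 < \<eta>\<close> by (subst ennreal_mult[symmetric]) auto
  finally show ?thesis using vc by blast
qed

text \<open>A Lebesgue point condition at one level \<epsilon>. The scale r is natural because a
  constant c has functional of order c r on a ball of radius r.\<close>

definition lorentz_point :: "('n::finite vec \<Rightarrow> real) \<Rightarrow> real \<Rightarrow> 'n vec \<Rightarrow> bool" where
  "lorentz_point g \<epsilon> x \<longleftrightarrow> (\<exists>\<delta>>0. \<forall>r. 0 < r \<and> r < \<delta> \<longrightarrow> lorentz (\<lambda>z. g z - g x) (ball x r) \<le> ennreal (\<epsilon> * r))"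

lemma lorentz_lebesgue_points:
  fixes g :: "'n::finite vec \<Rightarrow> real"
  assumes g: "g \<in> borel_measurable borel" and \<Omega>: "open \<Omega>" "emeasure lborel \<Omega> < \<infinity>" and fin: "lorentz g \<Omega> < \<infinity>"
  shows "\<exists>Z. negligible Z \<and> (\<forall>x\<in>\<Omega> - Z. \<forall>\<epsilon>>0. lorentz_point g \<epsilon> x)"
proof -
  let ?N = "CARD('n)"
  let ?w = "unit_ball_vol (real ?N)"
  define W where "W = ?w powr (1 / real ?N)"
  have "0 < ?w" by simp
  then have "?w \<noteq> 0" by (rule less_imp_neq[THEN not_sym])
  then have W: "0 < W" unfolding W_def by (rule powr_gt_zero[THEN iffD2])
  have fb: "finite_borel \<Omega>" using \<Omega> by simp
  have const_bound: "lorentz f (ball x r) \<le> ennreal (c * W * r)"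
    if "f \<in> borel_measurable borel" "0 \<le> c" "\<And>z. z \<in> ball x r \<Longrightarrow> \<bar>f z\<bar> \<le> c" "0 < r" for f :: "'n vec \<Rightarrow> real" and c r x
    using lorentz_bounded[OF that(1) finite_borel_ball[of x r] that(2,3)] ball_root_measure[of r x] that(4)
    by (simp add: W_def mult.assoc)
  define bad where "bad \<epsilon> = {x\<in>\<Omega>. \<not> lorentz_point g \<epsilon> x}" for \<epsilon>
  have neg: "negligible (bad \<epsilon>)" if "\<epsilon> > 0" for \<epsilon>
    unfolding negligible_outer
  proof (intro allI impI)
    fix \<eta> :: real assume "0 < \<eta>"
    \<comment> \<open>The final estimate applies \<open>lorentz_add\<close> twice and costs 2 (l + 2
      (l + l)) = 10 l \<le> \<epsilon>; m is the height of a constant whose functional on a ball of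
      radius r is at most l r.\<close>
    define l where "l = \<epsilon> / 16"
    define m where "m = \<epsilon> / (16 * W)"
    have lm: "0 < l" "0 < m" "m * W = l" using that W by (auto simp: l_def m_def)
    have "((\<lambda>A. ?w * (2 * A / l) ^ ?N + (A / m) ^ ?N) \<longlongrightarrow> ?w * (2 * 0 / l) ^ ?N + (0 / m) ^ ?N) (at_right 0)"
      using lm by (intro tendsto_intros) auto
    then have "((\<lambda>A. ?w * (2 * A / l) ^ ?N + (A / m) ^ ?N) \<longlongrightarrow> 0) (at_right 0)" by (simp add: power_0_left)
    from order_tendstoD(2)[OF this \<open>0 < \<eta>\<close>] eventually_at_right_less[of "0::real"]
    have "\<forall>\<^sub>F A in at_right 0. 0 < A \<and> ?w * (2 * A / l) ^ ?N + (A / m) ^ ?N < \<eta>" by eventually_elim auto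
    then obtain A where A: "0 < A" "?w * (2 * A / l) ^ ?N + (A / m) ^ ?N < \<eta>"
      using eventually_happens'[OF trivial_limit_at_right_real] by blast
    obtain v where v: "continuous_on UNIV v" "lorentz (\<lambda>z. g z - v z) \<Omega> \<le> ennreal A"
      using lorentz_continuous_dense[OF g fb fin A(1)] by blast
    define e where "e z = g z - v z" for z
    have vm: "v \<in> borel_measurable borel" using v(1) by (rule borel_measurable_continuous_onI)
    have em: "e \<in> borel_measurable borel" unfolding e_def using g vm by (rule borel_measurable_diff)
    have eA: "lorentz e \<Omega> \<le> ennreal A" using v(2) by (simp add: e_def[abs_def])
    \<comment> \<open>Off both exceptional sets g - g x splits into v - v x, small by continuity,
      the error e, small because of \<open>S1\<close>, and the constant e x, small because of
      \<open>S2\<close>. Choosing A small makes both sets small, the first by the weak type estimate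
      and the second by \<open>lorentz_chebyshev\<close>.\<close>
    define S1 where "S1 = {x\<in>\<Omega>. \<forall>d>0. \<exists>r. 0 < r \<and> r < d \<and> ennreal (l * r) < lorentz e (ball x r)}"
    define S2 where "S2 = {x\<in>\<Omega>. m \<le> \<bar>e x\<bar>}"
    obtain T where T: "S1 \<subseteq> T" "T \<in> lmeasurable" "measure lebesgue T \<le> ?w * (2 * A / l) ^ ?N"
    proof -
      have "\<exists>T. S1 \<subseteq> T \<and> T \<in> lmeasurable \<and> measure lebesgue T \<le> ?w * (2 * A / l) ^ ?N"
      proof (rule lorentz_weak_type[OF em \<Omega> eA A(1) lm(1)])
        show "S1 \<subseteq> \<Omega>" by (auto simp: S1_def)
        show "\<exists>r. 0 < r \<and> r < d \<and> ennreal (l * r) < lorentz e (ball x r)" if "x \<in> S1" "0 < d" for x d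
          using that unfolding S1_def by blast
      qed
      then show thesis using that by blast
    qed
    have S2m: "S2 \<in> fmeasurable lborel" unfolding S2_def by (rule superlevel_fmeasurable[OF em fb])
    have S2: "S2 \<in> lmeasurable" using S2m by (auto simp: fmeasurable_def)
    have "measure lebesgue S2 \<le> (A / m) ^ ?N"
    proof -
      have "ennreal (m * superlevel e \<Omega> m powr (1 / real ?N)) \<le> ennreal A"
        using lorentz_chebyshev[OF em fb lm(2)] eA by (rule order_trans)
      then have "m * superlevel e \<Omega> m powr (1 / real ?N) \<le> A" using A(1) by (simp add: ennreal_le_iff)
      then have "superlevel e \<Omega> m powr (1 / real ?N) \<le> A / m" using lm by (simp add: field_simps)
      then have "(superlevel e \<Omega> m powr (1 / real ?N)) ^ ?N \<le> (A / m) ^ ?N" by (intro power_mono) auto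
      moreover have "(x powr (1 / real ?N)) ^ ?N = x" if "0 \<le> x" for x :: real
        using that by (cases "x = 0") (auto simp: powr_powr simp flip: powr_realpow)
      moreover have "measure lebesgue S2 = superlevel e \<Omega> m"
        unfolding S2_def superlevel_def using S2m by (intro measure_completion) (auto simp: S2_def fmeasurable_def)
      ultimately show ?thesis by (simp add: superlevel_nonneg)
    qed
    then have "measure lebesgue (T \<union> S2) < \<eta>"
      using measure_Un_le[of T lebesgue S2] T S2 A(2) by (auto simp: fmeasurableD)
    moreover have "bad \<epsilon> \<subseteq> T \<union> S2"
    proof (rule subsetI, rule ccontr)
      fix x assume x: "x \<in> bad \<epsilon>" and "x \<notin> T \<union> S2"
      then have "x \<in> \<Omega>" "x \<notin> S1" "x \<notin> S2" using T(1) by (auto simp: bad_def)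
      then obtain d1 where d1: "d1 > 0" "\<And>r. 0 < r \<Longrightarrow> r < d1 \<Longrightarrow> lorentz e (ball x r) \<le> ennreal (l * r)"
        unfolding S1_def mem_Collect_eq by (meson not_less)
      have ex: "\<bar>e x\<bar> \<le> m" using \<open>x \<in> \<Omega>\<close> \<open>x \<notin> S2\<close> by (auto simp: S2_def)
      have "isCont v x" using v(1) by (simp add: continuous_on_eq_continuous_at)
      then obtain d2 where d2: "d2 > 0" "\<And>z. dist z x < d2 \<Longrightarrow> dist (v z) (v x) < m"
        using lm(2) unfolding continuous_at_eps_delta by metis
      have "lorentz (\<lambda>z. g z - g x) (ball x r) \<le> ennreal (\<epsilon> * r)" if r: "0 < r" "r < min d1 d2" for r
      proof -
        have 1: "lorentz e (ball x r) \<le> ennreal (l * r)" using d1 r by auto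
        have 2: "lorentz (\<lambda>z. e x) (ball x r) \<le> ennreal (l * r)"
          using const_bound[of "\<lambda>z. e x" m x r] ex lm r by simp
        have 3: "lorentz (\<lambda>z. v z - v x) (ball x r) \<le> ennreal (l * r)"
          using const_bound[of "\<lambda>z. v z - v x" m x r] lm r vm d2(2)
          by (fastforce simp: dist_real_def dist_commute intro: less_imp_le)
        have twice: "ennreal 2 * (ennreal a + ennreal b) = ennreal (2 * (a + b))" if "0 \<le> a" "0 \<le> b" for a b
          unfolding ennreal_plus[OF that, symmetric] using that by (intro ennreal_mult[symmetric]) auto
        have lr: "0 \<le> l * r" "0 \<le> 4 * l * r" using lm r by auto
        have 4: "lorentz (\<lambda>z. e z - e x) (ball x r) \<le> ennreal (4 * l * r)"
        proof -
          have "lorentz (\<lambda>z. e z - e x) (ball x r) \<le> 2 * (lorentz e (ball x r) + lorentz (\<lambda>z. e x) (ball x r))"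
            using em by (intro lorentz_add finite_borel_ball) auto
          also have "\<dots> \<le> ennreal 2 * (ennreal (l * r) + ennreal (l * r))" using 1 2 by (auto intro!: mult_left_mono add_mono)
          also have "\<dots> = ennreal (4 * l * r)" unfolding twice[OF lr(1,1)] by (simp add: mult.assoc)
          finally show ?thesis .
        qed
        have "lorentz (\<lambda>z. g z - g x) (ball x r) \<le> 2 * (lorentz (\<lambda>z. v z - v x) (ball x r) + lorentz (\<lambda>z. e z - e x) (ball x r))"
          using em vm g by (intro lorentz_add finite_borel_ball) (auto simp: e_def)
        also have "\<dots> \<le> ennreal 2 * (ennreal (l * r) + ennreal (4 * l * r))" using 3 4 by (auto intro!: mult_left_mono add_mono)
        also have "\<dots> = ennreal (10 * l * r)" unfolding twice[OF lr] by (simp add: algebra_simps)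
        also have "\<dots> \<le> ennreal (\<epsilon> * r)" using lm r that by (intro ennreal_leI mult_right_mono) (auto simp: l_def)
        finally show ?thesis .
      qed
      then have "lorentz_point g \<epsilon> x"
        unfolding lorentz_point_def using d1(1) d2(1) by (intro exI[of _ "min d1 d2"]) auto
      then show False using x unfolding bad_def mem_Collect_eq by blast
    qed
    ultimately show "\<exists>T. bad \<epsilon> \<subseteq> T \<and> T \<in> lmeasurable \<and> measure lebesgue T < \<eta>"
      using T(2) S2 by (intro exI[of _ "T \<union> S2"]) auto
  qed
  \<comment> \<open>Countably many levels suffice, since the condition weakens as \<epsilon>
    grows.\<close>
  define Z where "Z = (\<Union>n. bad (1 / real (Suc n)))"
  have "negligible Z" unfolding Z_def by (rule negligible_countable_Union) (auto intro: neg)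
  moreover have "lorentz_point g \<epsilon> x"
    if x: "x \<in> \<Omega> - Z" and \<epsilon>: "\<epsilon> > 0" for x \<epsilon>
  proof -
    obtain n where n: "1 / real (Suc n) < \<epsilon>" using nat_approx_posE[OF \<epsilon>] by blast
    have "x \<notin> bad (1 / real (Suc n))" using x by (auto simp: Z_def)
    then obtain \<delta> where \<delta>: "\<delta> > 0" "\<And>r. 0 < r \<Longrightarrow> r < \<delta> \<Longrightarrow> lorentz (\<lambda>z. g z - g x) (ball x r) \<le> ennreal (1 / real (Suc n) * r)"
      using x unfolding bad_def lorentz_point_def by blast
    have "lorentz (\<lambda>z. g z - g x) (ball x r) \<le> ennreal (\<epsilon> * r)" if "0 < r" "r < \<delta>" for r
      using n that by (intro order_trans[OF \<delta>(2)[OF that]] ennreal_leI mult_right_mono) auto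
    then show ?thesis using \<delta>(1) unfolding lorentz_point_def by blast
  qed
  ultimately show ?thesis by blast
qed

section \<open>Differentiability almost everywhere\<close>

lemma weak_partial_pairing_integrable:
  fixes g :: "'n::finite vec \<Rightarrow> real"
  assumes "weak_partial_on \<Omega> u b g" and \<phi>: "test_fun_on \<Omega> \<phi>"
  shows "integrable lebesgue (\<lambda>x. g x * \<phi> x)"
proof -
  obtain D K where "C1_supported \<Omega> \<phi> D K" using test_fun_on_C1_supported[OF \<phi>] by blast
  note D = C1_supportedD[OF this]
  have gK: "integrable lebesgue (\<lambda>x. indicator K x *\<^sub>R g x)"
    using assms(1) D(5,6) unfolding weak_partial_on_def set_integrable_def by blast
  have "bounded (\<phi> ` K)"
    by (intro compact_imp_bounded compact_continuous_image continuous_on_subset[OF D(8)] D(5)) simp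
  then obtain M where M: "\<And>x. x \<in> K \<Longrightarrow> \<bar>\<phi> x\<bar> \<le> M" by (auto simp: bounded_iff)
  have \<phi>m: "\<phi> \<in> borel_measurable lebesgue"
    using D(8) by (intro measurable_completion) (auto intro: borel_measurable_continuous_onI)
  have eq: "(\<lambda>x. g x * \<phi> x) = (\<lambda>x. (indicator K x *\<^sub>R g x) * \<phi> x)"
  proof
    show "g x * \<phi> x = (indicator K x *\<^sub>R g x) * \<phi> x" for x
      using D(3)[of x] by (cases "x \<in> K") auto
  qed
  show ?thesis
  proof (rule Bochner_Integration.integrable_bound)
    show "integrable lebesgue (\<lambda>x. M * (indicator K x *\<^sub>R g x))" using gK by simp
    show "(\<lambda>x. g x * \<phi> x) \<in> borel_measurable lebesgue"
      unfolding eq using gK \<phi>m by (intro borel_measurable_times) auto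
    show "AE x in lebesgue. norm (g x * \<phi> x) \<le> norm (M * (indicator K x *\<^sub>R g x))"
    proof (rule AE_I2)
      fix x
      show "norm (g x * \<phi> x) \<le> norm (M * (indicator K x *\<^sub>R g x))"
      proof (cases "x \<in> K")
        case True
        have "\<bar>\<phi> x\<bar> \<le> \<bar>M\<bar>" using M[OF True] by linarith
        then have "\<bar>g x\<bar> * \<bar>\<phi> x\<bar> \<le> \<bar>g x\<bar> * \<bar>M\<bar>" by (rule mult_left_mono) simp
        then show ?thesis using True by (simp add: abs_mult mult.commute)
      qed (simp add: D(3))
    qed
  qed
qed

lemma weak_partial_diff:
  fixes u v :: "'n::finite vec \<Rightarrow> real"
  assumes u: "weak_partial_on \<Omega> u b g" "continuous_on UNIV u" and v: "weak_partial_on \<Omega> v b h" "continuous_on UNIV v"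
  shows "weak_partial_on \<Omega> (\<lambda>x. u x - v x) b (\<lambda>x. g x - h x)"
  unfolding weak_partial_on_def
proof (intro conjI allI impI)
  show "set_integrable lebesgue K (\<lambda>x. g x - h x)" if "compact K \<and> K \<subseteq> \<Omega>" for K
    using u(1) v(1) that unfolding weak_partial_on_def by (intro set_integral_diff(1)) auto
  fix \<phi> assume \<phi>: "test_fun_on \<Omega> \<phi>"
  have int: "integrable lebesgue (\<lambda>x. w x * frechet_derivative \<phi> (at x) b)" if "continuous_on UNIV w" for w
    using test_fun_measurable(4)[OF \<phi> that, of b] by (simp add: integrable_completion borel_measurable_integrable)
  have "(\<integral>x. (u x - v x) * frechet_derivative \<phi> (at x) b \<partial>lebesgue) =
    (\<integral>x. u x * frechet_derivative \<phi> (at x) b \<partial>lebesgue) - (\<integral>x. v x * frechet_derivative \<phi> (at x) b \<partial>lebesgue)"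
    unfolding left_diff_distrib by (intro Bochner_Integration.integral_diff int u v)
  also have "\<dots> = - (\<integral>x. g x * \<phi> x \<partial>lebesgue) - - (\<integral>x. h x * \<phi> x \<partial>lebesgue)"
    using u(1) v(1) \<phi> unfolding weak_partial_on_def by simp
  also have "\<dots> = - (\<integral>x. (g x - h x) * \<phi> x \<partial>lebesgue)"
    unfolding left_diff_distrib
    using weak_partial_pairing_integrable[OF u(1) \<phi>] weak_partial_pairing_integrable[OF v(1) \<phi>] by simp
  finally show "(\<integral>x. (u x - v x) * frechet_derivative \<phi> (at x) b \<partial>lebesgue) = - (\<integral>x. (g x - h x) * \<phi> x \<partial>lebesgue)" .
qed

text \<open>Measurability of g is given only on \<Omega>, so g is extended by 0 and then replaced by
  a Borel function equal to it almost everywhere. The pairings are unchanged because test functions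
  vanish off \<Omega>.\<close>

lemma borel_weak_partial:
  fixes g :: "'n::finite vec \<Rightarrow> real"
  assumes wp: "weak_partial_on \<Omega> u b g" and lor: "lorentz_N1 \<Omega> g" and \<Omega>: "open \<Omega>"
  shows "\<exists>g'. g' \<in> borel_measurable borel \<and> weak_partial_on \<Omega> u b g' \<and> lorentz g' \<Omega> < \<infinity>"
proof -
  have \<Omega>m: "\<Omega> \<in> sets borel" using \<Omega> by simp
  have gr: "g \<in> borel_measurable (restrict_space lebesgue \<Omega>)"
    and fin: "(\<integral>\<^sup>+ s. indicator {0<..} s * ennreal (measure lebesgue {x\<in>\<Omega>. s \<le> \<bar>g x\<bar>} powr (1 / real CARD('n))) \<partial>lborel) < \<infinity>"
    using lor unfolding lorentz_N1_def by auto
  define g0 where "g0 x = indicator \<Omega> x * g x" for x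
  have g0: "g0 \<in> borel_measurable lebesgue"
    using gr \<Omega>m borel_measurable_restrict_space_iff[of \<Omega> lebesgue g] by (simp add: g0_def[abs_def])
  obtain g' where g': "g' \<in> borel_measurable lborel" and "AE x in lborel. g0 x = g' x"
    using completion_ex_borel_measurable_real[OF g0] by blast
  then have ae: "AE x in lebesgue. g0 x = g' x" by (intro AE_completion) auto
  have g'b: "g' \<in> borel_measurable borel" using g' by simp
  have g'l: "g' \<in> borel_measurable lebesgue" using g' by (rule measurable_completion)
  have "weak_partial_on \<Omega> u b g'"
    unfolding weak_partial_on_def
  proof (intro conjI allI impI)
    fix K assume K: "compact K \<and> K \<subseteq> \<Omega>"
    have 1: "integrable lebesgue (\<lambda>x. indicator K x *\<^sub>R g x)"
      using wp K unfolding weak_partial_on_def set_integrable_def by blast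
    have 2: "AE x in lebesgue. indicator K x *\<^sub>R g x = indicator K x *\<^sub>R g' x"
      using ae by eventually_elim (use K in \<open>auto simp: g0_def indicator_def split: if_splits\<close>)
    have 3: "(\<lambda>x. indicator K x *\<^sub>R g' x) \<in> borel_measurable lebesgue"
      using g'l K by (intro borel_measurable_scaleR borel_measurable_indicator) (auto simp: borel_compact)
    show "set_integrable lebesgue K g'"
      unfolding set_integrable_def by (rule integrable_cong_AE_imp[OF 1 3 2])
  next
    fix \<phi> assume \<phi>: "test_fun_on \<Omega> \<phi>"
    obtain D K where "C1_supported \<Omega> \<phi> D K" using test_fun_on_C1_supported[OF \<phi>] by blast
    note D = C1_supportedD[OF this]
    have "\<phi> \<in> borel_measurable lebesgue"
      using D(8) by (intro measurable_completion) (auto intro: borel_measurable_continuous_onI)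
    then have "(\<integral>x. g x * \<phi> x \<partial>lebesgue) = (\<integral>x. g' x * \<phi> x \<partial>lebesgue)"
    proof (intro integral_cong_AE)
      show "(\<lambda>x. g x * \<phi> x) \<in> borel_measurable lebesgue"
        using weak_partial_pairing_integrable[OF wp \<phi>] by (rule borel_measurable_integrable)
      show "AE x in lebesgue. g x * \<phi> x = g' x * \<phi> x"
        using ae
      proof eventually_elim
        fix x assume "g0 x = g' x"
        then show "g x * \<phi> x = g' x * \<phi> x"
          using D(3)[of x] D(6) by (cases "x \<in> \<Omega>") (auto simp: g0_def)
      qed
    qed (use g'l in auto)
    then show "(\<integral>x. u x * frechet_derivative \<phi> (at x) b \<partial>lebesgue) = - (\<integral>x. g' x * \<phi> x \<partial>lebesgue)"
      using wp \<phi> unfolding weak_partial_on_def by simp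
  qed
  moreover have "lorentz g' \<Omega> < \<infinity>"
  proof -
    have "measure lebesgue {x\<in>\<Omega>. s \<le> \<bar>g x\<bar>} = superlevel g' \<Omega> s" for s
    proof -
      have "{x\<in>\<Omega>. s \<le> \<bar>g x\<bar>} = \<Omega> \<inter> {x\<in>space lebesgue. s \<le> \<bar>g0 x\<bar>}" by (auto simp: g0_def)
      also have "\<dots> \<in> sets lebesgue"
      proof (rule sets.Int)
        show "\<Omega> \<in> sets lebesgue" using \<Omega>m by simp
        note [measurable] = g0
        show "{x\<in>space lebesgue. s \<le> \<bar>g0 x\<bar>} \<in> sets lebesgue" by measurable
      qed
      finally have 1: "{x\<in>\<Omega>. s \<le> \<bar>g x\<bar>} \<in> sets lebesgue" .
      have 2: "{x\<in>\<Omega>. s \<le> \<bar>g' x\<bar>} \<in> sets borel" using g'b \<Omega>m by (rule superlevel_sets)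
      have "measure lebesgue {x\<in>\<Omega>. s \<le> \<bar>g x\<bar>} = measure lebesgue {x\<in>\<Omega>. s \<le> \<bar>g' x\<bar>}"
      proof (rule measure_eq_AE)
        show "AE x in lebesgue. (x \<in> {x\<in>\<Omega>. s \<le> \<bar>g x\<bar>}) = (x \<in> {x\<in>\<Omega>. s \<le> \<bar>g' x\<bar>})"
          using ae by eventually_elim (auto simp: g0_def)
      qed (use 1 2 in auto)
      also have "\<dots> = superlevel g' \<Omega> s"
        unfolding superlevel_def using 2 by (intro measure_completion) simp
      finally show ?thesis .
    qed
    with fin show ?thesis by (simp add: lorentz_def)
  qed
  ultimately show ?thesis using g'b by blast
qed

text \<open>The candidate gradient has the components g b x. Subtracting the affine function leaves
  w with weak partials g b - g b x, small in the Lorentz sense near x;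
  \<open>oscillation_bound\<close> at scale R = |y - x| then makes |w y - w x| a small multiple of
  R.\<close>

lemma differentiable_at_lorentz_point:
  fixes u :: "'n::finite vec \<Rightarrow> real"
  assumes u: "continuous_on UNIV u" and wp: "\<And>b. b \<in> Basis \<Longrightarrow> weak_partial_on \<Omega> u b (g b)"
    and gm: "\<And>b. b \<in> Basis \<Longrightarrow> g b \<in> borel_measurable borel" and \<Omega>: "open \<Omega>" "x \<in> \<Omega>"
    and pt: "\<And>b \<epsilon>. b \<in> Basis \<Longrightarrow> \<epsilon> > 0 \<Longrightarrow> lorentz_point (g b) \<epsilon> x"
  shows "u differentiable (at x)"
proof -
  define a where "a = (\<Sum>b\<in>Basis. g b x *\<^sub>R b)"
  have ab: "a \<bullet> b = g b x" if "b \<in> Basis" for b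
    using that by (simp add: a_def inner_sum_left inner_Basis if_distrib cong: if_cong)
  define w where "w z = u z - (a \<bullet> z + 0)" for z
  have wc: "continuous_on UNIV w" unfolding w_def by (intro continuous_intros u)
  have ww: "weak_partial_on \<Omega> w b (\<lambda>z. g b z - a \<bullet> b)" if "b \<in> Basis" for b
    unfolding w_def[abs_def] by (intro weak_partial_diff wp[OF that] u weak_partial_affine continuous_intros)
  have wm: "(\<lambda>z. g b z - a \<bullet> b) \<in> borel_measurable borel" if "b \<in> Basis" for b
    using gm[OF that] by (intro borel_measurable_diff) auto
  define K where "K = 1 + 2 ^ CARD('n) * unit_ball_vol (real CARD('n))"
  have "0 < unit_ball_vol (real CARD('n))" by simp
  then have K: "0 < K" unfolding K_def by (intro add_pos_pos mult_pos_pos) auto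
  define c where "c = bump_mass TYPE('n)"
  have c: "0 < c" unfolding c_def by (rule bump_mass_pos)
  have "(u has_derivative (\<lambda>h. a \<bullet> h)) (at x)"
    unfolding has_derivative_at_alt
  proof (intro conjI allI impI)
    show "bounded_linear (\<lambda>h. a \<bullet> h)" by (rule bounded_linear_inner_right)
    fix e :: real assume "0 < e"
    \<comment> \<open>Collects the losses: 146 / c from the oscillation bound, one potential for
      each of the N directions, K from \<open>potential_le_lorentz\<close>, and 2 because balls of
      radius R centred within R of x lie in the ball of radius 2R about x.\<close>
    define Q where "Q = 146 * (real CARD('n) * (K * 2)) / c"
    have Q: "0 < Q" using K c by (simp add: Q_def)
    define \<epsilon> where "\<epsilon> = e / Q"
    have \<epsilon>: "0 < \<epsilon>" using Q \<open>0 < e\<close> by (simp add: \<epsilon>_def)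
    have "\<forall>b\<in>Basis. \<exists>\<delta>>0. \<forall>r. 0 < r \<and> r < \<delta> \<longrightarrow> lorentz (\<lambda>z. g b z - g b x) (ball x r) \<le> ennreal (\<epsilon> * r)"
      using pt \<epsilon> unfolding lorentz_point_def by blast
    then obtain \<delta> where \<delta>: "\<And>b. b \<in> Basis \<Longrightarrow> \<delta> b > 0"
      "\<And>b r. b \<in> Basis \<Longrightarrow> 0 < r \<Longrightarrow> r < \<delta> b \<Longrightarrow> lorentz (\<lambda>z. g b z - g b x) (ball x r) \<le> ennreal (\<epsilon> * r)"
      by metis
    define \<delta>0 where "\<delta>0 = Min (\<delta> ` Basis)"
    have \<delta>0: "0 < \<delta>0" "\<And>b. b \<in> Basis \<Longrightarrow> \<delta>0 \<le> \<delta> b"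
      using \<delta>(1) by (auto simp: \<delta>0_def)
    obtain d where d: "0 < d" "cball x d \<subseteq> \<Omega>" using \<Omega> by (meson open_contains_cball)
    have "norm (u y - u x - a \<bullet> (y - x)) \<le> e * norm (y - x)" if y: "norm (y - x) < min d \<delta>0 / 2" for y
    proof (cases "y = x")
      case False
      define R where "R = norm (y - x)"
      have R: "0 < R" "2 * R < d" "2 * R < \<delta>0" using False y by (auto simp: R_def)
      have pot: "potential (\<lambda>z. g b z - a \<bullet> b) v R \<le> ennreal (K * (\<epsilon> * (2 * R)))" if v: "dist x v \<le> R" and b: "b \<in> Basis" for v b
      proof -
        have "potential (\<lambda>z. g b z - a \<bullet> b) v R \<le> ennreal K * lorentz (\<lambda>z. g b z - a \<bullet> b) (ball v R)"
          unfolding K_def by (rule potential_le_lorentz[OF wm[OF b]])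
        also have "\<dots> \<le> ennreal K * ennreal (\<epsilon> * (2 * R))"
        proof (rule mult_left_mono)
          have "ball v R \<subseteq> ball x (2 * R)"
          proof
            fix z assume "z \<in> ball v R"
            then show "z \<in> ball x (2 * R)" using v dist_triangle[of x z v] by simp
          qed
          then have "lorentz (\<lambda>z. g b z - a \<bullet> b) (ball v R) \<le> lorentz (\<lambda>z. g b z - a \<bullet> b) (ball x (2 * R))"
            by (intro lorentz_mono wm[OF b] finite_borel_ball) auto
          also have "\<dots> \<le> ennreal (\<epsilon> * (2 * R))"
            using \<delta>(2)[OF b, of "2 * R"] \<delta>0(2)[OF b] R by (simp add: ab[OF b])
          finally show "lorentz (\<lambda>z. g b z - a \<bullet> b) (ball v R) \<le> ennreal (\<epsilon> * (2 * R))" .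
        qed simp
        also have "\<dots> = ennreal (K * (\<epsilon> * (2 * R)))" using K \<epsilon> R by (intro ennreal_mult[symmetric]) auto
        finally show ?thesis .
      qed
      define s where "s = real CARD('n) * (K * (\<epsilon> * (2 * R)))"
      have s: "(\<Sum>b\<in>Basis. potential (\<lambda>z. g b z - a \<bullet> b) v R) \<le> ennreal s" if v: "dist x v \<le> R" for v
      proof -
        have "(\<Sum>b\<in>Basis. potential (\<lambda>z. g b z - a \<bullet> b) v R) \<le> (\<Sum>b\<in>(Basis :: 'n vec set). ennreal (K * (\<epsilon> * (2 * R))))"
          by (intro sum_mono pot v)
        also have "\<dots> = ennreal (\<Sum>b\<in>(Basis :: 'n vec set). K * (\<epsilon> * (2 * R)))"
          using K \<epsilon> R by (intro sum_ennreal) auto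
        also have "\<dots> = ennreal s" by (simp add: s_def)
        finally show ?thesis .
      qed
      have s0: "0 \<le> s" using K \<epsilon> R by (simp add: s_def)
      have sub: "cball x (2 * R) \<subseteq> \<Omega>" using d R subset_cball[of "2 * R" d x] by auto
      have "c * \<bar>w y - w x\<bar> \<le> 146 * s"
        unfolding c_def
      proof (rule oscillation_bound[OF wc ww R(1) sub _ s s0])
        show "dist x y \<le> R" by (simp add: R_def dist_norm norm_minus_commute)
        show "(\<lambda>z. g b z - a \<bullet> b) \<in> borel_measurable lebesgue" if "b \<in> Basis" for b
          using wm[OF that] by (intro measurable_completion) simp
      qed
      then have "\<bar>w y - w x\<bar> \<le> 146 * s / c" using c by (simp add: field_simps)
      also have "146 * s / c = Q * \<epsilon> * R" by (simp add: s_def Q_def)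
      also have "\<dots> = e * R" using Q by (simp add: \<epsilon>_def)
      also have "w y - w x = u y - u x - a \<bullet> (y - x)" by (simp add: w_def inner_diff_right)
      finally show ?thesis by (simp add: R_def)
    qed simp
    then show "\<exists>d>0. \<forall>y. norm (y - x) < d \<longrightarrow> norm (u y - u x - a \<bullet> (y - x)) \<le> e * norm (y - x)"
      using d(1) \<delta>0(1) by (intro exI[of _ "min d \<delta>0 / 2"]) auto
  qed
  then show ?thesis by (rule differentiableI)
qed

lemma differentiable_ae_lorentz:
  fixes u :: "'n::finite vec \<Rightarrow> real"
  assumes u: "continuous_on UNIV u" and \<Omega>: "open \<Omega>" "bounded \<Omega>"
    and reg: "\<And>b. b \<in> Basis \<Longrightarrow> \<exists>g. weak_partial_on \<Omega> u b g \<and> lorentz_N1 \<Omega> g"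
  shows "negligible {x\<in>\<Omega>. \<not> u differentiable (at x)}"
proof -
  have fin: "emeasure lborel \<Omega> < \<infinity>" using \<Omega>(2) by (rule emeasure_bounded_finite)
  have "\<forall>b\<in>Basis. \<exists>g. g \<in> borel_measurable borel \<and> weak_partial_on \<Omega> u b g \<and> lorentz g \<Omega> < \<infinity>"
    using reg borel_weak_partial[OF _ _ \<Omega>(1)] by blast
  then obtain g where g: "\<And>b. b \<in> Basis \<Longrightarrow> g b \<in> borel_measurable borel"
    "\<And>b. b \<in> Basis \<Longrightarrow> weak_partial_on \<Omega> u b (g b)" "\<And>b. b \<in> Basis \<Longrightarrow> lorentz (g b) \<Omega> < \<infinity>"
    by metis
  have "\<forall>b\<in>Basis. \<exists>Z. negligible Z \<and> (\<forall>x\<in>\<Omega> - Z. \<forall>\<epsilon>>0. lorentz_point (g b) \<epsilon> x)"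
    using lorentz_lebesgue_points[OF g(1) \<Omega>(1) fin g(3)] by blast
  then obtain Z where Z: "\<And>b. b \<in> Basis \<Longrightarrow> negligible (Z b)"
    "\<And>b x \<epsilon>. b \<in> Basis \<Longrightarrow> x \<in> \<Omega> - Z b \<Longrightarrow> \<epsilon> > 0 \<Longrightarrow> lorentz_point (g b) \<epsilon> x"
    by metis
  have "negligible (\<Union>b\<in>Basis. Z b)" using Z(1) by (intro negligible_Union) auto
  moreover have "u differentiable (at x)" if "x \<in> \<Omega>" "x \<notin> (\<Union>b\<in>Basis. Z b)" for x
    by (rule differentiable_at_lorentz_point[OF u g(2) g(1) \<Omega>(1) that(1)]) (use Z(2) that in blast)+
  ultimately show ?thesis by (elim negligible_subset) auto
qed

text \<open>Balls of integer radii supply the bounded domains, and a vector field is differentiable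
  where all its components are.\<close>

lemma negligible_Eset:
  fixes U :: "'n::finite vec \<Rightarrow> 'n vec"
  assumes U: "continuous_on UNIV U"
    and reg: "\<And>\<Omega> k l. open \<Omega> \<Longrightarrow> bounded \<Omega> \<Longrightarrow> k \<in> Basis \<Longrightarrow> l \<in> Basis \<Longrightarrow>
                 \<exists>g. weak_partial_on \<Omega> (\<lambda>y. U y \<bullet> k) l g \<and> lorentz_N1 \<Omega> g"
  shows "negligible (Eset U)"
proof -
  let ?Z = "\<lambda>n k. {x\<in>ball 0 (real n). \<not> (\<lambda>y. U y \<bullet> k) differentiable (at x)}"
  have "negligible (?Z n k)" if "k \<in> Basis" for n k
    using that by (intro differentiable_ae_lorentz reg continuous_intros U) auto
  then have "negligible (\<Union>n. \<Union>k\<in>Basis. ?Z n k)"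
    by (intro negligible_countable_Union negligible_Union) auto
  moreover have "Eset U \<subseteq> (\<Union>n. \<Union>k\<in>Basis. ?Z n k)"
  proof
    fix x assume "x \<in> Eset U"
    then obtain k where "k \<in> Basis" "\<not> (\<lambda>y. U y \<bullet> k) differentiable (at x)"
      unfolding Eset_def using differentiable_componentwise_within[of U x UNIV] by auto
    moreover obtain n where "norm x < real n" using reals_Archimedean2 by blast
    ultimately show "x \<in> (\<Union>n. \<Union>k\<in>Basis. ?Z n k)" by auto
  qed
  ultimately show ?thesis by (rule negligible_subset)
qed

section \<open>Null sets under differentiable maps\<close>

text \<open>The order is pulled back from an arbitrary injection into the naturals, as the index
  type of the theorem carries none.\<close>

typedef 'a ordered_copy = "UNIV :: 'a set" by simp

instance ordered_copy :: (finite) finite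
proof
  have "inj (Rep_ordered_copy :: 'a ordered_copy \<Rightarrow> 'a)"
    by (simp add: inj_on_def Rep_ordered_copy_inject)
  then show "finite (UNIV :: 'a ordered_copy set)"
    by (rule finite_imageD[rotated]) simp
qed

instantiation ordered_copy :: (finite) wellorder
begin

definition ordered_copy_index :: "'a ordered_copy \<Rightarrow> nat" where
  "ordered_copy_index = (SOME f. inj f)"

definition less_eq_ordered_copy :: "'a ordered_copy \<Rightarrow> 'a ordered_copy \<Rightarrow> bool" where
  "less_eq_ordered_copy x y \<longleftrightarrow> ordered_copy_index x \<le> ordered_copy_index y"

definition less_ordered_copy :: "'a ordered_copy \<Rightarrow> 'a ordered_copy \<Rightarrow> bool" where
  "less_ordered_copy x y \<longleftrightarrow> ordered_copy_index x < ordered_copy_index y"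

instance
proof
  have inj: "inj (ordered_copy_index :: 'a ordered_copy \<Rightarrow> nat)"
    unfolding ordered_copy_index_def
    using finite_imp_inj_to_nat_seg[of "UNIV :: 'a ordered_copy set"] by (intro someI_ex[of inj]) auto
  fix x y z :: "'a ordered_copy"
  show "x < y \<longleftrightarrow> x \<le> y \<and> \<not> y \<le> x" "x \<le> x" "x \<le> y \<or> y \<le> x"
    by (auto simp: less_eq_ordered_copy_def less_ordered_copy_def)
  show "x \<le> y \<Longrightarrow> y \<le> z \<Longrightarrow> x \<le> z" by (simp add: less_eq_ordered_copy_def)
  show "x \<le> y \<Longrightarrow> y \<le> x \<Longrightarrow> x = y"
    using inj by (auto simp: less_eq_ordered_copy_def inj_eq dest: antisym)
  fix P :: "'a ordered_copy \<Rightarrow> bool" and a :: "'a ordered_copy"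
  assume "\<And>x. (\<And>y. y < x \<Longrightarrow> P y) \<Longrightarrow> P x"
  then show "P a"
    unfolding less_ordered_copy_def by (rule measure_induct_rule[of ordered_copy_index])
qed

end

lemma CARD_ordered_copy: "CARD('a ordered_copy) = CARD('a)"
  using type_definition.card[OF type_definition_ordered_copy] by simp

text \<open>Singularity expressed by the kernel does not refer to coordinates, so it survives
  conjugation with a relabelling of them.\<close>

lemma det_matrix_eq_0_kernel:
  fixes f :: "real ^ 'n \<Rightarrow> real ^ 'n::finite"
  assumes "linear f"
  shows "det (matrix f) = 0 \<longleftrightarrow> (\<exists>v. v \<noteq> 0 \<and> f v = 0)"
proof -
  have "det (matrix f) = 0 \<longleftrightarrow> \<not> inj ((*v) (matrix f))"
    by (simp add: det_eq_0_rank full_rank_injective[symmetric] less_rank_noninjective)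
  also have "(*v) (matrix f) = f"
    using assms by (auto simp: fun_eq_iff matrix_works)
  also have "\<not> inj f \<longleftrightarrow> (\<exists>v. v \<noteq> 0 \<and> f v = 0)"
    using linear_injective_0[OF assms] by auto
  finally show ?thesis .
qed

text \<open>The library proves Sard's theorem for well-ordered index types only, hence the detour through
  a well-ordered copy of the index type.\<close>

lemma negligible_singular_image:
  fixes f :: "real ^ 'n \<Rightarrow> real ^ 'n::finite"
  assumes der: "\<And>x. x \<in> S \<Longrightarrow> (f has_derivative f' x) (at x)"
    and sing: "\<And>x. x \<in> S \<Longrightarrow> det (matrix (f' x)) = 0"
  shows "negligible (f ` S)"
proof -
  define p :: "real ^ 'n \<Rightarrow> real ^ 'n ordered_copy" where "p x = (\<chi> i. x $ Rep_ordered_copy i)" for x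
  define q :: "real ^ 'n ordered_copy \<Rightarrow> real ^ 'n" where "q x = (\<chi> i. x $ Abs_ordered_copy i)" for x
  have pq: "p (q y) = y" "q (p x) = x" for x y
    by (simp_all add: p_def q_def vec_eq_iff Abs_ordered_copy_inverse Rep_ordered_copy_inverse)
  have lp: "linear p" and lq: "linear q"
    by (auto intro!: linearI simp: p_def q_def vec_eq_iff)
  have blp: "bounded_linear p" and blq: "bounded_linear q"
    using lp lq by (simp_all add: linear_linear)
  have "negligible ((p \<circ> f \<circ> q) ` (p ` S))"
  proof (rule baby_Sard[where f' = "\<lambda>y. p \<circ> f' (q y) \<circ> q"])
    show "CARD('n ordered_copy) \<le> CARD('n ordered_copy)" by simp
    fix y assume "y \<in> p ` S"
    then have qy: "q y \<in> S" by (auto simp: pq)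
    have "((f \<circ> q) has_derivative f' (q y) \<circ> q) (at y)"
      by (rule diff_chain_at[OF bounded_linear_imp_has_derivative[OF blq] der[OF qy]])
    then have "((p \<circ> (f \<circ> q)) has_derivative p \<circ> (f' (q y) \<circ> q)) (at y)"
      by (rule diff_chain_at[OF _ bounded_linear_imp_has_derivative[OF blp]])
    then show "((p \<circ> f \<circ> q) has_derivative p \<circ> f' (q y) \<circ> q) (at y within p ` S)"
      by (simp add: o_assoc has_derivative_at_withinI)
    have lf: "linear (f' (q y))" using der[OF qy] by (rule has_derivative_linear)
    obtain v where v: "v \<noteq> 0" "f' (q y) v = 0"
      using sing[OF qy] det_matrix_eq_0_kernel[OF lf] by auto
    have l: "linear (p \<circ> f' (q y) \<circ> q)" by (intro linear_compose lp lq lf)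
    have "p v \<noteq> 0" using v(1) pq(2)[of v] linear_0[OF lq] by metis
    moreover have "(p \<circ> f' (q y) \<circ> q) (p v) = 0" using v(2) linear_0[OF lp] by (simp add: pq)
    ultimately have "det (matrix (p \<circ> f' (q y) \<circ> q)) = 0"
      using det_matrix_eq_0_kernel[OF l] by blast
    then show "rank (matrix (p \<circ> f' (q y) \<circ> q)) < CARD('n ordered_copy)"
      by (simp add: det_eq_0_rank)
  qed
  then have "negligible (q ` (p \<circ> f \<circ> q) ` (p ` S))"
    using lq by (intro negligible_differentiable_image_negligible[where f = q])
      (simp_all add: CARD_ordered_copy linear_imp_differentiable_on)
  also have "q ` (p \<circ> f \<circ> q) ` (p ` S) = f ` S"
    by (simp add: image_image pq)
  finally show ?thesis .
qed

text \<open>The preimage is exhausted by sets \<open>T n\<close> from whose points f shrinks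
  distances by at most the factor n + 1 at scales below 1 / (n + 1). On a part of \<open>T n\<close>
  of smaller extent f is injective with Lipschitz inverse, so that part is a Lipschitz image of a
  subset of A.\<close>

lemma negligible_preimage_nonsingular:
  fixes f :: "real ^ 'n \<Rightarrow> real ^ 'n::finite"
  assumes der: "\<And>x. x \<in> S \<Longrightarrow> (f has_derivative f' x) (at x)"
    and nonsing: "\<And>x. x \<in> S \<Longrightarrow> det (matrix (f' x)) \<noteq> 0" and A: "negligible A"
  shows "negligible {x\<in>S. f x \<in> A}"
proof -
  define T where "T n = {x\<in>S. f x \<in> A \<and> (\<forall>y. norm (y - x) < 1 / real (Suc n) \<longrightarrow> norm (y - x) \<le> real (Suc n) * norm (f y - f x))}" for n
  have "{x\<in>S. f x \<in> A} \<subseteq> (\<Union>n. T n)"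
  proof
    fix x assume x: "x \<in> {x\<in>S. f x \<in> A}"
    have l: "linear (f' x)" using der x has_derivative_linear by blast
    have "inj (f' x)"
      using det_matrix_eq_0_kernel[OF l] nonsing x linear_injective_0[OF l] by auto
    then obtain B where B: "B > 0" "\<And>h. B * norm h \<le> norm (f' x h)"
      using linear_inj_bounded_below_pos[OF l] by blast
    \<comment> \<open>Half of the lower bound B absorbs the remainder, leaving |y - x| \<le> (2 / B)
      |f y - f x|.\<close>
    have "B / 2 > 0" using B by simp
    then obtain d where d: "d > 0" "\<And>y. norm (y - x) < d \<Longrightarrow> norm (f y - f x - f' x (y - x)) \<le> B / 2 * norm (y - x)"
      using der[of x] x unfolding has_derivative_at_alt by blast
    obtain n where n: "max (1 / d) (2 / B) < real n" using reals_Archimedean2 by blast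
    have n1: "1 / real (Suc n) < d"
    proof -
      have "1 / d < real (Suc n)" using n by simp
      then show ?thesis using d(1) by (simp add: field_simps)
    qed
    have n2: "2 / B \<le> real (Suc n)" using n by simp
    have "norm (y - x) \<le> real (Suc n) * norm (f y - f x)" if "norm (y - x) < 1 / real (Suc n)" for y
    proof -
      have "norm (f' x (y - x)) \<le> norm (f y - f x) + norm (f y - f x - f' x (y - x))"
        by (metis norm_triangle_sub norm_minus_commute add.commute)
      then have "B / 2 * norm (y - x) \<le> norm (f y - f x)"
        using d(2)[of y] that n1 B(2)[of "y - x"] by simp
      then have "norm (y - x) \<le> 2 / B * norm (f y - f x)" using B(1) by (simp add: field_simps)
      also have "\<dots> \<le> real (Suc n) * norm (f y - f x)" using n2 by (intro mult_right_mono) auto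
      finally show ?thesis .
    qed
    then have "x \<in> T n" using x by (simp add: T_def del: of_nat_Suc)
    then show "x \<in> (\<Union>n. T n)" by blast
  qed
  moreover have "negligible (T n)" for n
  proof (rule locally_negligible_alt[THEN iffD2], rule ballI)
    fix x assume x: "x \<in> T n"
    \<comment> \<open>Half the scale of \<open>T n\<close>, so that any two points of
      \<open>V\<close> are within that scale of each other.\<close>
    define V where "V = T n \<inter> ball x (1 / (2 * real (Suc n)))"
    have inv: "norm (y - z) \<le> real (Suc n) * norm (f y - f z)" if "y \<in> V" "z \<in> V" for y z
    proof -
      have "dist y z < 1 / (2 * real (Suc n)) + 1 / (2 * real (Suc n))"
        using that by (intro dist_triangle_less_add[of y x _ z]) (auto simp: V_def dist_commute)
      then have "norm (y - z) < 1 / real (Suc n)" by (simp add: dist_norm del: of_nat_Suc)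
      then show ?thesis using that(2) by (auto simp: V_def T_def simp del: of_nat_Suc)
    qed
    have "inj_on f V" using inv by (intro inj_onI) force
    then have V: "inv_into V f ` f ` V = V" by (rule inv_into_image_cancel) simp
    have "f ` V \<subseteq> A" by (auto simp: V_def T_def)
    then have "negligible (f ` V)" using A negligible_subset by blast
    then have "negligible (inv_into V f ` f ` V)"
    proof (rule negligible_locally_Lipschitz_image[rotated])
      fix u assume u: "u \<in> f ` V"
      have "norm (inv_into V f w - inv_into V f u) \<le> real (Suc n) * norm (w - u)" if "w \<in> f ` V" for w
        using inv[OF inv_into_into[OF that] inv_into_into[OF u]] by (simp only: f_inv_into_f[OF that] f_inv_into_f[OF u])
      then show "\<exists>T B. open T \<and> u \<in> T \<and> (\<forall>w\<in>f ` V \<inter> T. norm (inv_into V f w - inv_into V f u) \<le> B * norm (w - u))"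
        by (intro exI[of _ UNIV]) blast
    qed simp
    then have "negligible V" by (simp only: V)
    then show "\<exists>U. openin (top_of_set (T n)) U \<and> x \<in> U \<and> negligible U"
      using x by (intro exI[of _ V]) (auto simp: V_def openin_open_Int)
  qed
  then have "negligible (\<Union>n. T n)" by (intro negligible_countable_Union) auto
  ultimately show ?thesis by (metis (no_types, lifting) negligible_subset)
qed

text \<open>Entries are limits of difference quotients with step 1 / (n + 1), and \<open>lim\<close>
  of a sequence of Borel functions is Borel even where it takes its default value. This avoids any
  measurability question about the choice made by \<open>frechet_derivative\<close>.\<close>

lemma det_derivative_measurable:
  fixes f :: "real ^ 'n \<Rightarrow> real ^ 'n::finite"
  assumes f: "continuous_on UNIV f"
  shows "\<exists>D \<in> borel_measurable borel. \<forall>x f'. (f has_derivative f') (at x) \<longrightarrow> D x = det (matrix f')"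
proof -
  define q where "q i j n x = (f (x + (1 / real (Suc n)) *\<^sub>R axis j 1) $ i - f x $ i) * real (Suc n)" for i j n x
  define D where "D x = det (\<chi> i j. lim (\<lambda>n. q i j n x))" for x
  have "q i j n \<in> borel_measurable borel" for i j n
    unfolding q_def
    by (intro borel_measurable_continuous_onI continuous_intros continuous_on_compose2[OF f]) auto
  then have "(\<lambda>x. lim (\<lambda>n. q i j n x)) \<in> borel_measurable borel" for i j
    by (rule borel_measurable_lim_metric)
  then have "D \<in> borel_measurable borel"
    unfolding D_def det_def by (intro borel_measurable_sum borel_measurable_times borel_measurable_prod) auto
  moreover have "D x = det (matrix f')" if f': "(f has_derivative f') (at x)" for x f'
  proof -
    have "(\<lambda>n. q i j n x) \<longlonglongrightarrow> f' (axis j 1) $ i" for i j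
    proof -
      have "((\<lambda>t. x + t *\<^sub>R axis j 1) has_derivative (\<lambda>t. t *\<^sub>R axis j 1)) (at (0::real))"
        by (auto intro!: derivative_eq_intros)
      then have "((\<lambda>t. f (x + t *\<^sub>R axis j 1)) has_derivative (\<lambda>t. f' (t *\<^sub>R axis j 1))) (at (0::real))"
        using has_derivative_compose[of "\<lambda>t. x + t *\<^sub>R axis j 1" _ 0 UNIV f f'] f' by simp
      then have "((\<lambda>t. f (x + t *\<^sub>R axis j 1) $ i) has_derivative (\<lambda>t. f' (t *\<^sub>R axis j 1) $ i)) (at (0::real))"
        by (rule bounded_linear.has_derivative[OF bounded_linear_vec_nth])
      moreover have "(\<lambda>t. f' (t *\<^sub>R axis j 1) $ i) = (*) (f' (axis j 1) $ i)"
        using has_derivative_linear[OF f'] by (auto simp: fun_eq_iff linear_cmul)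
      ultimately have "((\<lambda>t. f (x + t *\<^sub>R axis j 1) $ i) has_real_derivative f' (axis j 1) $ i) (at 0)"
        by (simp add: has_field_derivative_def)
      then have lim: "((\<lambda>h. (f (x + h *\<^sub>R axis j 1) $ i - f x $ i) / h) \<longlongrightarrow> f' (axis j 1) $ i) (at 0)"
        by (simp add: DERIV_def)
      have "filterlim (\<lambda>n. 1 / real (Suc n)) (at 0) sequentially"
        unfolding filterlim_at using LIMSEQ_inverse_real_of_nat by (auto simp: inverse_eq_divide)
      from filterlim_compose[OF lim this] show ?thesis
        by (simp add: q_def)
    qed
    then have "lim (\<lambda>n. q i j n x) = f' (axis j 1) $ i" for i j by (rule limI)
    then show ?thesis by (simp add: D_def matrix_def)
  qed
  ultimately show ?thesis by blast
qed

text \<open>Let N be the union of the two null carriers. Off N both singular parts vanish, on N both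
  absolutely continuous parts do, so the sum identity on either side yields equality. Nothing is
  subtracted, so infinite values cause no trouble.\<close>

lemma lebesgue_decomposition_unique:
  fixes \<rho>a \<rho>s P Z :: "'a::euclidean_space measure"
  assumes sets: "sets \<rho>a = sets borel" "sets \<rho>s = sets borel" "sets P = sets borel" "sets Z = sets borel"
    and eq: "\<And>A. A \<in> sets borel \<Longrightarrow> emeasure \<rho>a A + emeasure \<rho>s A = emeasure P A + emeasure Z A"
    and ac: "null_sets lborel \<subseteq> null_sets \<rho>a" "null_sets lborel \<subseteq> null_sets P"
    and S: "S \<in> null_sets lborel" "emeasure \<rho>s (UNIV - S) = 0" and S': "S' \<in> null_sets lborel" "emeasure Z (UNIV - S') = 0"
  shows "\<rho>a = P" "\<rho>s = Z"
proof -
  let ?N = "S \<union> S'"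
  have N: "?N \<in> null_sets lborel" using S(1) S'(1) by (rule null_sets.Un)
  have Nb: "?N \<in> sets borel" "S \<in> sets borel" "S' \<in> sets borel" using N S S' by (auto simp: null_sets_def)
  have 0: "emeasure \<rho>s (A - ?N) = 0" "emeasure Z (A - ?N) = 0" if "A \<in> sets borel" for A
  proof -
    have "emeasure \<rho>s (A - ?N) \<le> emeasure \<rho>s (UNIV - S)" "emeasure Z (A - ?N) \<le> emeasure Z (UNIV - S')"
      using Nb sets by (auto intro!: emeasure_mono)
    then show "emeasure \<rho>s (A - ?N) = 0" "emeasure Z (A - ?N) = 0" using S(2) S'(2) by auto
  qed
  have a0: "emeasure \<rho>a (A \<inter> ?N) = 0" "emeasure P (A \<inter> ?N) = 0" if "A \<in> sets borel" for A
    using ac N that sets by (auto intro!: null_setsD1 null_set_Int1)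
  have split: "emeasure M A = emeasure M (A \<inter> ?N) + emeasure M (A - ?N)" if "sets M = sets borel" "A \<in> sets borel" for A and M :: "'a measure"
    using that Nb plus_emeasure[of "A \<inter> ?N" M "A - ?N"] by (auto simp: Int_Diff_Un Int_Diff_disjoint)
  show "\<rho>a = P"
  proof (rule measure_eqI)
    fix A assume "A \<in> sets \<rho>a"
    then have A: "A \<in> sets borel" "A - ?N \<in> sets borel" using sets Nb by auto
    show "emeasure \<rho>a A = emeasure P A"
      using split[OF sets(1) A(1)] split[OF sets(3) A(1)] a0[OF A(1)] eq[OF A(2)] 0[OF A(1)] by simp
  qed (simp add: sets)
  show "\<rho>s = Z"
  proof (rule measure_eqI)
    fix A assume "A \<in> sets \<rho>s"
    then have A: "A \<in> sets borel" "A \<inter> ?N \<in> sets borel" using sets Nb by auto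
    show "emeasure \<rho>s A = emeasure Z A"
      using split[OF sets(2) A(1)] split[OF sets(4) A(1)] a0[OF A(1)] eq[OF A(2)] 0[OF A(1)] by simp
  qed (simp add: sets)
qed

text \<open>The linear map J(a, b) = (b, -a) turns the gradient into the Hamiltonian vector field,
  whose derivative is bounded because the Hessian is.\<close>

lemma hamiltonian_lipschitz_flow:
  fixes G :: "'a::euclidean_space \<times> 'a \<Rightarrow> 'a \<times> 'a"
  assumes hess: "\<And>z. (G has_derivative blinfun_apply (D2 z)) (at z)"
    and hess_cont: "continuous_on UNIV D2" and bound_hess: "\<And>z. norm (D2 z) \<le> \<kappa>"
    and flow0: "\<And>z. \<Phi> 0 z = z"
    and flow: "\<And>z t. ((\<lambda>s. \<Phi> s z) has_vector_derivative (snd (G (\<Phi> t z)), - fst (G (\<Phi> t z)))) (at t)"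
  shows "\<exists>V DV \<kappa>'. lipschitz_flow V DV \<kappa>' \<Phi>"
proof -
  define J :: "('a \<times> 'a) \<Rightarrow>\<^sub>L ('a \<times> 'a)" where "J = Blinfun (\<lambda>p. (snd p, - fst p))"
  have J: "blinfun_apply J = (\<lambda>p. (snd p, - fst p))"
    unfolding J_def by (intro bounded_linear_Blinfun_apply bounded_linear_Pair bounded_linear_minus bounded_linear_fst bounded_linear_snd)
  have "lipschitz_flow (\<lambda>z. J (G z)) (\<lambda>z. J o\<^sub>L D2 z) (norm J * \<kappa>) \<Phi>"
  proof
    show "((\<lambda>z. J (G z)) has_derivative blinfun_apply (J o\<^sub>L D2 z)) (at z)" for z
      using bounded_linear.has_derivative[OF blinfun.bounded_linear_right hess]
      by (rule has_derivative_eq_rhs) (simp add: fun_eq_iff)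
    show "continuous_on UNIV (\<lambda>z. J o\<^sub>L D2 z)"
      by (intro bounded_bilinear.continuous_on[OF bounded_bilinear_blinfun_compose] continuous_on_const hess_cont)
    show "norm (J o\<^sub>L D2 z) \<le> norm J * \<kappa>" for z
      by (rule order_trans[OF norm_blinfun_compose mult_left_mono[OF bound_hess norm_ge_zero]])
    show "((\<lambda>s. \<Phi> s z) has_vector_derivative J (G (\<Phi> t z))) (at t)" for z t
      using flow by (simp add: J)
  qed (rule flow0)
  then show ?thesis by blast
qed

section \<open>Monokinetic measures\<close>

lemma measure_support_distr_subset:
  fixes f :: "'a::metric_space \<Rightarrow> 'b::metric_space"
  assumes f: "f \<in> measurable M borel" and "closed C" and "\<And>x. x \<in> space M \<Longrightarrow> f x \<in> C"
  shows "measure_support (distr M borel f) \<subseteq> C"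
proof (rule subsetI, rule ccontr)
  fix z assume z: "z \<in> measure_support (distr M borel f)" "z \<notin> C"
  then obtain e where e: "e > 0" "ball z e \<subseteq> - C"
    using \<open>closed C\<close> by (meson ComplI open_Compl open_contains_ball)
  have "emeasure (distr M borel f) (ball z e) = emeasure M (f -` ball z e \<inter> space M)"
    by (rule emeasure_distr[OF f]) simp
  also have "f -` ball z e \<inter> space M = {}" using e(2) assms(3) by blast
  finally show False using z(1) e(1) by (auto simp: measure_support_def)
qed

text \<open>The image of a measurable set need not be Borel. Up to a null set, however, Z is a
  countable union of compact sets, and the continuous image of such a union is again one.\<close>

lemma carried_by_image:
  fixes F :: "'a::euclidean_space \<Rightarrow> 'b::euclidean_space"
  assumes F: "continuous_on UNIV F" and Z: "Z \<in> sets lebesgue"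
  shows "\<exists>A\<in>sets borel. A \<subseteq> F ` Z \<and> negligible {y\<in>Z. F y \<notin> A}"
proof -
  obtain C T where CT: "fsigma C" "T \<in> null_sets lebesgue" "C \<union> T = Z" "disjnt C T"
    using lebesgue_set_almost_fsigma[OF Z] by blast
  obtain c where c: "\<And>n::nat. closed (c n)" "C = (\<Union>n. c n)"
    using CT(1) by (auto elim!: fsigma.cases)
  have "C = (\<Union>n. \<Union>m. c n \<inter> cball 0 (real m))"
  proof -
    have "(\<Union>m. cball 0 (real m)) = (UNIV :: 'a set)"
    proof (intro equalityI subsetI)
      fix x :: 'a
      obtain m where "norm x \<le> real m" using real_arch_simple by blast
      then show "x \<in> (\<Union>m. cball 0 (real m))" by (intro UN_I[of m]) simp_all
    qed simp
    then have "(\<Union>m. c n \<inter> cball 0 (real m)) = c n" for n by blast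
    then show ?thesis unfolding c(2) by simp
  qed
  then have FC: "F ` C = (\<Union>n. \<Union>m. F ` (c n \<inter> cball 0 (real m)))" by blast
  have "compact (F ` (c n \<inter> cball 0 (real m)))" for n m
    by (intro compact_continuous_image continuous_on_subset[OF F] closed_Int_compact c compact_cball) auto
  then have "F ` C \<in> sets borel"
    unfolding FC by (intro sets.countable_UN) (auto intro: borel_compact)
  moreover have "F ` C \<subseteq> F ` Z" using CT(3) by blast
  moreover have "negligible {y\<in>Z. F y \<notin> F ` C}"
  proof (rule negligible_subset)
    show "negligible T" using CT(2) by (simp add: negligible_iff_null_sets)
    show "{y\<in>Z. F y \<notin> F ` C} \<subseteq> T" using CT(3) by blast
  qed
  ultimately show ?thesis by blast
qed

lemma emeasure_distr_density:
  fixes F :: "'a::euclidean_space \<Rightarrow> 'b::euclidean_space" and r :: "'a \<Rightarrow> ennreal"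
  assumes "F \<in> borel_measurable lebesgue" "r \<in> borel_measurable lebesgue" "A \<in> sets borel"
  shows "emeasure (distr (density lebesgue r) borel F) A = (\<integral>\<^sup>+y. r y * indicator (F -` A) y \<partial>lebesgue)"
proof -
  have FA: "F -` A \<in> sets lebesgue"
    using measurable_sets[OF assms(1,3)] by simp
  have "emeasure (distr (density lebesgue r) borel F) A = emeasure (density lebesgue r) (F -` A)"
    using assms by (subst emeasure_distr) auto
  also have "\<dots> = (\<integral>\<^sup>+y. r y * indicator (F -` A) y \<partial>lebesgue)"
    by (rule emeasure_density[OF assms(2) FA])
  finally show ?thesis .
qed

lemma emeasure_distr_density_eq_0:
  fixes F :: "'a::euclidean_space \<Rightarrow> 'b::euclidean_space" and r :: "'a \<Rightarrow> ennreal"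
  assumes "F \<in> borel_measurable lebesgue" "r \<in> borel_measurable lebesgue" "A \<in> sets borel"
    and "negligible {y. r y \<noteq> 0 \<and> F y \<in> A}"
  shows "emeasure (distr (density lebesgue r) borel F) A = 0"
proof -
  have "AE y in lebesgue. y \<notin> {y. r y \<noteq> 0 \<and> F y \<in> A}"
    using assms(4) by (intro AE_not_in) (simp add: negligible_iff_null_sets)
  then have "(\<integral>\<^sup>+y. r y * indicator (F -` A) y \<partial>lebesgue) = (\<integral>\<^sup>+y. 0 \<partial>(lebesgue :: 'a measure))"
    by (intro nn_integral_cong_AE) (auto elim!: eventually_mono simp: indicator_def)
  then show ?thesis by (simp add: emeasure_distr_density[OF assms(1-3)])
qed

text \<open>The decomposition enters as an arbitrary pair of Borel measures, and "carried by" is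
  expressed through a Borel subset of \<open>Cset\<close>, so that no measurability of
  \<open>Cset\<close> itself is claimed.\<close>

theorem theorem2p8:
  fixes H :: "('n::finite) vec \<times> 'n vec \<Rightarrow> real"
    and G :: "'n vec \<times> 'n vec \<Rightarrow> 'n vec \<times> 'n vec"
    and D2 :: "'n vec \<times> 'n vec \<Rightarrow> ('n vec \<times> 'n vec) \<Rightarrow>\<^sub>L ('n vec \<times> 'n vec)"
    and \<kappa> :: real and h :: "real \<Rightarrow> real"
    and \<Phi> :: "real \<Rightarrow> 'n vec \<times> 'n vec \<Rightarrow> 'n vec \<times> 'n vec"
    and U :: "'n vec \<Rightarrow> 'n vec" and \<rho>in :: "'n vec \<Rightarrow> real"
  assumes grad: "\<And>z. (H has_derivative (\<lambda>v. G z \<bullet> v)) (at z)"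
    and hess: "\<And>z. (G has_derivative blinfun_apply (D2 z)) (at z)"
    and hess_cont: "continuous_on UNIV D2"
    and kappa_pos: "\<kappa> > 0"
    and h_cont: "continuous_on UNIV h" and h_nonneg: "\<And>r. h r \<ge> 0"
    and h_lim: "((\<lambda>r. h r / r) \<longlongrightarrow> 0) at_top"
    and bound_xi: "\<And>x \<xi>. norm (snd (G (x, \<xi>))) \<le> \<kappa> * (1 + norm \<xi>)"
    and bound_x: "\<And>x \<xi>. norm (fst (G (x, \<xi>))) \<le> h (norm x) + \<kappa> * norm \<xi>"
    and bound_hess: "\<And>z. norm (D2 z) \<le> \<kappa>"
    and flow0: "\<And>z. \<Phi> 0 z = z"
    and flow: "\<And>z t. ((\<lambda>s. \<Phi> s z) has_vector_derivative
                  (snd (G (\<Phi> t z)), - fst (G (\<Phi> t z)))) (at t)"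
    and U_cont: "continuous_on UNIV U"
    and U_growth: "((\<lambda>y. norm (U y) / norm y) \<longlongrightarrow> 0) at_infinity"
    and U_reg: "\<And>\<Omega> k l. open \<Omega> \<Longrightarrow> bounded \<Omega> \<Longrightarrow> k \<in> Basis \<Longrightarrow> l \<in> Basis \<Longrightarrow>
                 \<exists>g. weak_partial_on \<Omega> (\<lambda>y. U y \<bullet> k) l g \<and> lorentz_N1 \<Omega> g"
    and rho_meas: "\<rho>in \<in> borel_measurable lebesgue"
    and rho_nonneg: "\<And>x. \<rho>in x \<ge> 0"
    and rho_prob: "(\<integral>\<^sup>+ x. ennreal (\<rho>in x) \<partial>lebesgue) = 1"
  shows "(\<forall>t. measure_support (distr (monokinetic U \<rho>in) borel (\<Phi> t))
              \<subseteq> \<Phi> t ` {(x, U x) | x. True})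
       \<and> (\<forall>t \<rho>a \<rho>s.
            sets \<rho>a = sets borel \<and> sets \<rho>s = sets borel \<and>
            (\<forall>A\<in>sets borel.
               emeasure (distr (distr (monokinetic U \<rho>in) borel (\<Phi> t)) borel fst) A
                 = emeasure \<rho>a A + emeasure \<rho>s A) \<and>
            absolutely_continuous lborel \<rho>a \<and> singular_lebesgue \<rho>s
          \<longrightarrow> (\<exists>A\<in>sets borel. A \<subseteq> Cset \<Phi> U t \<and> emeasure \<rho>s (UNIV - A) = 0)
            \<and> \<rho>a = distr (density lebesgue (\<lambda>y. ennreal (\<rho>in y) * indicator (Pset \<Phi> U t) y))
                          borel (Fmap \<Phi> U t)
            \<and> \<rho>s = distr (density lebesgue (\<lambda>y. ennreal (\<rho>in y) * indicator (Zset \<Phi> U t) y))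
                          borel (Fmap \<Phi> U t))"
proof -
  define E where "E = Eset U"
  have negE: "negligible E" unfolding E_def by (rule negligible_Eset[OF U_cont U_reg])
  obtain V DV \<kappa>' where "lipschitz_flow V DV \<kappa>' \<Phi>"
    using hamiltonian_lipschitz_flow[OF hess hess_cont bound_hess flow0 flow] by blast
  then interpret lipschitz_flow V DV \<kappa>' \<Phi> .
  have graph_cont: "continuous_on UNIV (\<lambda>y. (y, U y))" by (intro continuous_intros U_cont)
  have graph_meas: "(\<lambda>y. (y, U y)) \<in> borel_measurable (density lebesgue (\<lambda>x. ennreal (\<rho>in x)))"
    using graph_cont by (auto intro!: measurable_completion borel_measurable_continuous_onI)
  have flow_meas: "\<Phi> t \<in> borel_measurable borel" for t
    using flow_continuous by (rule borel_measurable_continuous_onI)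
  have lifted: "distr (monokinetic U \<rho>in) borel (\<Phi> t) =
      distr (density lebesgue (\<lambda>x. ennreal (\<rho>in x))) borel (\<lambda>y. \<Phi> t (y, U y))" for t
    unfolding monokinetic_def using distr_distr[OF flow_meas graph_meas] by (simp add: o_def)
  have lift_meas: "(\<lambda>y. \<Phi> t (y, U y)) \<in> borel_measurable (density lebesgue (\<lambda>x. ennreal (\<rho>in x)))" for t
    by (rule measurable_compose[OF graph_meas flow_meas])
  have support: "measure_support (distr (monokinetic U \<rho>in) borel (\<Phi> t)) \<subseteq> \<Phi> t ` {(x, U x) | x. True}" for t
    unfolding lifted
  proof (rule measure_support_distr_subset[OF lift_meas])
    have "closed {p. snd p = U (fst p)}"
      by (intro closed_Collect_eq continuous_intros continuous_on_compose2[OF U_cont]) auto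
    moreover have "{p. snd p = U (fst p)} = {(x, U x) | x. True}" by auto
    ultimately show "closed (\<Phi> t ` {(x, U x) | x. True})" by (simp add: flow_closed_image)
  qed blast
  have decomposition: "(\<exists>A\<in>sets borel. A \<subseteq> Cset \<Phi> U t \<and> emeasure \<rho>s (UNIV - A) = 0)
      \<and> \<rho>a = distr (density lebesgue (\<lambda>y. ennreal (\<rho>in y) * indicator (Pset \<Phi> U t) y)) borel (Fmap \<Phi> U t)
      \<and> \<rho>s = distr (density lebesgue (\<lambda>y. ennreal (\<rho>in y) * indicator (Zset \<Phi> U t) y)) borel (Fmap \<Phi> U t)"
    if sets: "sets \<rho>a = sets borel" "sets \<rho>s = sets borel"
      and total: "\<forall>A\<in>sets borel. emeasure (distr (distr (monokinetic U \<rho>in) borel (\<Phi> t)) borel fst) A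
                 = emeasure \<rho>a A + emeasure \<rho>s A"
      and ac: "absolutely_continuous lborel \<rho>a" and sing: "singular_lebesgue \<rho>s"
    for t and \<rho>a \<rho>s :: "'n vec measure"
  proof -
    define F where "F = Fmap \<Phi> U t"
    define P where "P = Pset \<Phi> U t"
    define Z where "Z = Zset \<Phi> U t"
    have F_eq: "F = (\<lambda>y. fst (\<Phi> t (y, U y)))" by (simp add: F_def Fmap_def fun_eq_iff)
    have F_cont: "continuous_on UNIV F"
      unfolding F_eq by (intro continuous_intros continuous_on_compose2[OF flow_continuous] graph_cont) auto
    have F_meas: "F \<in> borel_measurable lebesgue"
      using F_cont by (auto intro!: measurable_completion borel_measurable_continuous_onI)
    \<comment> \<open>Off E the chain rule applies, so \<open>frechet_derivative\<close> is the
      genuine derivative and not an arbitrary value.\<close>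
    have F_der: "(F has_derivative frechet_derivative F (at y)) (at y)" if "y \<notin> E" for y
    proof -
      have "U differentiable (at y)" using that by (simp add: E_def Eset_def)
      then obtain U' where U': "(U has_derivative U') (at y)" by (auto simp: differentiable_def)
      obtain L where L: "(\<Phi> t has_derivative L) (at (y, U y))"
        using flow_differentiable[of t "(y, U y)"] unfolding differentiable_def by blast
      have "((\<lambda>y. \<Phi> t (y, U y)) has_derivative (\<lambda>h. L (h, U' h))) (at y)"
        by (rule has_derivative_compose[OF has_derivative_Pair[OF has_derivative_ident U'] L])
      then have "F differentiable (at y)"
        unfolding F_eq by (rule differentiableI[OF has_derivative_fst])
      then show ?thesis by (simp add: frechet_derivative_works)
    qed
    have P_iff: "y \<in> P \<longleftrightarrow> y \<notin> E \<and> det (matrix (frechet_derivative F (at y))) \<noteq> 0"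
      and Z_iff: "y \<in> Z \<longleftrightarrow> y \<notin> E \<and> det (matrix (frechet_derivative F (at y))) = 0" for y
      by (auto simp: P_def Z_def Pset_def Zset_def Jac_def E_def F_def)
    \<comment> \<open>Up to E, \<open>P\<close> and \<open>Z\<close> are the sets D \<noteq> 0 and D
      = 0 of a Borel function, which gives their Lebesgue measurability.\<close>
    obtain D where D: "D \<in> borel_measurable borel" "\<And>y f'. (F has_derivative f') (at y) \<Longrightarrow> D y = det (matrix f')"
      using det_derivative_measurable[OF F_cont] by blast
    have Em: "E \<in> sets lebesgue" using negE by (simp add: negligible_imp_sets)
    have D0: "{y. D y = 0} \<in> sets borel" "{y. D y \<noteq> 0} \<in> sets borel"
      using D(1) by measurable
    have "P = {y. D y \<noteq> 0} - E" "Z = {y. D y = 0} - E"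
      using P_iff Z_iff D(2)[OF F_der] by auto
    then have PZ_meas: "P \<in> sets lebesgue" "Z \<in> sets lebesgue"
      using D0 Em by auto
    have P_null: "negligible {y\<in>P. F y \<in> N}" if "negligible N" for N
      by (rule negligible_preimage_nonsingular[OF _ _ that]) (use P_iff F_der in auto)
    have Z_image: "negligible (F ` Z)"
      by (rule negligible_singular_image) (use Z_iff F_der in auto)
    define rP where "rP y = ennreal (\<rho>in y) * indicator P y" for y
    define rZ where "rZ y = ennreal (\<rho>in y) * indicator Z y" for y
    have r_meas: "rP \<in> borel_measurable lebesgue" "rZ \<in> borel_measurable lebesgue" "(\<lambda>y. ennreal (\<rho>in y)) \<in> borel_measurable lebesgue"
      unfolding rP_def rZ_def using rho_meas PZ_meas
      by (auto intro!: borel_measurable_times_ennreal borel_measurable_indicator)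
    define \<nu>P where "\<nu>P = distr (density lebesgue rP) borel F"
    define \<nu>Z where "\<nu>Z = distr (density lebesgue rZ) borel F"
    have fst_meas: "fst \<in> borel_measurable (borel :: ('n vec \<times> 'n vec) measure)"
      by (intro borel_measurable_continuous_onI continuous_intros)
    have spatial: "distr (distr (monokinetic U \<rho>in) borel (\<Phi> t)) borel fst = distr (density lebesgue (\<lambda>x. ennreal (\<rho>in x))) borel F"
      unfolding lifted using distr_distr[OF fst_meas lift_meas] by (simp add: o_def F_eq)
    have AE_E: "AE y in lebesgue. y \<notin> E"
      using negE by (intro AE_not_in) (simp add: negligible_iff_null_sets)
    \<comment> \<open>Off E every point lies in exactly one of \<open>P\<close> and
      \<open>Z\<close>, so the density splits almost everywhere.\<close>
    have sum: "emeasure \<rho>a A + emeasure \<rho>s A = emeasure \<nu>P A + emeasure \<nu>Z A" if A: "A \<in> sets borel" for A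
    proof -
      have FA: "F -` A \<in> sets lebesgue" using measurable_sets[OF F_meas A] by simp
      have "emeasure \<rho>a A + emeasure \<rho>s A = (\<integral>\<^sup>+y. ennreal (\<rho>in y) * indicator (F -` A) y \<partial>lebesgue)"
        using total[rule_format, OF A] unfolding spatial emeasure_distr_density[OF F_meas r_meas(3) A] by (rule sym)
      also have "\<dots> = (\<integral>\<^sup>+y. rP y * indicator (F -` A) y + rZ y * indicator (F -` A) y \<partial>lebesgue)"
      proof (rule nn_integral_cong_AE)
        show "AE y in lebesgue. ennreal (\<rho>in y) * indicator (F -` A) y = rP y * indicator (F -` A) y + rZ y * indicator (F -` A) y"
          using AE_E
        proof eventually_elim
          fix y assume "y \<notin> E"
          then have "y \<in> P \<and> y \<notin> Z \<or> y \<notin> P \<and> y \<in> Z" using P_iff Z_iff by auto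
          then show "ennreal (\<rho>in y) * indicator (F -` A) y = rP y * indicator (F -` A) y + rZ y * indicator (F -` A) y"
            by (auto simp: rP_def rZ_def)
        qed
      qed
      also have "\<dots> = emeasure \<nu>P A + emeasure \<nu>Z A"
        unfolding \<nu>P_def \<nu>Z_def emeasure_distr_density[OF F_meas r_meas(1) A] emeasure_distr_density[OF F_meas r_meas(2) A]
        using r_meas FA by (intro nn_integral_add borel_measurable_times_ennreal borel_measurable_indicator)
      finally show ?thesis .
    qed
    have P_ac: "null_sets lborel \<subseteq> null_sets \<nu>P"
    proof
      fix N :: "'n vec set" assume N: "N \<in> null_sets lborel"
      then have Nb: "N \<in> sets borel" by (auto simp: null_sets_def)
      have "negligible N" using N by (simp add: negligible_iff_null_sets null_sets_completionI)
      then have "negligible {y. rP y \<noteq> 0 \<and> F y \<in> N}"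
        by (rule negligible_subset[OF P_null]) (auto simp: rP_def indicator_def split: if_splits)
      then have "emeasure \<nu>P N = 0"
        unfolding \<nu>P_def by (rule emeasure_distr_density_eq_0[OF F_meas r_meas(1) Nb])
      then show "N \<in> null_sets \<nu>P" using Nb by (auto simp: null_sets_def \<nu>P_def)
    qed
    \<comment> \<open>The null image of \<open>Z\<close> is enlarged to a Borel null set, since a
      carrier of \<open>\<nu>Z\<close> has to be measurable.\<close>
    obtain S' where S': "S' \<in> null_sets lborel" "F ` Z \<subseteq> S'"
      using Z_image by (auto simp: negligible_iff_null_sets null_sets_completion_iff2)
    have S'b: "S' \<in> sets borel" using S'(1) by (auto simp: null_sets_def)
    have Z_sing: "emeasure \<nu>Z (UNIV - S') = 0"
      unfolding \<nu>Z_def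
    proof (rule emeasure_distr_density_eq_0[OF F_meas r_meas(2)])
      have "{y. rZ y \<noteq> 0 \<and> F y \<in> UNIV - S'} = {}" using S'(2) by (auto simp: rZ_def indicator_def)
      then show "negligible {y. rZ y \<noteq> 0 \<and> F y \<in> UNIV - S'}" by (simp only: negligible_empty)
    qed (use S'b in auto)
    obtain S where S: "S \<in> sets borel" "emeasure lborel S = 0" "emeasure \<rho>s (UNIV - S) = 0"
      using sing unfolding singular_lebesgue_def by blast
    have Sn: "S \<in> null_sets lborel" using S by (auto simp: null_sets_def)
    have \<nu>: "sets \<nu>P = sets borel" "sets \<nu>Z = sets borel" by (simp_all add: \<nu>P_def \<nu>Z_def)
    \<comment> \<open>Identifies the given pair with the two push-forwards; from here on facts about
      \<open>\<nu>Z\<close> are facts about \<open>\<rho>s\<close>.\<close>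
    note dec = lebesgue_decomposition_unique[OF sets \<nu> sum ac[unfolded absolutely_continuous_def] P_ac Sn S(3) S'(1) Z_sing]
    \<comment> \<open>A second carrier is needed: \<open>S'\<close> contains the image of
      \<open>Z\<close> and may stick out of \<open>Cset\<close>, whereas \<open>A\<close> lies
      inside that image.\<close>
    obtain A where A: "A \<in> sets borel" "A \<subseteq> F ` Z" "negligible {y\<in>Z. F y \<notin> A}"
      using carried_by_image[OF F_cont PZ_meas(2)] by blast
    have "emeasure \<nu>Z (UNIV - A) = 0"
      unfolding \<nu>Z_def
    proof (rule emeasure_distr_density_eq_0[OF F_meas r_meas(2)])
      show "negligible {y. rZ y \<noteq> 0 \<and> F y \<in> UNIV - A}"
        by (rule negligible_subset[OF A(3)]) (auto simp: rZ_def indicator_def split: if_splits)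
    qed (use A(1) in auto)
    moreover have "A \<subseteq> Cset \<Phi> U t" using A(2) by (auto simp: Cset_def Z_def F_def)
    ultimately have "\<exists>A\<in>sets borel. A \<subseteq> Cset \<Phi> U t \<and> emeasure \<rho>s (UNIV - A) = 0"
      using A(1) dec(2) by auto
    moreover have "\<nu>P = distr (density lebesgue (\<lambda>y. ennreal (\<rho>in y) * indicator (Pset \<Phi> U t) y)) borel (Fmap \<Phi> U t)"
      "\<nu>Z = distr (density lebesgue (\<lambda>y. ennreal (\<rho>in y) * indicator (Zset \<Phi> U t) y)) borel (Fmap \<Phi> U t)"
      by (simp_all add: \<nu>P_def \<nu>Z_def rP_def[abs_def] rZ_def[abs_def] P_def Z_def F_def)
    ultimately show ?thesis using dec by simp
  qed
  show ?thesis
    using support decomposition by blast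
qed

end
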